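(* Let $E$ be a Banach lattice, identified with its canonical image in $E''$. Then: (1) $E$ has order continuous norm if and only if $(E')^\sim_{uaw^*}=E$; (2) $E'$ has order continuous norm if and only if $E^\sim_{uaw}=E^\sim_d=E^\sim_{un}=E'$; (3) $E$ and $E'$ both have order continuous norm if and only if $E^\sim_{uo}=E^\sim_{uaw}=E^\sim_d=E^\sim_{un}=E'$; (4) $E$ is reflexive if and only if $(E')^\sim_{uaw^*}=(E')^\sim_{uo}=(E')^\sim_{uaw}=(E')^\sim_{d}=(E')^\sim_{un}=E''$.
   Context: Order convergence: a net $(x_\alpha)$ in a Riesz space is order convergent to $x$ if there is a net $(y_\beta)$, possibly over a different index set, with $y_\beta\downarrow 0$ such that for each $\beta$ there is $\alpha_0$ with $|x_\alpha-x|\le y_\beta$ for all $\alpha\ge\alpha_0$. A net $(x_\alpha)$ is disjoint if $|x_\alpha|\wedge|x_\beta|=0$ whenever $\alpha\neq\beta$. A net $(x_\alpha)$ in a Banach lattice $X$ is $uo$-null (resp. $un$-null, $uaw$-null) if for every $u\in X_+$ the net $(|x_\alpha|\wedge u)$ converges to $0$ in order (resp. in norm, weakly). A net $(x'_\alpha)$ in the dual $E'$ is $uaw^*$-null if $|x'_\alpha|\wedge u'\to0$ in the weak* topology $\sigma(E',E)$ for every $u'\in E'_+$. Duals: for a Banach lattice $X$, $X'$ is the norm dual; $X^\sim_{uo}$ is the set of linear functionals $f$ on $X$ with $f(x_\alpha)\to0$ for every norm bounded $uo$-null net in $X$; $X^\sim_d$ (resp. $X^\sim_{un}$, $X^\sim_{uaw}$)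 is the set of norm bounded linear functionals $f$ on $X$ with $f(x_\alpha)\to0$ for every norm bounded disjoint (resp. $un$-null, $uaw$-null) net $(x_\alpha)$ in $X$. These are applied with $X=E$ and $X=E'$. $(E')^\sim_{uaw^*}$ is the set of norm bounded linear functionals $f$ on $E'$ with $f(x'_\alpha)\to0$ for every norm bounded $uaw^*$-null net $(x'_\alpha)$ in $E'$. A Banach lattice has order continuous norm (is order continuous) if $\|x_\alpha\|\to0$ for every net $x_\alpha\downarrow0$.
   Formalization: In the definition of the dual for disjoint nets, only disjoint nets whose index set has no greatest element are considered; otherwise a one-element net is vacuously disjoint, this dual is {0}, and (2)–(4) fail, for example for E = ℝ. *)

theory Defs
  imports "HOL-Analysis.Analysis" "HOL-Library.Lattice_Algebras"
begin

section \<open>Banach lattices\<close>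

class banach_lattice = lattice_ab_group_add_abs + ordered_real_vector + banach +
  assumes norm_mono_abs: "\<bar>x\<bar> \<le> \<bar>y\<bar> \<Longrightarrow> norm x \<le> norm y"

text \<open>
  The norm dual of \<open>E\<close> is \<open>E \<Rightarrow>\<^sub>L real\<close>. Type class arities cannot mention the type \<open>real\<close>
  itself, and \<open>E \<Rightarrow>\<^sub>L F\<close> is not a lattice for a general Banach lattice \<open>F\<close>. The following class,
  of Banach lattices that are isometrically and order isomorphic to the real line, has the sole
  purpose of making \<open>E \<Rightarrow>\<^sub>L real\<close> an instance of \<open>banach_lattice\<close>.
\<close>

class real_line = banach_lattice +
  assumes ex_real_iso: "\<exists>\<phi>::'a \<Rightarrow> real. bij \<phi> \<and> (\<forall>x y. \<phi> (x + y) = \<phi> x + \<phi> y) \<and>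
    (\<forall>c x. \<phi> (c *\<^sub>R x) = c * \<phi> x) \<and> (\<forall>x y. x \<le> y \<longleftrightarrow> \<phi> x \<le> \<phi> y) \<and> (\<forall>x. \<bar>\<phi> x\<bar> = norm x)"

instance real :: banach_lattice
  by standard simp

instance real :: real_line
  by standard (rule exI[of _ "\<lambda>x. x"], auto intro: bij_id[unfolded id_def])


section \<open>The dual Banach lattice\<close>

lemma norm_abs_bl [simp]: "norm \<bar>x::'a::banach_lattice\<bar> = norm x"
  by (intro antisym norm_mono_abs) simp_all

lemma eq_pprt_diff_pprt: "x = sup x 0 - sup (-x) (0::'a::lattice_ab_group_add)"
proof -
  have "x = pprt x + nprt x" by (rule prts)
  moreover have "nprt x = - pprt (-x)" by (simp add: pprt_neg)
  ultimately show ?thesis by (simp add: pprt_def)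
qed

lemma abs_eq_pprt_add: "\<bar>x\<bar> = sup x 0 + sup (-x) (0::'a::lattice_ab_group_add_abs)"
  using abs_prts[of x] pprt_neg[of x] by (simp add: pprt_def)

lemma diff_eq_diff_swap: "a - b = c - d \<Longrightarrow> a + d = b + (c::'a::ab_group_add)"
  by (simp add: algebra_simps)

lemma norm_sup_zero_le: "norm (sup x 0) \<le> norm (x::'a::banach_lattice)"
  by (rule norm_mono_abs) (metis abs_ge_self abs_ge_zero abs_of_nonneg le_supI sup.cobounded2)

lemma riesz_decomposition:
  fixes x y z :: "'a::lattice_ab_group_add"
  assumes "0 \<le> x" "0 \<le> y" "0 \<le> z" "z \<le> x + y"
  obtains u v where "z = u + v" "0 \<le> u" "u \<le> x" "0 \<le> v" "v \<le> y"
proof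
  show "z = inf z x + (z - inf z x)" by (metis add.commute diff_add_cancel)
  show "0 \<le> inf z x" "inf z x \<le> x" using assms by auto
  show "0 \<le> z - inf z x" unfolding le_diff_eq by simp
  have "z - y \<le> inf z x" using assms by (auto simp: algebra_simps)
  then show "z - inf z x \<le> y" by (simp only: diff_le_eq add.commute)
qed

lemma additive_on_cone_extends:
  fixes p :: "'a::banach_lattice \<Rightarrow> real"
  assumes add: "\<And>x y. 0 \<le> x \<Longrightarrow> 0 \<le> y \<Longrightarrow> p (x + y) = p x + p y"
    and scale: "\<And>c x. 0 \<le> c \<Longrightarrow> 0 \<le> x \<Longrightarrow> p (c *\<^sub>R x) = c * p x"
    and bnd: "\<And>x. 0 \<le> x \<Longrightarrow> \<bar>p x\<bar> \<le> C * norm x"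
    and C: "0 \<le> C"
  shows "\<exists>h::'a \<Rightarrow>\<^sub>L real. \<forall>x\<ge>0. h x = p x"
proof -
  define q where "q x = p (sup x 0) - p (sup (-x) 0)" for x
  have q_diff: "q (a - b) = p a - p b" if "0 \<le> a" "0 \<le> b" for a b
  proof -
    have "a - b = sup (a - b) 0 - sup (-(a-b)) 0" by (rule eq_pprt_diff_pprt)
    then have "a + sup (-(a-b)) 0 = b + sup (a - b) 0" by (rule diff_eq_diff_swap)
    then have "p a + p (sup (-(a-b)) 0) = p b + p (sup (a - b) 0)"
      unfolding add[OF that(1) sup_ge2, symmetric] add[OF that(2) sup_ge2, symmetric]
      by (rule arg_cong)
    then show ?thesis unfolding q_def by linarith
  qed
  have q_pos: "q x = p x" if "0 \<le> x" for x
    using q_diff[of x 0] that add[of 0 0] by simp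
  have q_add: "q (x + y) = q x + q y" for x y
  proof -
    have "x + y = (sup x 0 + sup y 0) - (sup (-x) 0 + sup (-y) 0)"
      unfolding add_diff_add by (intro arg_cong2[where f = "(+)"] eq_pprt_diff_pprt)
    then have "q (x + y) = p (sup x 0 + sup y 0) - p (sup (-x) 0 + sup (-y) 0)"
      using q_diff[of "sup x 0 + sup y 0" "sup (-x) 0 + sup (-y) 0"]
      by (simp only: add_nonneg_nonneg sup_ge2)
    then show ?thesis by (simp add: add q_def)
  qed
  have q_scale_pos: "q (c *\<^sub>R x) = c * q x" if "0 \<le> c" for c x
  proof -
    have "c *\<^sub>R x = c *\<^sub>R sup x 0 - c *\<^sub>R sup (-x) 0"
      unfolding scaleR_right_diff_distrib[symmetric]
      by (intro arg_cong[where f = "\<lambda>z. c *\<^sub>R z"] eq_pprt_diff_pprt)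
    then have "q (c *\<^sub>R x) = p (c *\<^sub>R sup x 0) - p (c *\<^sub>R sup (-x) 0)"
      using q_diff[of "c *\<^sub>R sup x 0" "c *\<^sub>R sup (-x) 0"] that
      by (simp only: scaleR_nonneg_nonneg sup_ge2)
    then show ?thesis using that by (simp add: scale q_def algebra_simps)
  qed
  have q_neg: "q (- x) = - q x" for x by (simp add: q_def)
  have q_scale: "q (c *\<^sub>R x) = c * q x" for c x
  proof (cases "0 \<le> c")
    case False
    then have "q (c *\<^sub>R x) = - q ((-c) *\<^sub>R x)" using q_neg[of "(-c) *\<^sub>R x"] by simp
    then show ?thesis using q_scale_pos[of "-c" x] False by simp
  qed (rule q_scale_pos)
  have "\<bar>q x\<bar> \<le> norm x * (2 * C)" for x
  proof -
    have "\<bar>q x\<bar> \<le> \<bar>p (sup x 0)\<bar> + \<bar>p (sup (-x) 0)\<bar>" by (simp add: q_def)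
    also have "\<dots> \<le> C * norm (sup x 0) + C * norm (sup (-x) 0)" by (intro add_mono bnd) auto
    also have "\<dots> \<le> C * norm x + C * norm (-x)"
      by (intro add_mono mult_left_mono norm_sup_zero_le C)
    finally show ?thesis by (simp add: mult.commute mult.left_commute)
  qed
  then have "bounded_linear q"
    by (intro bounded_linear_intro[where K = "2 * C"]) (auto simp: q_add q_scale)
  then show ?thesis by (intro exI[of _ "Blinfun q"]) (auto simp: bounded_linear_Blinfun_apply q_pos)
qed

text \<open>The Riesz--Kantorovich formula for the positive part of a functional.\<close>

lemma functional_pprt:
  fixes f :: "'a::banach_lattice \<Rightarrow>\<^sub>L real"
  shows "\<exists>h::'a \<Rightarrow>\<^sub>L real. \<forall>x\<ge>0. h x = (SUP y\<in>{0..x}. f y)"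
proof (rule additive_on_cone_extends)
  have norm_le: "norm y \<le> norm x" if "y \<in> {0..x}" for x y :: 'a
    using that by (intro norm_mono_abs) (auto simp: abs_of_nonneg order_trans)
  have f_le: "\<bar>f y\<bar> \<le> norm f * norm x" if "y \<in> {0..x}" for x y
    using norm_blinfun[of f y] mult_left_mono[OF norm_le[OF that] norm_ge_zero[of f]] by simp
  have bdd: "bdd_above (blinfun_apply f ` {0..x})" for x
    using f_le by (intro bdd_aboveI[of _ "norm f * norm x"]) (auto simp: abs_le_iff)
  have ge: "f y \<le> (SUP y\<in>{0..x}. f y)" if "0 \<le> y" "y \<le> x" for x y
    using bdd that by (intro cSUP_upper) auto
  show "(SUP z\<in>{0..x + y}. f z) = (SUP z\<in>{0..x}. f z) + (SUP z\<in>{0..y}. f z)"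
    if xy: "0 \<le> x" "0 \<le> y" for x y
  proof (rule antisym)
    show "(SUP z\<in>{0..x + y}. f z) \<le> (SUP z\<in>{0..x}. f z) + (SUP z\<in>{0..y}. f z)"
    proof (rule cSUP_least)
      show "{0..x + y} \<noteq> {}" using xy by simp
      fix z assume "z \<in> {0..x + y}"
      then obtain u v where "z = u + v" "0 \<le> u" "u \<le> x" "0 \<le> v" "v \<le> y"
        using riesz_decomposition[of x y z] xy by auto
      then show "f z \<le> (SUP z\<in>{0..x}. f z) + (SUP z\<in>{0..y}. f z)"
        by (simp add: blinfun.add_right add_mono ge)
    qed
    have *: "f u \<le> (SUP z\<in>{0..x + y}. f z) - f v" if "u \<in> {0..x}" "v \<in> {0..y}" for u v
      using ge[of "u + v" "x + y"] that by (simp add: blinfun.add_right add_mono)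
    then have "(SUP z\<in>{0..x}. f z) \<le> (SUP z\<in>{0..x + y}. f z) - f v" if "v \<in> {0..y}" for v
      using that xy by (intro cSUP_least) auto
    then have "f v \<le> (SUP z\<in>{0..x + y}. f z) - (SUP z\<in>{0..x}. f z)" if "v \<in> {0..y}" for v
      using that by fastforce
    then have "(SUP z\<in>{0..y}. f z) \<le> (SUP z\<in>{0..x + y}. f z) - (SUP z\<in>{0..x}. f z)"
      using xy by (intro cSUP_least) auto
    then show "(SUP z\<in>{0..x}. f z) + (SUP z\<in>{0..y}. f z) \<le> (SUP z\<in>{0..x + y}. f z)" by simp
  qed
  have le: "c * (SUP y\<in>{0..x}. f y) \<le> (SUP y\<in>{0..c *\<^sub>R x}. f y)" if "0 < c" "0 \<le> x" for c x
  proof -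
    have "f y \<le> (SUP y\<in>{0..c *\<^sub>R x}. f y) / c" if "y \<in> {0..x}" for y
      using ge[of "c *\<^sub>R y" "c *\<^sub>R x"] that \<open>0 < c\<close>
      by (simp add: blinfun.scaleR_right scaleR_left_mono scaleR_nonneg_nonneg field_simps)
    then have "(SUP y\<in>{0..x}. f y) \<le> (SUP y\<in>{0..c *\<^sub>R x}. f y) / c"
      using that by (intro cSUP_least) auto
    then show ?thesis using that by (simp add: field_simps)
  qed
  show "(SUP y\<in>{0..c *\<^sub>R x}. f y) = c * (SUP y\<in>{0..x}. f y)" if "0 \<le> c" "0 \<le> x" for c x
  proof (cases "c = 0")
    case False
    then have c: "0 < c" using that by simp
    have "(1/c) * (SUP y\<in>{0..c *\<^sub>R x}. f y) \<le> (SUP y\<in>{0..x}. f y)"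
      using le[of "1/c" "c *\<^sub>R x"] c that by (simp add: scaleR_nonneg_nonneg)
    then show ?thesis using le[OF c that(2)] c by (intro antisym) (auto simp: field_simps)
  qed simp
  show "\<bar>SUP y\<in>{0..x}. f y\<bar> \<le> norm f * norm x" if "0 \<le> x" for x
  proof (rule abs_leI)
    show "(SUP y\<in>{0..x}. f y) \<le> norm f * norm x"
      using that f_le by (intro cSUP_least) (auto simp: abs_le_iff)
    show "- (SUP y\<in>{0..x}. f y) \<le> norm f * norm x"
      using ge[OF order_refl that] mult_nonneg_nonneg[OF norm_ge_zero[of f] norm_ge_zero[of x]]
      unfolding blinfun.zero_right by linarith
  qed
  show "0 \<le> norm f" by simp
qed

definition functional_le :: "('a::banach_lattice \<Rightarrow>\<^sub>L 'b::real_line) \<Rightarrow> ('a \<Rightarrow>\<^sub>L 'b) \<Rightarrow> bool"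
  where "functional_le f g \<longleftrightarrow> (\<forall>x\<ge>0. f x \<le> g x)"

lemma functional_le_antisym:
  assumes "functional_le f g" "functional_le g f"
  shows "f = g"
proof (rule blinfun_eqI)
  fix x
  have pos: "f y = g y" if "0 \<le> y" for y
    using assms that by (simp add: functional_le_def order.antisym)
  show "f x = g x"
    using eq_pprt_diff_pprt[of x] pos by (metis blinfun.diff_right sup.cobounded2)
qed

lemma functional_sup_real:
  fixes f g :: "'a::banach_lattice \<Rightarrow>\<^sub>L real"
  shows "\<exists>h. functional_le f h \<and> functional_le g h \<and>
    (\<forall>k. functional_le f k \<and> functional_le g k \<longrightarrow> functional_le h k) \<and>
    (g = - f \<longrightarrow> (\<forall>x\<ge>0. h x \<le> norm f * norm x))"
proof -
  obtain p :: "'a \<Rightarrow>\<^sub>L real" where p: "\<And>x. 0 \<le> x \<Longrightarrow> p x = (SUP y\<in>{0..x}. (f - g) y)"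
    using functional_pprt[of "f - g"] by blast
  have norm_le: "norm y \<le> norm x" if "y \<in> {0..x}" for x y :: 'a
    using that by (intro norm_mono_abs) (auto simp: abs_of_nonneg order_trans)
  have bdd: "bdd_above (blinfun_apply k ` {0..x})" for x and k :: "'a \<Rightarrow>\<^sub>L real"
  proof (rule bdd_aboveI)
    fix t assume "t \<in> blinfun_apply k ` {0..x}"
    then obtain y where y: "t = k y" "y \<in> {0..x}" by auto
    show "t \<le> norm k * norm x"
      using norm_blinfun[of k y] mult_left_mono[OF norm_le[OF y(2)] norm_ge_zero[of k]] y by simp
  qed
  have ge: "(f - g) y \<le> p x" if "0 \<le> y" "y \<le> x" for x y
    using that bdd p[of x] by (auto intro!: cSUP_upper order_trans[OF that])
  have "functional_le f (g + p)"
    using ge by (force simp: functional_le_def blinfun.add_left blinfun.diff_left)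
  moreover have "functional_le g (g + p)"
    using ge[of 0] by (auto simp: functional_le_def blinfun.add_left)
  moreover have "functional_le (g + p) k" if k: "functional_le f k" "functional_le g k" for k
    unfolding functional_le_def
  proof (intro allI impI)
    fix x :: 'a assume x: "0 \<le> x"
    have "(f - g) y \<le> k x - g x" if "y \<in> {0..x}" for y
    proof -
      have "f y \<le> k y" "g (x - y) \<le> k (x - y)" using k that by (auto simp: functional_le_def)
      then show ?thesis by (simp add: blinfun.diff_left blinfun.diff_right)
    qed
    then have "p x \<le> k x - g x" using x by (auto simp: p intro!: cSUP_least)
    then show "(g + p) x \<le> k x" by (simp add: blinfun.add_left)
  qed
  moreover have "(g + p) x \<le> norm f * norm x" if "g = - f" "0 \<le> x" for x
  proof -
    have "(f - g) y \<le> norm f * norm x + f x" if y: "y \<in> {0..x}" for y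
    proof -
      have "\<bar>2 *\<^sub>R y - x\<bar> \<le> \<bar>x\<bar>"
        using y \<open>0 \<le> x\<close> by (intro abs_leI) (auto simp: abs_of_nonneg algebra_simps scaleR_2 add_mono)
      then have "norm (2 *\<^sub>R y - x) \<le> norm x" by (rule norm_mono_abs)
      then have "f (2 *\<^sub>R y - x) \<le> norm f * norm x"
        using norm_blinfun[of f "2 *\<^sub>R y - x"]
        by (smt (verit) mult_left_mono norm_ge_zero real_norm_def)
      then show ?thesis
        by (simp add: \<open>g = - f\<close> blinfun.diff_right blinfun.scaleR_right blinfun.add_left)
    qed
    then have "p x \<le> norm f * norm x + f x" using that by (auto simp: p intro!: cSUP_least)
    then show ?thesis by (simp add: \<open>g = - f\<close> blinfun.add_left blinfun.diff_left)
  qed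
  ultimately show ?thesis by blast
qed

lemma functional_sup:
  fixes f g :: "'a::banach_lattice \<Rightarrow>\<^sub>L 'b::real_line"
  shows "\<exists>h. functional_le f h \<and> functional_le g h \<and>
    (\<forall>k. functional_le f k \<and> functional_le g k \<longrightarrow> functional_le h k) \<and>
    (g = - f \<longrightarrow> (\<forall>x\<ge>0. norm (h x) \<le> norm f * norm x))"
proof -
  obtain \<phi> :: "'b \<Rightarrow> real" where bij: "bij \<phi>" and add: "\<And>x y. \<phi> (x + y) = \<phi> x + \<phi> y"
    and scale: "\<And>c x. \<phi> (c *\<^sub>R x) = c * \<phi> x" and le: "\<And>x y. x \<le> y \<longleftrightarrow> \<phi> x \<le> \<phi> y"
    and nrm: "\<And>x. \<bar>\<phi> x\<bar> = norm x"
    using ex_real_iso by metis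
  define \<psi> where "\<psi> = inv \<phi>"
  have \<phi>\<psi>: "\<phi> (\<psi> t) = t" for t using bij by (simp add: \<psi>_def bij_is_surj surj_f_inv_f)
  have \<psi>\<phi>: "\<psi> (\<phi> x) = x" for x using bij by (simp add: \<psi>_def bij_is_inj)
  have bl: "bounded_linear \<phi>"
    by (rule bounded_linear_intro[where K = 1]) (auto simp: add scale nrm)
  have bl': "bounded_linear \<psi>"
  proof (rule bounded_linear_intro[where K = 1])
    show "\<psi> (s + t) = \<psi> s + \<psi> t" for s t using add[of "\<psi> s" "\<psi> t"] \<psi>\<phi> \<phi>\<psi> by metis
    show "\<psi> (c *\<^sub>R t) = c *\<^sub>R \<psi> t" for c t
      using scale[of c "\<psi> t"] \<psi>\<phi>[of "c *\<^sub>R \<psi> t"] by (simp add: \<phi>\<psi>)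
    show "norm (\<psi> t) \<le> norm t * 1" for t using nrm[of "\<psi> t"] by (simp add: \<phi>\<psi>)
  qed
  define T where "T k = Blinfun \<phi> o\<^sub>L k" for k :: "'a \<Rightarrow>\<^sub>L 'b"
  define S where "S k = Blinfun \<psi> o\<^sub>L k" for k :: "'a \<Rightarrow>\<^sub>L real"
  have T: "T k x = \<phi> (k x)" for k x by (simp add: T_def bounded_linear_Blinfun_apply bl)
  have S: "S k x = \<psi> (k x)" for k x by (simp add: S_def bounded_linear_Blinfun_apply bl')
  have TS: "T (S k) = k" for k by (rule blinfun_eqI) (simp add: T S \<phi>\<psi>)
  have Tle: "functional_le (T k) (T l) \<longleftrightarrow> functional_le k l" for k l
    by (simp add: functional_le_def T le)
  have T_minus: "T (- k) = - T k" for k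
    using scale[of "-1"] by (intro blinfun_eqI) (simp add: T blinfun.minus_left)
  have T_norm: "norm (T k) \<le> norm k" for k
    by (rule norm_blinfun_bound) (auto simp: T nrm norm_blinfun)
  obtain h where h: "functional_le (T f) h" "functional_le (T g) h"
    "\<And>k. functional_le (T f) k \<and> functional_le (T g) k \<Longrightarrow> functional_le h k"
    "g = - f \<Longrightarrow> \<forall>x\<ge>0. h x \<le> norm (T f) * norm x"
    using functional_sup_real[of "T f" "T g"] T_minus by metis
  have "norm (S h x) \<le> norm f * norm x" if gf: "g = - f" and x: "0 \<le> x" for x
  proof -
    have "T f x \<le> h x" "- T f x \<le> h x"
      using h(1,2) gf x T_minus by (auto simp: functional_le_def blinfun.minus_left)
    then have "0 \<le> h x" by linarith
    have "norm (S h x) = \<bar>h x\<bar>" using nrm \<phi>\<psi> S by metis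
    also have "\<dots> \<le> norm (T f) * norm x" using h(4)[OF gf] x \<open>0 \<le> h x\<close> by simp
    also have "\<dots> \<le> norm f * norm x" by (intro mult_right_mono T_norm) simp
    finally show ?thesis .
  qed
  moreover have "functional_le (S h) k" if "functional_le f k" "functional_le g k" for k
    using h(3)[of "T k"] that Tle TS by metis
  ultimately show ?thesis
    using h(1,2) Tle TS by (intro exI[of _ "S h"]) (metis)
qed

instantiation blinfun :: (banach_lattice, real_line) banach_lattice
begin

definition "f \<le> g \<longleftrightarrow> (\<forall>x\<ge>0. blinfun_apply f x \<le> blinfun_apply g x)"
definition "f < g \<longleftrightarrow> f \<le> g \<and> \<not> g \<le> f" for f g :: "'a \<Rightarrow>\<^sub>L 'b"
definition "sup f g = (THE h. f \<le> h \<and> g \<le> h \<and> (\<forall>k. f \<le> k \<and> g \<le> k \<longrightarrow> h \<le> k))"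
  for f g :: "'a \<Rightarrow>\<^sub>L 'b"
definition "inf f g = (THE h. h \<le> f \<and> h \<le> g \<and> (\<forall>k. k \<le> f \<and> k \<le> g \<longrightarrow> k \<le> h))"
  for f g :: "'a \<Rightarrow>\<^sub>L 'b"
definition "\<bar>f\<bar> = sup f (- f)" for f :: "'a \<Rightarrow>\<^sub>L 'b"

instance
proof
  fix f g h :: "'a \<Rightarrow>\<^sub>L 'b" and c d :: real
  have le: "f \<le> g \<longleftrightarrow> functional_le f g" for f g :: "'a \<Rightarrow>\<^sub>L 'b"
    by (simp add: less_eq_blinfun_def functional_le_def)
  have asym: "f = g" if "f \<le> g" "g \<le> f" for f g :: "'a \<Rightarrow>\<^sub>L 'b"
    using that functional_le_antisym le by blast
  have sup: "f \<le> sup f g \<and> g \<le> sup f g \<and> (\<forall>k. f \<le> k \<and> g \<le> k \<longrightarrow> sup f g \<le> k)"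
    for f g :: "'a \<Rightarrow>\<^sub>L 'b"
    unfolding sup_blinfun_def
    by (rule theI') (use functional_sup[of f g] asym in \<open>metis le\<close>)
  have neg: "- f \<le> - g \<longleftrightarrow> g \<le> f" for f g :: "'a \<Rightarrow>\<^sub>L 'b"
    by (simp add: less_eq_blinfun_def blinfun.minus_left)
  have inf: "inf f g \<le> f \<and> inf f g \<le> g \<and> (\<forall>k. k \<le> f \<and> k \<le> g \<longrightarrow> k \<le> inf f g)"
    for f g :: "'a \<Rightarrow>\<^sub>L 'b"
    unfolding inf_blinfun_def
  proof (rule theI')
    have "- sup (- f) (- g) \<le> f \<and> - sup (- f) (- g) \<le> g \<and>
        (\<forall>k. k \<le> f \<and> k \<le> g \<longrightarrow> k \<le> - sup (- f) (- g))"
      using sup[of "- f" "- g"] neg by (metis minus_minus)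
    then show "\<exists>!h. h \<le> f \<and> h \<le> g \<and> (\<forall>k. k \<le> f \<and> k \<le> g \<longrightarrow> k \<le> h)"
      using asym by metis
  qed
  have abs_bound: "norm (\<bar>f\<bar> x) \<le> norm f * norm x" if "0 \<le> x" for x and f :: "'a \<Rightarrow>\<^sub>L 'b"
  proof -
    obtain h where h: "f \<le> h" "- f \<le> h" "\<And>k. f \<le> k \<and> - f \<le> k \<Longrightarrow> h \<le> k"
      "\<forall>x\<ge>0. norm (h x) \<le> norm f * norm x"
      using functional_sup[of f "- f"] unfolding le by blast
    then have "\<bar>f\<bar> = h" using sup[of f "- f"] asym by (metis abs_blinfun_def)
    then show ?thesis using h that by simp
  qed
  have abs_le: "\<bar>f x\<bar> \<le> \<bar>f\<bar> \<bar>x\<bar>" for x and f :: "'a \<Rightarrow>\<^sub>L 'b"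
  proof -
    have pos: "\<bar>f y\<bar> \<le> \<bar>f\<bar> y" if "0 \<le> y" for y
      using sup[of f "- f"] that
      by (auto simp: abs_blinfun_def less_eq_blinfun_def blinfun.minus_left intro!: abs_leI)
    have "f x = f (sup x 0) - f (sup (-x) 0)"
      using eq_pprt_diff_pprt[of x] by (metis blinfun.diff_right)
    then have "\<bar>f x\<bar> \<le> \<bar>f (sup x 0)\<bar> + \<bar>f (sup (-x) 0)\<bar>"
      by (metis abs_triangle_ineq4)
    also have "\<dots> \<le> \<bar>f\<bar> (sup x 0) + \<bar>f\<bar> (sup (-x) 0)" by (intro add_mono pos) auto
    also have "\<dots> = \<bar>f\<bar> \<bar>x\<bar>" by (simp only: abs_eq_pprt_add blinfun.add_right)
    finally show ?thesis .
  qed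
  show "f < g \<longleftrightarrow> f \<le> g \<and> \<not> g \<le> f" by (rule less_blinfun_def)
  show "f \<le> f" by (simp add: less_eq_blinfun_def)
  show "f \<le> g \<Longrightarrow> g \<le> h \<Longrightarrow> f \<le> h" by (auto simp: less_eq_blinfun_def intro: order_trans)
  show "f \<le> g \<Longrightarrow> g \<le> f \<Longrightarrow> f = g" by (rule asym)
  show "f \<le> g \<Longrightarrow> h + f \<le> h + g" by (simp add: less_eq_blinfun_def blinfun.add_left)
  show "inf f g \<le> f" "inf f g \<le> g" "f \<le> g \<Longrightarrow> f \<le> h \<Longrightarrow> f \<le> inf g h" using inf by blast+
  show "f \<le> sup f g" "g \<le> sup f g" using sup by blast+
  show "f \<le> h \<Longrightarrow> g \<le> h \<Longrightarrow> sup f g \<le> h" using sup by blast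
  show "\<bar>f\<bar> = sup f (- f)" by (rule abs_blinfun_def)
  show "f \<le> g \<Longrightarrow> 0 \<le> c \<Longrightarrow> c *\<^sub>R f \<le> c *\<^sub>R g"
    by (simp add: less_eq_blinfun_def blinfun.scaleR_left scaleR_left_mono)
  show "c \<le> d \<Longrightarrow> 0 \<le> f \<Longrightarrow> c *\<^sub>R f \<le> d *\<^sub>R f"
    by (simp add: less_eq_blinfun_def blinfun.scaleR_left scaleR_right_mono)
  show "norm f \<le> norm g" if fg: "\<bar>f\<bar> \<le> \<bar>g\<bar>"
  proof (rule norm_blinfun_bound)
    fix x
    have *: "\<bar>f x\<bar> \<le> \<bar>g\<bar> \<bar>x\<bar>"
      using abs_le[of f x] fg by (auto simp: less_eq_blinfun_def intro: order_trans)
    then have "norm (f x) \<le> norm (\<bar>g\<bar> \<bar>x\<bar>)"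
      by (intro norm_mono_abs) (metis abs_ge_self order_trans)
    then show "norm (f x) \<le> norm g * norm x"
      using abs_bound[of "\<bar>x\<bar>" g] by simp
  qed simp
qed

end


section \<open>Nets\<close>

text \<open>
  A net over an arbitrary directed (preordered) index set is a pair of a directed relation \<open>r\<close>,
  with index set \<open>Field r\<close>, and a function \<open>x\<close> on the indices; \<open>(a, b) \<in> r\<close> means \<open>a \<le> b\<close>.
\<close>

definition directed_rel :: "'i rel \<Rightarrow> bool"
  where "directed_rel r \<longleftrightarrow> r \<noteq> {} \<and> refl_on (Field r) r \<and> trans r \<and>
    (\<forall>a\<in>Field r. \<forall>b\<in>Field r. \<exists>c. (a, c) \<in> r \<and> (b, c) \<in> r)"

definition tails :: "'i rel \<Rightarrow> 'i filter"
  where "tails r = (INF a\<in>Field r. principal (r `` {a}))"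

lemma eventually_tails:
  assumes "directed_rel r"
  shows "eventually P (tails r) \<longleftrightarrow> (\<exists>a\<in>Field r. \<forall>b. (a, b) \<in> r \<longrightarrow> P b)"
  unfolding tails_def
proof (subst eventually_INF_base)
  show "Field r \<noteq> {}" using assms by (auto simp: directed_rel_def Field_def)
  fix a b assume "a \<in> Field r" "b \<in> Field r"
  then obtain c where c: "(a, c) \<in> r" "(b, c) \<in> r" using assms by (auto simp: directed_rel_def)
  have "trans r" using assms by (simp add: directed_rel_def)
  then show "\<exists>c\<in>Field r. principal (r `` {c}) \<le> inf (principal (r `` {a})) (principal (r `` {b}))"
    using c by (intro bexI[of _ c]) (auto intro: FieldI2 elim: transE)
qed (auto simp: eventually_principal)

text \<open>
  HOL cannot quantify over all index types inside a definition. Below, nets in \<open>'a\<close> are indexed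
  by elements of the following type. This is no loss of generality: the lemmas at the end of this
  theory show that each of the notions defined with it applies to nets over any index type.
\<close>

type_synonym 'a idx = "'a set \<times> 'a"

definition decreases_to_zero :: "'i rel \<Rightarrow> ('i \<Rightarrow> 'a::banach_lattice) \<Rightarrow> bool"
  where "decreases_to_zero r x \<longleftrightarrow> (\<forall>(a, b)\<in>r. x b \<le> x a) \<and>
    (\<forall>a\<in>Field r. 0 \<le> x a) \<and> (\<forall>z. (\<forall>a\<in>Field r. z \<le> x a) \<longrightarrow> z \<le> 0)"

definition order_converges :: "'i rel \<Rightarrow> ('i \<Rightarrow> 'a::banach_lattice) \<Rightarrow> 'a \<Rightarrow> bool"
  where "order_converges r x l \<longleftrightarrow> (\<exists>(s :: 'a idx rel) y. directed_rel s \<and> decreases_to_zero s y \<and>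
    (\<forall>b\<in>Field s. \<forall>\<^sub>F a in tails r. \<bar>x a - l\<bar> \<le> y b))"

definition disjoint_net :: "'i rel \<Rightarrow> ('i \<Rightarrow> 'a::banach_lattice) \<Rightarrow> bool"
  where "disjoint_net r x \<longleftrightarrow> (\<forall>a\<in>Field r. \<forall>b\<in>Field r. a \<noteq> b \<longrightarrow> inf \<bar>x a\<bar> \<bar>x b\<bar> = 0)"

definition uo_null :: "'i rel \<Rightarrow> ('i \<Rightarrow> 'a::banach_lattice) \<Rightarrow> bool"
  where "uo_null r x \<longleftrightarrow> (\<forall>u\<ge>0. order_converges r (\<lambda>a. inf \<bar>x a\<bar> u) 0)"

definition un_null :: "'i rel \<Rightarrow> ('i \<Rightarrow> 'a::banach_lattice) \<Rightarrow> bool"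
  where "un_null r x \<longleftrightarrow> (\<forall>u\<ge>0. ((\<lambda>a. inf \<bar>x a\<bar> u) \<longlongrightarrow> 0) (tails r))"

definition uaw_null :: "'i rel \<Rightarrow> ('i \<Rightarrow> 'a::banach_lattice) \<Rightarrow> bool"
  where "uaw_null r x \<longleftrightarrow>
    (\<forall>u\<ge>0. \<forall>f :: 'a \<Rightarrow>\<^sub>L real. ((\<lambda>a. f (inf \<bar>x a\<bar> u)) \<longlongrightarrow> 0) (tails r))"

definition uaw_star_null :: "'i rel \<Rightarrow> ('i \<Rightarrow> 'a::banach_lattice \<Rightarrow>\<^sub>L real) \<Rightarrow> bool"
  where "uaw_star_null r x \<longleftrightarrow>
    (\<forall>u\<ge>0. \<forall>v. ((\<lambda>a. blinfun_apply (inf \<bar>x a\<bar> u) v) \<longlongrightarrow> 0) (tails r))"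

definition order_continuous_norm :: "'a::banach_lattice itself \<Rightarrow> bool"
  where "order_continuous_norm _ \<longleftrightarrow> (\<forall>(r :: 'a idx rel) (x :: 'a idx \<Rightarrow> 'a).
    directed_rel r \<and> decreases_to_zero r x \<longrightarrow> ((\<lambda>a. norm (x a)) \<longlongrightarrow> 0) (tails r))"


section \<open>Duals\<close>

text \<open>All duals of \<open>E\<close> are regarded as sets of functions \<open>E \<Rightarrow> real\<close>.\<close>

definition norm_dual :: "('a::real_normed_vector \<Rightarrow> real) set"
  where "norm_dual = {f. bounded_linear f}"

definition uo_dual :: "('a::banach_lattice \<Rightarrow> real) set"
  where "uo_dual = {f. linear f \<and> (\<forall>(r :: 'a idx rel) x.
    directed_rel r \<and> bounded (x ` Field r) \<and> uo_null r x \<longrightarrow> ((\<lambda>a. f (x a)) \<longlongrightarrow> 0) (tails r))}"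

definition un_dual :: "('a::banach_lattice \<Rightarrow> real) set"
  where "un_dual = {f. bounded_linear f \<and> (\<forall>(r :: 'a idx rel) x.
    directed_rel r \<and> bounded (x ` Field r) \<and> un_null r x \<longrightarrow> ((\<lambda>a. f (x a)) \<longlongrightarrow> 0) (tails r))}"

definition uaw_dual :: "('a::banach_lattice \<Rightarrow> real) set"
  where "uaw_dual = {f. bounded_linear f \<and> (\<forall>(r :: 'a idx rel) x.
    directed_rel r \<and> bounded (x ` Field r) \<and> uaw_null r x \<longrightarrow> ((\<lambda>a. f (x a)) \<longlongrightarrow> 0) (tails r))}"

text \<open>
  For disjoint nets the index set must not have a greatest element: a net indexed by a singleton
  is vacuously disjoint whatever its value, so admitting such index sets would force every \<open>f\<close>
  in the dual to vanish.
\<close>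

definition no_greatest :: "'i rel \<Rightarrow> bool"
  where "no_greatest r \<longleftrightarrow> \<not> (\<exists>m\<in>Field r. \<forall>a\<in>Field r. (a, m) \<in> r)"

definition d_dual :: "('a::banach_lattice \<Rightarrow> real) set"
  where "d_dual = {f. bounded_linear f \<and> (\<forall>(r :: 'a idx rel) x.
    directed_rel r \<and> no_greatest r \<and> bounded (x ` Field r) \<and> disjoint_net r x
      \<longrightarrow> ((\<lambda>a. f (x a)) \<longlongrightarrow> 0) (tails r))}"

definition uaw_star_dual :: "(('a::banach_lattice \<Rightarrow>\<^sub>L real) \<Rightarrow> real) set"
  where "uaw_star_dual = {f. bounded_linear f \<and> (\<forall>(r :: ('a \<Rightarrow>\<^sub>L real) idx rel) x.
    directed_rel r \<and> bounded (x ` Field r) \<and> uaw_star_null r x \<longrightarrow> ((\<lambda>a. f (x a)) \<longlongrightarrow> 0) (tails r))}"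

definition canonical :: "'a::real_normed_vector \<Rightarrow> ('a \<Rightarrow>\<^sub>L real) \<Rightarrow> real"
  where "canonical x = (\<lambda>f. f x)"

definition reflexive_space :: "'a::real_normed_vector itself \<Rightarrow> bool"
  where "reflexive_space _ \<longleftrightarrow> range (canonical :: 'a \<Rightarrow> ('a \<Rightarrow>\<^sub>L real) \<Rightarrow> real) = norm_dual"


section \<open>Independence of the index type\<close>

lemma net_reindex:
  fixes x :: "'i \<Rightarrow> 'a"
  assumes r: "directed_rel r"
  obtains s :: "'a idx rel" and y where "directed_rel s" "y ` Field s \<subseteq> x ` Field r"
    "filtermap y (tails s) = filtermap x (tails r)"
proof -
  define B where "B = {S. S \<subseteq> x ` Field r \<and> eventually (\<lambda>a. x a \<in> S) (tails r)}"
  define s where "s = {((S, a), (T, b)). S \<in> B \<and> T \<in> B \<and> a \<in> S \<and> b \<in> T \<and> T \<subseteq> S}"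
  have F: "Field s = {(S, a). S \<in> B \<and> a \<in> S}"
    by (auto simp: s_def Field_def)
  have ne: "S \<noteq> {}" if "S \<in> B" for S
    using that r unfolding B_def eventually_tails[OF r]
    by (auto simp: directed_rel_def refl_on_def)
  have top: "x ` Field r \<in> B"
    using r unfolding B_def eventually_tails[OF r] by (auto simp: directed_rel_def intro: FieldI2)
      (meson FieldI1 FieldI2 ex_in_conv imageI surj_pair)
  have int: "S \<inter> T \<in> B" if "S \<in> B" "T \<in> B" for S T
    using that by (auto simp: B_def eventually_conj_iff)
  have s: "directed_rel s"
    unfolding directed_rel_def
  proof (intro conjI ballI)
    obtain a where "a \<in> x ` Field r" using ne[OF top] by blast
    then have "((x ` Field r, a), (x ` Field r, a)) \<in> s" using top by (auto simp: s_def)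
    then show "s \<noteq> {}" by blast
    show "refl_on (Field s) s" unfolding F by (auto simp: refl_on_def s_def)
    show "trans s" by (rule transI) (auto simp: s_def)
    fix p q assume "p \<in> Field s" "q \<in> Field s"
    then obtain S a T b where pq: "p = (S, a)" "q = (T, b)" "S \<in> B" "a \<in> S" "T \<in> B" "b \<in> T"
      by (auto simp: F)
    obtain c where "c \<in> S \<inter> T" using ne[OF int[OF pq(3,5)]] by blast
    then show "\<exists>c. (p, c) \<in> s \<and> (q, c) \<in> s"
      using pq int[OF pq(3,5)] by (intro exI[of _ "(S \<inter> T, c)"]) (auto simp: s_def)
  qed
  have "eventually P (filtermap snd (tails s)) \<longleftrightarrow> eventually P (filtermap x (tails r))" for P
  proof
    assume "eventually P (filtermap snd (tails s))"
    then obtain S a where Sa: "(S, a) \<in> Field s" "\<And>T b. ((S, a), (T, b)) \<in> s \<Longrightarrow> P b"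
      unfolding eventually_filtermap eventually_tails[OF s] by (metis prod.collapse snd_conv)
    have SB: "S \<in> B" "a \<in> S" using Sa(1) by (simp_all add: F)
    then have "P b" if "b \<in> S" for b using that Sa(2)[of S b] by (simp add: s_def)
    then show "eventually P (filtermap x (tails r))"
      using SB(1) unfolding B_def eventually_filtermap by (auto elim: eventually_mono)
  next
    assume P: "eventually P (filtermap x (tails r))"
    define S where "S = {b \<in> x ` Field r. P b}"
    have "x ` Field r \<in> B" by (rule top)
    then have S: "S \<in> B"
      using P unfolding B_def S_def eventually_filtermap by (auto elim: eventually_elim2)
    obtain a where "a \<in> S" using ne[OF S] by blast
    then show "eventually P (filtermap snd (tails s))"
      unfolding eventually_filtermap eventually_tails[OF s]
    proof (intro bexI[of _ "(S, a)"] allI impI)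
      show "(S, a) \<in> Field s" using S \<open>a \<in> S\<close> by (simp add: F)
      show "P (snd q)" if "((S, a), q) \<in> s" for q
        using that by (cases q) (auto simp: s_def S_def)
    qed
  qed
  then have "filtermap snd (tails s) = filtermap x (tails r)" by (simp add: filter_eq_iff)
  moreover have "snd ` Field s \<subseteq> x ` Field r" by (auto simp: F B_def)
  ultimately show thesis using s that by blast
qed

lemma decreasing_net_reindex:
  fixes x :: "'i \<Rightarrow> 'a::banach_lattice"
  assumes r: "directed_rel r" and x: "decreases_to_zero r x"
  obtains s :: "'a idx rel" where "directed_rel s" "decreases_to_zero s snd" "snd ` Field s = x ` Field r"
proof -
  define s :: "'a idx rel" where "s = {(({}, c), ({} :: 'a set, d)) | c d. c \<in> x ` Field r \<and> d \<in> x ` Field r \<and> d \<le> c}"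
  have F: "Field s = Pair {} ` x ` Field r"
  proof
    show "Field s \<subseteq> Pair {} ` x ` Field r" unfolding s_def by (subst (1) Field_def) auto
    show "Pair {} ` x ` Field r \<subseteq> Field s"
    proof
      fix p :: "'a idx" assume "p \<in> Pair {} ` x ` Field r"
      then have "(p, p) \<in> s" unfolding s_def by blast
      then show "p \<in> Field s" by (rule FieldI1)
    qed
  qed
  have img: "snd ` Field s = x ` Field r" unfolding F by force
  have "directed_rel s"
    unfolding directed_rel_def
  proof (intro conjI ballI)
    have "Field r \<noteq> {}" using r by (auto simp: directed_rel_def Field_def)
    then show "s \<noteq> {}" using F by (metis Field_empty image_is_empty)
    show "refl_on (Field s) s" unfolding F by (auto simp: refl_on_def s_def)
    show "trans s" by (rule transI) (auto simp: s_def)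
    fix p q assume "p \<in> Field s" "q \<in> Field s"
    then obtain a b where ab: "p = ({}, x a)" "q = ({}, x b)" "a \<in> Field r" "b \<in> Field r"
      by (auto simp: F)
    then obtain c where c: "(a, c) \<in> r" "(b, c) \<in> r" using r by (auto simp: directed_rel_def)
    then have "x c \<le> x a" "x c \<le> x b" "c \<in> Field r"
      using x by (auto simp: decreases_to_zero_def intro: FieldI2)
    then show "\<exists>c. (p, c) \<in> s \<and> (q, c) \<in> s"
      using ab by (intro exI[of _ "({}, x c)"]) (auto simp: s_def)
  qed
  moreover have "decreases_to_zero s snd"
    using x unfolding decreases_to_zero_def by (auto simp: F) (auto simp: s_def)
  ultimately show thesis using img that by blast
qed

lemma order_converges_any_index:
  fixes s :: "'j rel" and y :: "'j \<Rightarrow> 'a::banach_lattice"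
  assumes s: "directed_rel s" "decreases_to_zero s y"
    and ev: "\<And>b. b \<in> Field s \<Longrightarrow> \<forall>\<^sub>F a in tails r. \<bar>x a - l\<bar> \<le> y b"
  shows "order_converges r x l"
proof -
  obtain t :: "'a idx rel" where t: "directed_rel t" "decreases_to_zero t snd" "snd ` Field t = y ` Field s"
    using decreasing_net_reindex[OF s] .
  have "\<forall>\<^sub>F a in tails r. \<bar>x a - l\<bar> \<le> snd b" if "b \<in> Field t" for b
  proof -
    have "snd b \<in> y ` Field s" using that t(3) by blast
    then show ?thesis using ev by auto
  qed
  then show ?thesis using t unfolding order_converges_def by blast
qed

lemma order_continuous_norm_any_index:
  fixes r :: "'i rel" and x :: "'i \<Rightarrow> 'a::banach_lattice"
  assumes "order_continuous_norm TYPE('a)" and r: "directed_rel r" "decreases_to_zero r x"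
  shows "((\<lambda>a. norm (x a)) \<longlongrightarrow> 0) (tails r)"
proof -
  obtain s :: "'a idx rel" where s: "directed_rel s" "decreases_to_zero s snd" "snd ` Field s = x ` Field r"
    using decreasing_net_reindex[OF r] .
  then have lim: "((\<lambda>a. norm (snd a)) \<longlongrightarrow> 0) (tails s)"
    using assms(1) by (auto simp: order_continuous_norm_def)
  show ?thesis
  proof (rule tendstoI)
    fix e :: real assume "0 < e"
    then have "\<forall>\<^sub>F a in tails s. norm (snd a) < e" using tendstoD[OF lim] by simp
    then obtain a where a: "a \<in> Field s" "\<And>b. (a, b) \<in> s \<Longrightarrow> norm (snd b) < e"
      unfolding eventually_tails[OF s(1)] by blast
    have "refl_on (Field s) s" using s(1) by (simp add: directed_rel_def)
    then have "norm (snd a) < e" using a by (auto simp: refl_on_def)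
    moreover have "snd a \<in> x ` Field r" using a(1) s(3) by blast
    ultimately obtain i where i: "i \<in> Field r" "norm (x i) < e" by auto
    have "norm (x j) \<le> norm (x i)" if "(i, j) \<in> r" for j
    proof (rule norm_mono_abs)
      have "x j \<le> x i" "0 \<le> x j" "0 \<le> x i"
        using r(2) that i(1) by (auto simp: decreases_to_zero_def intro: FieldI2)
      then show "\<bar>x j\<bar> \<le> \<bar>x i\<bar>" by simp
    qed
    then show "\<forall>\<^sub>F a in tails r. dist (norm (x a)) 0 < e"
      unfolding eventually_tails[OF r(1)] using i by (intro bexI[of _ i]) force+
  qed
qed

lemma net_dual_any_index:
  fixes r :: "'i rel" and x :: "'i \<Rightarrow> 'a::metric_space" and f :: "'a \<Rightarrow> real"
  assumes dual: "\<And>(s :: 'a idx rel) y. directed_rel s \<Longrightarrow> bounded (y ` Field s) \<Longrightarrow> N (filtermap y (tails s))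
      \<Longrightarrow> ((\<lambda>a. f (y a)) \<longlongrightarrow> 0) (tails s)"
    and "directed_rel r" "bounded (x ` Field r)" "N (filtermap x (tails r))"
  shows "((\<lambda>a. f (x a)) \<longlongrightarrow> 0) (tails r)"
proof -
  obtain s :: "'a idx rel" and y where s: "directed_rel s" "y ` Field s \<subseteq> x ` Field r"
    "filtermap y (tails s) = filtermap x (tails r)"
    using net_reindex[OF assms(2)] .
  then have "((\<lambda>a. f (y a)) \<longlongrightarrow> 0) (tails s)"
    using dual[of s y] assms(3,4) bounded_subset by metis
  then have "(f \<longlongrightarrow> 0) (filtermap x (tails r))"
    unfolding s(3)[symmetric] by (simp add: filterlim_filtermap)
  then show ?thesis by (simp add: filterlim_filtermap)
qed

lemma uo_dual_any_index:
  fixes r :: "'i rel" and x :: "'i \<Rightarrow> 'a::banach_lattice"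
  assumes "f \<in> uo_dual" "directed_rel r" "bounded (x ` Field r)" "uo_null r x"
  shows "((\<lambda>a. f (x a)) \<longlongrightarrow> 0) (tails r)"
  by (rule net_dual_any_index[where N = "\<lambda>F. \<forall>u\<ge>0. \<exists>(s :: 'a idx rel) y. directed_rel s \<and>
      decreases_to_zero s y \<and> (\<forall>b\<in>Field s. \<forall>\<^sub>F a in F. \<bar>inf \<bar>a\<bar> u - 0\<bar> \<le> y b)"])
    (use assms in \<open>auto simp: uo_dual_def uo_null_def order_converges_def eventually_filtermap\<close>)

lemma un_dual_any_index:
  fixes r :: "'i rel" and x :: "'i \<Rightarrow> 'a::banach_lattice"
  assumes "f \<in> un_dual" "directed_rel r" "bounded (x ` Field r)" "un_null r x"
  shows "((\<lambda>a. f (x a)) \<longlongrightarrow> 0) (tails r)"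
  by (rule net_dual_any_index[where N = "\<lambda>F. \<forall>u\<ge>0. ((\<lambda>a. inf \<bar>a\<bar> u) \<longlongrightarrow> 0) F"])
    (use assms in \<open>auto simp: un_dual_def un_null_def filterlim_filtermap\<close>)

lemma uaw_dual_any_index:
  fixes r :: "'i rel" and x :: "'i \<Rightarrow> 'a::banach_lattice"
  assumes "f \<in> uaw_dual" "directed_rel r" "bounded (x ` Field r)" "uaw_null r x"
  shows "((\<lambda>a. f (x a)) \<longlongrightarrow> 0) (tails r)"
  by (rule net_dual_any_index[where N = "\<lambda>F. \<forall>u\<ge>0. \<forall>g :: 'a \<Rightarrow>\<^sub>L real. ((\<lambda>a. g (inf \<bar>a\<bar> u)) \<longlongrightarrow> 0) F"])
    (use assms in \<open>auto simp: uaw_dual_def uaw_null_def filterlim_filtermap\<close>)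

lemma uaw_star_dual_any_index:
  fixes r :: "'i rel" and x :: "'i \<Rightarrow> 'a::banach_lattice \<Rightarrow>\<^sub>L real"
  assumes "f \<in> uaw_star_dual" "directed_rel r" "bounded (x ` Field r)" "uaw_star_null r x"
  shows "((\<lambda>a. f (x a)) \<longlongrightarrow> 0) (tails r)"
  by (rule net_dual_any_index[where N = "\<lambda>F. \<forall>u\<ge>0. \<forall>v. ((\<lambda>a. blinfun_apply (inf \<bar>a\<bar> u) v) \<longlongrightarrow> 0) F"])
    (use assms in \<open>auto simp: uaw_star_dual_def uaw_star_null_def filterlim_filtermap\<close>)

lemma d_dual_any_index:
  fixes r :: "'i rel" and x :: "'i \<Rightarrow> 'a::banach_lattice"
  assumes f: "f \<in> d_dual" and r: "directed_rel r" "no_greatest r"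
    and x: "bounded (x ` Field r)" "disjoint_net r x"
  shows "((\<lambda>a. f (x a)) \<longlongrightarrow> 0) (tails r)"
proof (rule ccontr)
  assume "\<not> ?thesis"
  then obtain e where e: "0 < e" and "\<not> (\<forall>\<^sub>F a in tails r. dist (f (x a)) 0 < e)"
    by (auto simp: tendsto_iff)
  then have cof: "\<exists>b. (a, b) \<in> r \<and> e \<le> \<bar>f (x b)\<bar>" if "a \<in> Field r" for a
    using that unfolding eventually_tails[OF r(1)] by force
  define J where "J = {b \<in> Field r. e \<le> \<bar>f (x b)\<bar>}"
  have cof': "\<exists>b\<in>J. (a, b) \<in> r" if "a \<in> Field r" for a
    using cof[OF that] by (auto simp: J_def intro: FieldI2)
  have refl: "(a, a) \<in> r" if "a \<in> Field r" for a
    using r(1) that by (auto simp: directed_rel_def refl_on_def)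
  have tr: "(a, c) \<in> r" if "(a, b) \<in> r" "(b, c) \<in> r" for a b c
    using r(1) that by (auto simp: directed_rel_def elim: transE)
  have f0: "f 0 = 0" using f by (auto simp: d_dual_def linear_simps)
  have inj: "inj_on x J"
  proof (rule inj_onI, rule ccontr)
    fix a b assume ab: "a \<in> J" "b \<in> J" "x a = x b" "a \<noteq> b"
    then have "inf \<bar>x a\<bar> \<bar>x b\<bar> = 0" using x(2) unfolding disjoint_net_def J_def by blast
    then have "x a = 0" by (simp add: ab(3))
    then show False using ab(1) e by (simp add: J_def f0)
  qed
  define i where "i = inv_into J x"
  have i: "i (x a) = a" if "a \<in> J" for a using that inj by (simp add: i_def)
  define s :: "'a idx rel" where "s = {(({}, x a), ({} :: 'a set, x b)) | a b. a \<in> J \<and> b \<in> J \<and> (a, b) \<in> r}"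
  have sI: "(({}, x a), ({}, x b)) \<in> s" if "a \<in> J" "b \<in> J" "(a, b) \<in> r" for a b
    using that by (auto simp: s_def)
  have sD: "(a, b) \<in> r" if "(({}, x a), ({}, x b)) \<in> s" "a \<in> J" "b \<in> J" for a b
    using that inj by (auto simp: s_def dest: inj_onD)
  have JF: "a \<in> Field r" if "a \<in> J" for a using that by (simp add: J_def)
  have F: "Field s = Pair {} ` x ` J"
  proof
    show "Field s \<subseteq> Pair {} ` x ` J" by (auto simp: Field_def s_def)
    show "Pair {} ` x ` J \<subseteq> Field s"
    proof
      fix p :: "'a idx" assume "p \<in> Pair {} ` x ` J"
      then obtain a where "a \<in> J" "p = ({}, x a)" by auto
      then have "(p, p) \<in> s" using sI[OF _ _ refl[OF JF]] by simp
      then show "p \<in> Field s" by (rule FieldI1)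
    qed
  qed
  have dir: "directed_rel s"
    unfolding directed_rel_def
  proof (intro conjI ballI)
    have "Field r \<noteq> {}" using r by (auto simp: directed_rel_def Field_def)
    then have "J \<noteq> {}" using cof' by blast
    then show "s \<noteq> {}" using F by (metis Field_empty image_is_empty)
    show "refl_on (Field s) s" unfolding F using sI refl JF by (auto simp: refl_on_def)
    show "trans s"
    proof (rule transI)
      fix p q t assume "(p, q) \<in> s" "(q, t) \<in> s"
      then obtain a b b' c where "p = ({}, x a)" "q = ({}, x b)" "q = ({}, x b')" "t = ({}, x c)"
        and J: "a \<in> J" "b \<in> J" "b' \<in> J" "c \<in> J" and r: "(a, b) \<in> r" "(b', c) \<in> r"
        unfolding s_def by blast
      moreover from this have "b = b'" using inj by (simp add: inj_on_eq_iff)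
      ultimately show "(p, t) \<in> s" using sI[OF J(1,4)] tr[OF r(1)] by simp
    qed
    fix p q assume "p \<in> Field s" "q \<in> Field s"
    then obtain a b where ab: "p = ({}, x a)" "q = ({}, x b)" "a \<in> J" "b \<in> J"
      by (auto simp: F)
    then obtain c where c: "(a, c) \<in> r" "(b, c) \<in> r"
      using r(1) JF[of a] JF[of b] unfolding directed_rel_def by blast
    then obtain d where "d \<in> J" "(c, d) \<in> r" using cof' by (meson FieldI2)
    then show "\<exists>c. (p, c) \<in> s \<and> (q, c) \<in> s"
      using ab c sI[of a d] sI[of b d] tr[of _ c d] by (intro exI[of _ "({}, x d)"]) simp
  qed
  have "no_greatest s"
    unfolding no_greatest_def
  proof
    assume "\<exists>m\<in>Field s. \<forall>a\<in>Field s. (a, m) \<in> s"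
    then obtain m where m: "m \<in> J" "\<And>a. a \<in> J \<Longrightarrow> (a, m) \<in> r" unfolding F using sD by auto
    then have "(a, m) \<in> r" if "a \<in> Field r" for a using cof'[OF that] tr by blast
    then show False using r(2) m(1) JF by (auto simp: no_greatest_def)
  qed
  moreover have "snd ` Field s \<subseteq> x ` Field r" unfolding F using JF by auto
  then have "bounded (snd ` Field s)" using x(1) bounded_subset by blast
  moreover have "disjoint_net s snd"
    using x(2) JF by (force simp: disjoint_net_def F)
  ultimately have "((\<lambda>a. f (snd a)) \<longlongrightarrow> 0) (tails s)" using f dir by (auto simp: d_dual_def)
  then have "\<forall>\<^sub>F a in tails s. dist (f (snd a)) 0 < e" using e by (rule tendstoD)
  then obtain p where p: "p \<in> Field s" "\<And>q. (p, q) \<in> s \<Longrightarrow> dist (f (snd q)) 0 < e"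
    unfolding eventually_tails[OF dir] by blast
  moreover have "refl_on (Field s) s" using dir by (simp add: directed_rel_def)
  ultimately have "dist (f (snd p)) 0 < e" by (auto simp: refl_on_def)
  then show False using p(1) by (auto simp: F J_def)
qed

end

theory Submission
  imports Defs
begin

text \<open>
  The proof rests on two facts about a Banach lattice \<open>E\<close> with order continuous norm.

  The first is that balls of the dual are almost order bounded with respect to each \<open>x \<ge> 0\<close>: for
  \<open>e > 0\<close> there is \<open>u \<ge> 0\<close> in \<open>E'\<close> with \<open>(\<bar>g\<bar> - u)\<^sup>+ x \<le> e\<close> on the ball. Otherwise some functionals
  \<open>g n\<close> of the ball satisfy \<open>(g n - 2\<^sup>n (g 0 + \<dots> + g (n - 1)))\<^sup>+ x > e\<close>, and the Riesz--Kantorovich formula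
  gives \<open>y n \<in> [0, x]\<close> with \<open>g n (y n) > e\<close> while \<open>g i (y n)\<close> is of order \<open>2\<^sup>-\<^sup>n\<close> for \<open>i < n\<close>. Then
  \<open>limsup y\<close>, which exists as a norm limit, is annihilated by every \<open>g i\<close>, and the tail
  suprema of \<open>y\<close> converge to it in norm, so \<open>g n (y n)\<close> tends to \<open>0\<close>: a contradiction
  (\<open>oc_gliding_hump\<close>). Exchanging the two spaces shows that, if \<open>E'\<close> has order continuous norm,
  balls of \<open>E\<close> are almost order bounded with respect to each \<open>f \<ge> 0\<close> in \<open>E'\<close>. In both cases
  \<open>\<bar>x\<bar> = (\<bar>x\<bar> \<sqinter> u) + (\<bar>x\<bar> - u)\<^sup>+\<close> turns unbounded convergence of a bounded net into convergence
  against the given functional. Since disjoint nets without a last index and un-null nets are uaw-null,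
  the duals of \<open>E\<close> for these classes of nets are then all equal to \<open>E'\<close>.

  The second fact is that \<open>E\<close> is an ideal of \<open>E''\<close> (\<open>oc_interval_in_range_embed\<close>). For
  \<open>0 \<le> \<phi> \<le> x\<close> take the largest \<open>z \<in> E\<close> below \<open>\<phi>\<close>. If \<open>\<psi> = \<phi> - z\<close> is not \<open>0\<close>, then for a
  small \<open>\<delta>\<close> a Hahn decomposition produces \<open>k \<ge> 0\<close> in \<open>E'\<close> such that \<open>\<psi> - \<delta> x\<close> is nonnegative on
  \<open>[0, k]\<close> and positive at \<open>k\<close>. The part of \<open>x\<close> carried by \<open>k\<close> is then a nonzero element of
  \<open>E\<close> whose multiple by \<open>\<delta>\<close> lies below \<open>\<psi>\<close>, contradicting the choice of \<open>z\<close>.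

  If \<open>F \<in> E''\<close> is continuous along bounded uaw*-null nets, then for \<open>e > 0\<close> there are \<open>u\<close>,
  \<open>x\<close>, \<open>d\<close> such that \<open>\<bar>F g\<bar> < e\<close> for all \<open>g\<close> of the unit ball with \<open>(\<bar>g\<bar> \<sqinter> u) x \<le> d\<close>. So
  \<open>(F\<^sup>+ - n x)\<^sup>+\<close> has norm at most \<open>e\<close> for large \<open>n\<close>, and \<open>F\<^sup>+\<close> is a norm limit of elements of
  intervals \<open>[0, n x]\<close>, which lie in \<open>E\<close> if the norm of \<open>E\<close> is order continuous.

  Conversely, let \<open>x\<^sub>\<alpha> \<down> 0\<close>. The norms tend to \<open>0\<close> as soon as \<open>f x\<^sub>\<alpha> \<rightarrow> 0\<close> for all \<open>f \<ge> 0\<close>, by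
  Hahn--Banach. If \<open>E\<close> is the uaw*-dual of \<open>E'\<close>, then \<open>E\<close> is an ideal of \<open>E''\<close>, and therefore
  contains the pointwise limit of the net, which must be \<open>0\<close>. If all of \<open>E'\<close> is uo-continuous,
  then \<open>f x\<^sub>\<alpha> \<rightarrow> 0\<close> because decreasing nets are uo-null. If all of \<open>E'\<close> is un-continuous, balls
  are almost order bounded with respect to each functional, and \<open>f\<^sub>\<alpha> \<down> 0\<close> in \<open>E'\<close> tends to \<open>0\<close>
  uniformly on the ball. Finally, reflexivity passes to the dual and makes \<open>E\<close>, \<open>E'\<close> and \<open>E''\<close> ideals
  of their biduals, so that all three have order continuous norms. In the other direction order continuity descends from \<open>E''\<close> to \<open>E\<close>,
  which is closed in \<open>E''\<close>, so the characterization of the uaw*-dual gives \<open>E = E''\<close>.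
\<close>

section \<open>Limits and scalars in Banach lattices\<close>

lemma abs_sup_diff_le:
  fixes x y z :: "'a::lattice_ab_group_add_abs"
  shows "\<bar>sup x z - sup y z\<bar> \<le> \<bar>x - y\<bar>"
proof -
  have *: "sup a z - sup b z \<le> \<bar>a - b\<bar>" for a b :: 'a
  proof -
    have "a \<le> \<bar>a - b\<bar> + b" using abs_ge_self[of "a - b"] by (simp add: diff_le_eq)
    then have "a \<le> \<bar>a - b\<bar> + sup b z" by (meson add_left_mono order_trans sup_ge1)
    moreover have "z \<le> \<bar>a - b\<bar> + sup b z" by (simp add: add_increasing)
    ultimately have "sup a z \<le> \<bar>a - b\<bar> + sup b z" by (rule le_supI)
    then show ?thesis unfolding diff_le_eq .
  qed
  show ?thesis
    using *[of x y] *[of y x] by (intro abs_leI) (simp_all only: abs_minus_commute minus_diff_eq)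
qed

lemma tendsto_sup_const:
  fixes f :: "'b \<Rightarrow> 'a::banach_lattice"
  assumes "(f \<longlongrightarrow> x) F"
  shows "((\<lambda>a. sup (f a) z) \<longlongrightarrow> sup x z) F"
proof (rule metric_tendsto_imp_tendsto[OF assms])
  show "\<forall>\<^sub>F a in F. dist (sup (f a) z) (sup x z) \<le> dist (f a) x"
    unfolding dist_norm by (intro always_eventually allI norm_mono_abs abs_sup_diff_le)
qed

lemma tendsto_lower_bound_lattice:
  fixes f :: "'b \<Rightarrow> 'a::banach_lattice"
  assumes "(f \<longlongrightarrow> x) F" "F \<noteq> bot" "\<forall>\<^sub>F a in F. z \<le> f a"
  shows "z \<le> x"
proof -
  have "\<forall>\<^sub>F a in F. sup (f a) z = f a"
    using assms(3) by eventually_elim (simp add: sup_absorb1)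
  then have "((\<lambda>a. sup (f a) z) \<longlongrightarrow> x) F" using assms(1) by (simp add: tendsto_cong)
  then have "sup x z = x" using tendsto_sup_const[OF assms(1)] tendsto_unique[OF assms(2)] by blast
  then show ?thesis by (metis sup_ge2)
qed

lemma tendsto_upper_bound_lattice:
  fixes f :: "'b \<Rightarrow> 'a::banach_lattice"
  assumes "(f \<longlongrightarrow> x) F" "F \<noteq> bot" "\<forall>\<^sub>F a in F. f a \<le> z"
  shows "x \<le> z"
  using tendsto_lower_bound_lattice[OF tendsto_minus[OF assms(1)] assms(2), of "- z"] assms(3)
  by simp

text \<open>
  The cone is norm closed and \<open>u / n\<close> tends to \<open>0\<close>, so a Banach lattice is Archimedean.
\<close>

lemma archimedean_lattice:
  fixes z u :: "'a::banach_lattice"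
  assumes "\<And>n::nat. real n *\<^sub>R z \<le> u"
  shows "z \<le> 0"
proof (rule tendsto_lower_bound_lattice)
  have "((\<lambda>n. inverse (real (Suc n)) *\<^sub>R u) \<longlongrightarrow> 0 *\<^sub>R u) sequentially"
    by (intro tendsto_intros LIMSEQ_inverse_real_of_nat)
  then show "(\<lambda>n. inverse (real (Suc n)) *\<^sub>R u) \<longlonglongrightarrow> 0" by simp
  show "\<forall>\<^sub>F n in sequentially. z \<le> inverse (real (Suc n)) *\<^sub>R u"
  proof (rule always_eventually, rule allI)
    fix n
    have "inverse (real (Suc n)) *\<^sub>R (real (Suc n) *\<^sub>R z) \<le> inverse (real (Suc n)) *\<^sub>R u"
      by (intro scaleR_left_mono assms) simp
    then show "z \<le> inverse (real (Suc n)) *\<^sub>R u" by simp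
  qed
qed simp

lemma inf_scaleR:
  fixes a b :: "'a::banach_lattice"
  assumes "0 < c"
  shows "c *\<^sub>R inf a b = inf (c *\<^sub>R a) (c *\<^sub>R b)"
proof (rule antisym)
  show "c *\<^sub>R inf a b \<le> inf (c *\<^sub>R a) (c *\<^sub>R b)"
    using assms by (intro le_infI scaleR_left_mono) auto
  have "inverse c *\<^sub>R inf (c *\<^sub>R a) (c *\<^sub>R b) \<le> inverse c *\<^sub>R (c *\<^sub>R a)"
    "inverse c *\<^sub>R inf (c *\<^sub>R a) (c *\<^sub>R b) \<le> inverse c *\<^sub>R (c *\<^sub>R b)"
    using assms by (intro scaleR_left_mono; simp)+
  then have "inverse c *\<^sub>R inf (c *\<^sub>R a) (c *\<^sub>R b) \<le> inf a b" using assms by simp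
  then have "c *\<^sub>R (inverse c *\<^sub>R inf (c *\<^sub>R a) (c *\<^sub>R b)) \<le> c *\<^sub>R inf a b"
    using assms by (intro scaleR_left_mono) auto
  then show "inf (c *\<^sub>R a) (c *\<^sub>R b) \<le> c *\<^sub>R inf a b" using assms by simp
qed

lemma sup_zero_scaleR:
  fixes a :: "'a::banach_lattice"
  assumes "0 \<le> c"
  shows "sup (c *\<^sub>R a) 0 = c *\<^sub>R sup a 0"
proof (cases "c = 0")
  case False
  then have "c *\<^sub>R inf (- a) 0 = inf (c *\<^sub>R (- a)) (c *\<^sub>R 0)" using assms by (intro inf_scaleR) simp
  then have "- (c *\<^sub>R inf (- a) 0) = - inf (- (c *\<^sub>R a)) 0" by simp
  then show ?thesis by (simp only: neg_inf_eq_sup minus_minus minus_zero scaleR_minus_right[symmetric])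
qed simp

lemma sup_zero_add_le: "sup (x + y) 0 \<le> sup x 0 + sup y (0::'a::lattice_ab_group_add)"
  by (intro le_supI add_mono add_nonneg_nonneg) auto

lemma norm_mono: "0 \<le> x \<Longrightarrow> x \<le> y \<Longrightarrow> norm x \<le> norm (y::'a::banach_lattice)"
  by (rule norm_mono_abs) (simp add: order_trans[of 0 x y])

lemma inf_plus_sup_diff: "inf x u + sup (x - u) 0 = (x::'a::lattice_ab_group_add)"
proof -
  have "sup (x - u) 0 = - inf (u - x) 0" by (simp only: neg_inf_eq_sup minus_diff_eq minus_zero)
  moreover have "inf (u - x) 0 = inf u x - x"
    using add_inf_distrib_right[of "u" "x" "- x"] by (simp only: add.right_inverse diff_conv_add_uminus)
  ultimately have "sup (x - u) 0 = x - inf u x" by (simp only: minus_diff_eq)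
  then show ?thesis by (metis add.commute diff_add_cancel inf_commute)
qed

section \<open>Positive functionals\<close>

lemma blinfun_nonneg:
  fixes f :: "'a::banach_lattice \<Rightarrow>\<^sub>L real"
  shows "0 \<le> f \<Longrightarrow> 0 \<le> x \<Longrightarrow> 0 \<le> f x"
  by (simp add: less_eq_blinfun_def)

lemma blinfun_leD:
  fixes f g :: "'a::banach_lattice \<Rightarrow>\<^sub>L real"
  shows "f \<le> g \<Longrightarrow> 0 \<le> x \<Longrightarrow> f x \<le> g x"
  by (simp add: less_eq_blinfun_def)

lemma blinfun_mono_right:
  fixes f :: "'a::banach_lattice \<Rightarrow>\<^sub>L real"
  shows "0 \<le> f \<Longrightarrow> x \<le> y \<Longrightarrow> f x \<le> f y"
  using blinfun_nonneg[of f "y - x"] by (simp add: blinfun.diff_right)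

lemma blinfun_abs_le:
  fixes f :: "'a::banach_lattice \<Rightarrow>\<^sub>L real"
  shows "\<bar>f x\<bar> \<le> \<bar>f\<bar> \<bar>x\<bar>"
proof -
  have pos: "\<bar>f y\<bar> \<le> \<bar>f\<bar> y" if "0 \<le> y" for y
    using blinfun_leD[OF abs_ge_self[of f] that] blinfun_leD[OF abs_ge_minus_self[of f] that]
    by (simp add: blinfun.minus_left)
  have "f x = f (sup x 0) - f (sup (-x) 0)"
    using eq_pprt_diff_pprt[of x] by (metis blinfun.diff_right)
  then have "\<bar>f x\<bar> \<le> \<bar>f (sup x 0)\<bar> + \<bar>f (sup (-x) 0)\<bar>"
    by (metis abs_triangle_ineq4)
  also have "\<dots> \<le> \<bar>f\<bar> (sup x 0) + \<bar>f\<bar> (sup (-x) 0)" by (intro add_mono pos) auto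
  also have "\<dots> = \<bar>f\<bar> \<bar>x\<bar>" by (simp only: abs_eq_pprt_add blinfun.add_right)
  finally show ?thesis .
qed

lemma norm_pos_functional_le:
  fixes f :: "'a::banach_lattice \<Rightarrow>\<^sub>L real"
  assumes f: "0 \<le> f" and le: "\<And>x. 0 \<le> x \<Longrightarrow> norm x \<le> 1 \<Longrightarrow> f x \<le> e" and e: "0 \<le> e"
  shows "norm f \<le> e"
proof (rule norm_blinfun_bound[OF e])
  fix x
  show "norm (f x) \<le> e * norm x"
  proof (cases "x = 0")
    case False
    have "\<bar>f x\<bar> \<le> f \<bar>x\<bar>" using blinfun_abs_le[of f x] f by simp
    moreover have "f (inverse (norm x) *\<^sub>R \<bar>x\<bar>) \<le> e"
      using False by (intro le) (auto simp: scaleR_nonneg_nonneg)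
    ultimately show ?thesis using False by (simp add: blinfun.scaleR_right field_simps)
  qed simp
qed

lemma pos_functional_le_norm:
  fixes f :: "'a::banach_lattice \<Rightarrow>\<^sub>L real"
  assumes "norm f \<le> M" "norm x \<le> K" "0 \<le> M"
  shows "f x \<le> M * K"
proof -
  have "f x \<le> norm f * norm x" using norm_blinfun[of f x] by simp
  also have "\<dots> \<le> M * K" using assms by (intro mult_mono) auto
  finally show ?thesis .
qed

text \<open>
  This is how the Riesz--Kantorovich formula \<open>f\<^sup>+ x = sup {f y | 0 \<le> y \<le> x}\<close> is used: estimates of
  \<open>f\<^sup>+\<close> reduce to estimates of \<open>f\<close>. The functional given by the supremum is an upper bound of
  \<open>f\<close> and \<open>0\<close>, hence dominates \<open>f\<^sup>+\<close>.
\<close>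

lemma functional_pprt_witness:
  fixes f :: "'a::banach_lattice \<Rightarrow>\<^sub>L real"
  assumes x: "0 \<le> x" and t: "t < (sup f 0) x"
  shows "\<exists>y. 0 \<le> y \<and> y \<le> x \<and> t < f y"
proof (rule ccontr)
  assume no: "\<not> ?thesis"
  obtain h :: "'a \<Rightarrow>\<^sub>L real" where h: "\<And>x. 0 \<le> x \<Longrightarrow> h x = (SUP y\<in>{0..x}. f y)"
    using functional_pprt[of f] by blast
  have bdd: "bdd_above (blinfun_apply f ` {0..x})" for x
  proof (rule bdd_aboveI)
    fix t assume "t \<in> blinfun_apply f ` {0..x}"
    then obtain y where y: "t = f y" "0 \<le> y" "y \<le> x" by auto
    then show "t \<le> norm f * norm x" using pos_functional_le_norm[of f "norm f" y "norm x"] norm_mono by auto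
  qed
  have "f \<le> h" "0 \<le> h"
    unfolding less_eq_blinfun_def
    using cSUP_upper[OF _ bdd] h by (auto, metis atLeastAtMost_iff blinfun.zero_right order_refl)
  then have "(sup f 0) x \<le> h x" using x by (intro blinfun_leD) auto
  also have "\<dots> \<le> t" unfolding h[OF x] using no x by (intro cSUP_least) (auto simp: not_less)
  finally show False using t by simp
qed

section \<open>The Hahn--Banach theorem\<close>

definition sublinear :: "('a::real_vector \<Rightarrow> real) \<Rightarrow> bool"
  where "sublinear p \<longleftrightarrow> (\<forall>x y. p (x + y) \<le> p x + p y) \<and> (\<forall>c\<ge>0. \<forall>x. p (c *\<^sub>R x) = c * p x)"

lemma sublinear_zero: "sublinear p \<Longrightarrow> p 0 = 0"
  unfolding sublinear_def by (metis order_refl mult_zero_left scaleR_zero_left)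

lemma sublinear_neg_le:
  assumes "sublinear p"
  shows "- p (- x) \<le> p x"
proof -
  have "p (x + - x) \<le> p x + p (- x)" using assms unfolding sublinear_def by blast
  then show ?thesis using sublinear_zero[OF assms] by simp
qed

text \<open>
  The scaling inequality for \<open>c\<close> and for \<open>1 / c\<close> together give homogeneity. One inequality is what
  infima of sublinear functions provide.
\<close>

lemma sublinearI:
  assumes add: "\<And>x y. p (x + y) \<le> p x + p y" and scale: "\<And>c x. 0 < c \<Longrightarrow> p (c *\<^sub>R x) \<le> c * p x"
    and zero: "p 0 = 0"
  shows "sublinear p"
proof -
  have "p (c *\<^sub>R x) = c * p x" if "0 \<le> c" for c x
  proof (cases "c = 0")
    case False
    then have c: "0 < c" using that by simp
    have "p x \<le> inverse c * p (c *\<^sub>R x)" using scale[of "inverse c" "c *\<^sub>R x"] c by simp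
    then have "c * p x \<le> p (c *\<^sub>R x)" using c by (simp add: field_simps)
    then show ?thesis using scale[OF c, of x] by simp
  qed (simp add: zero)
  then show ?thesis using add by (simp add: sublinear_def)
qed

lemma sublinear_INF:
  fixes Q :: "'i \<Rightarrow> 'a::real_vector \<Rightarrow> real"
  assumes I: "I \<noteq> {}" and bdd: "\<And>x. bdd_below ((\<lambda>i. Q i x) ` I)"
    and add: "\<And>i j x y. i \<in> I \<Longrightarrow> j \<in> I \<Longrightarrow> \<exists>k\<in>I. Q k (x + y) \<le> Q i x + Q j y"
    and scale: "\<And>i c x. i \<in> I \<Longrightarrow> 0 < c \<Longrightarrow> \<exists>k\<in>I. Q k (c *\<^sub>R x) \<le> c * Q i x"
    and zero: "\<And>i. i \<in> I \<Longrightarrow> 0 \<le> Q i 0" "\<exists>i\<in>I. Q i 0 \<le> 0"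
  shows "sublinear (\<lambda>x. INF i\<in>I. Q i x)"
proof (rule sublinearI)
  fix x y
  have *: "(INF k\<in>I. Q k (x + y)) \<le> Q i x + Q j y" if "i \<in> I" "j \<in> I" for i j
    using add[OF that, of x y] cINF_lower2[OF bdd] by blast
  have "(INF k\<in>I. Q k (x + y)) - Q j y \<le> (INF i\<in>I. Q i x)" if "j \<in> I" for j
    using *[OF _ that] I by (intro cINF_greatest) (auto simp: diff_le_eq)
  then have "(INF k\<in>I. Q k (x + y)) - (INF i\<in>I. Q i x) \<le> (INF j\<in>I. Q j y)"
    using I by (intro cINF_greatest) (auto simp: algebra_simps)
  then show "(INF k\<in>I. Q k (x + y)) \<le> (INF i\<in>I. Q i x) + (INF j\<in>I. Q j y)" by simp
next
  fix c :: real and x assume c: "0 < c"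
  have "inverse c * (INF k\<in>I. Q k (c *\<^sub>R x)) \<le> Q i x" if "i \<in> I" for i
  proof -
    have "(INF k\<in>I. Q k (c *\<^sub>R x)) \<le> c * Q i x"
      using scale[OF that c, of x] cINF_lower2[OF bdd] by blast
    then show ?thesis using c by (simp add: field_simps)
  qed
  then have "inverse c * (INF k\<in>I. Q k (c *\<^sub>R x)) \<le> (INF i\<in>I. Q i x)"
    using I by (intro cINF_greatest) auto
  then show "(INF k\<in>I. Q k (c *\<^sub>R x)) \<le> c * (INF i\<in>I. Q i x)" using c by (simp add: field_simps)
next
  show "(INF i\<in>I. Q i 0) = 0"
  proof (rule antisym)
    show "(INF i\<in>I. Q i 0) \<le> 0" using zero(2) cINF_lower2[OF bdd] by blast
    show "0 \<le> (INF i\<in>I. Q i 0)" using I zero(1) by (intro cINF_greatest) auto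
  qed
qed

text \<open>
  The function \<open>q x = inf {p (x + t x0) - t p x0 | t \<ge> 0}\<close> lies below \<open>p\<close> and is as small as
  possible at \<open>- x0\<close>: every linear function below \<open>q\<close> agrees with \<open>p\<close> at \<open>x0\<close>.
\<close>

lemma sublinear_tilt:
  fixes p :: "'a::real_vector \<Rightarrow> real"
  assumes p: "sublinear p"
  shows "\<exists>q. sublinear q \<and> (\<forall>x. q x \<le> p x) \<and> q (- x0) \<le> - p x0"
proof -
  define Q where "Q t x = p (x + t *\<^sub>R x0) - t * p x0" for t x
  have add: "p (x + y) \<le> p x + p y" for x y using p by (simp add: sublinear_def)
  have scale: "p (c *\<^sub>R x) = c * p x" if "0 \<le> c" for c x using p that by (simp add: sublinear_def)
  have lower: "- p (- x) \<le> Q t x" if "0 \<le> t" for t x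
    using add[of "x + t *\<^sub>R x0" "- x"] scale[OF that, of x0] by (simp add: Q_def)
  have bdd: "bdd_below ((\<lambda>t. Q t x) ` {0..})" for x
    using lower by (intro bdd_belowI2[of _ "- p (- x)"]) simp
  have "sublinear (\<lambda>x. INF t\<in>{0..}. Q t x)"
  proof (rule sublinear_INF)
    fix s t :: real and x y assume "s \<in> {0..}" "t \<in> {0..}"
    then show "\<exists>k\<in>{0..}. Q k (x + y) \<le> Q s x + Q t y"
      using add[of "x + s *\<^sub>R x0" "y + t *\<^sub>R x0"]
      by (intro bexI[of _ "s + t"]) (auto simp: Q_def algebra_simps)
  next
    fix t c :: real and x assume "t \<in> {0..}" "0 < c"
    then show "\<exists>k\<in>{0..}. Q k (c *\<^sub>R x) \<le> c * Q t x"
      using scale[of c "x + t *\<^sub>R x0"]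
      by (intro bexI[of _ "c * t"]) (auto simp: Q_def algebra_simps)
  next
    show "\<exists>t\<in>{0..}. Q t 0 \<le> 0" by (rule bexI[of _ 0]) (auto simp: Q_def sublinear_zero[OF p])
    show "0 \<le> Q t 0" if "t \<in> {0..}" for t using scale that by (auto simp: Q_def)
  qed (use bdd in auto)
  moreover have "(INF t\<in>{0..}. Q t x) \<le> p x" for x
    using cINF_lower[OF bdd, of 0 x] by (simp add: Q_def)
  moreover have "(INF t\<in>{0..}. Q t (- x0)) \<le> - p x0"
    using cINF_lower[OF bdd, of 1 "- x0"] by (simp add: Q_def sublinear_zero[OF p])
  ultimately show ?thesis by (intro exI[of _ "\<lambda>x. INF t\<in>{0..}. Q t x"]) simp
qed

text \<open>
  By Zorn's lemma there is a minimal sublinear function below \<open>p\<close>. It agrees with all its tilts, so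
  it is odd, and an odd sublinear function is linear.
\<close>

lemma sublinear_dominates_linear:
  fixes p :: "'a::real_vector \<Rightarrow> real"
  assumes p: "sublinear p"
  shows "\<exists>f. linear f \<and> (\<forall>x. f x \<le> p x)"
proof -
  define A where "A = {q. sublinear q \<and> (\<forall>x. q x \<le> p x)}"
  define P where "P q q' \<longleftrightarrow> (\<forall>x. q' x \<le> q x)" for q q' :: "'a \<Rightarrow> real"
  have "\<exists>m\<in>A. \<forall>a\<in>A. P m a \<longrightarrow> a = m"
  proof (rule predicate_Zorn)
    show "partial_order_on A (relation_of P A)"
      by (rule partial_order_on_relation_ofI) (auto simp: P_def fun_eq_iff intro: order_trans antisym)
  next
    fix C assume C: "C \<in> Chains (relation_of P A)"
    then have CA: "C \<subseteq> A" and chain: "\<And>q q'. q \<in> C \<Longrightarrow> q' \<in> C \<Longrightarrow> P q q' \<or> P q' q"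
      by (auto simp: Chains_def relation_of_def)
    show "\<exists>u\<in>A. \<forall>a\<in>C. P a u"
    proof (cases "C = {}")
      case True
      then show ?thesis using p by (auto simp: A_def)
    next
      case False
      have lower: "- p (- x) \<le> q x" if "q \<in> C" for q x
      proof -
        have "q (- x) \<le> p (- x)" "sublinear q" using that CA by (auto simp: A_def)
        then show ?thesis using sublinear_neg_le[of q x] by linarith
      qed
      have bdd: "bdd_below ((\<lambda>q. q x) ` C)" for x
        using lower by (intro bdd_belowI2[of _ "- p (- x)"]) simp
      have "sublinear (\<lambda>x. INF q\<in>C. q x)"
      proof (rule sublinear_INF[OF False bdd])
        fix q q' x y assume q: "q \<in> C" "q' \<in> C"
        have sub: "q'' (x + y) \<le> q'' x + q'' y" if "q'' \<in> C" for q''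
          using that CA by (auto simp: A_def sublinear_def)
        show "\<exists>k\<in>C. k (x + y) \<le> q x + q' y"
          using chain[OF q] sub[OF q(1)] sub[OF q(2)] q unfolding P_def
          by (metis (no_types, lifting) add_left_mono add_right_mono order_trans)
      next
        fix q and c :: real and x assume "q \<in> C" "0 < c"
        then show "\<exists>k\<in>C. k (c *\<^sub>R x) \<le> c * q x"
          using CA by (intro bexI[of _ q]) (auto simp: A_def sublinear_def)
      next
        have z: "q 0 = 0" if "q \<in> C" for q using that CA by (auto simp: A_def sublinear_zero)
        show "0 \<le> q 0" if "q \<in> C" for q using z[OF that] by simp
        show "\<exists>q\<in>C. q 0 \<le> 0" using z False by fastforce
      qed
      moreover have le: "(INF q\<in>C. q x) \<le> q x" if "q \<in> C" for q x
        using cINF_lower[OF bdd that] .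
      moreover have "(INF q\<in>C. q x) \<le> p x" for x
      proof -
        obtain q where "q \<in> C" using False by blast
        moreover from this have "q x \<le> p x" using CA by (auto simp: A_def)
        ultimately show ?thesis using le[of q x] by linarith
      qed
      ultimately show ?thesis by (intro bexI[of _ "\<lambda>x. INF q\<in>C. q x"]) (auto simp: A_def P_def)
    qed
  qed
  then obtain m where "m \<in> A" and least: "\<And>q. q \<in> A \<Longrightarrow> P m q \<Longrightarrow> q = m" by blast
  then have m: "sublinear m" "\<And>x. m x \<le> p x" by (auto simp: A_def)
  have min: "q = m" if "sublinear q" "\<forall>x. q x \<le> m x" for q
    using that m(2) order_trans by (intro least) (fastforce simp: A_def P_def)+
  have neg: "m (- x) = - m x" for x
  proof -
    obtain q where "sublinear q" "\<forall>y. q y \<le> m y" "q (- x) \<le> - m x"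
      using sublinear_tilt[OF m(1), of x] by blast
    then have "m (- x) \<le> - m x" using min[of q] by auto
    then show ?thesis using sublinear_neg_le[OF m(1), of x] by linarith
  qed
  have sub: "m (x + y) \<le> m x + m y" for x y using m(1) by (simp add: sublinear_def)
  have add: "m (x + y) = m x + m y" for x y
    using sub[of x y] sub[of "x + y" "- y"] neg[of y] by simp
  have "m (c *\<^sub>R x) = c *\<^sub>R m x" for c x
  proof (cases "0 \<le> c")
    case True
    then show ?thesis using m(1) by (simp add: sublinear_def)
  next
    case False
    then have "m ((- c) *\<^sub>R x) = (- c) * m x" using m(1) unfolding sublinear_def by (metis le_minus_iff linear minus_zero)
    then show ?thesis using neg[of "c *\<^sub>R x"] by simp
  qed
  then have "linear m" using add by (intro linearI)
  then show ?thesis using m(2) by blast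
qed

lemma hahn_banach_at_point:
  fixes p :: "'a::real_vector \<Rightarrow> real"
  assumes p: "sublinear p"
  shows "\<exists>f. linear f \<and> (\<forall>x. f x \<le> p x) \<and> f x0 = p x0"
proof -
  obtain q where q: "sublinear q" "\<forall>x. q x \<le> p x" "q (- x0) \<le> - p x0"
    using sublinear_tilt[OF p] by blast
  obtain f where f: "linear f" "\<forall>x. f x \<le> q x" using sublinear_dominates_linear[OF q(1)] by blast
  have "f (- x0) = - f x0" using f(1) by (simp add: linear_neg)
  then have "p x0 \<le> f x0" using f(2) q(3) by (smt (verit))
  then show ?thesis using f q(2) by (meson order_antisym order_trans)
qed

section \<open>Functionals from sublinear functions\<close>

lemma linear_dominated_blinfun:
  fixes f :: "'a::real_normed_vector \<Rightarrow> real"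
  assumes f: "linear f" and le: "\<And>x. f x \<le> C * norm x"
  shows "\<exists>g. blinfun_apply g = f"
proof -
  have "\<bar>f x\<bar> \<le> norm x * C" for x
    using le[of x] le[of "- x"] by (simp add: linear_neg[OF f] mult.commute abs_le_iff)
  then have "bounded_linear f"
    using f by (intro bounded_linear_intro[where K = C]) (auto simp: linear_add linear_cmul)
  then show ?thesis by (metis bounded_linear_Blinfun_apply)
qed

text \<open>
  Hahn--Banach for \<open>y \<mapsto> \<parallel>y\<^sup>+\<parallel>\<close>. A linear function below it is positive because it is at most \<open>0\<close>
  on the negative cone.
\<close>

lemma functional_attaining_norm_pprt:
  fixes x :: "'a::banach_lattice"
  shows "\<exists>f :: 'a \<Rightarrow>\<^sub>L real. 0 \<le> f \<and> norm f \<le> 1 \<and> blinfun_apply f x = norm (sup x 0)"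
proof -
  have "sublinear (\<lambda>y::'a. norm (sup y 0))"
  proof (rule sublinearI)
    show "norm (sup (x + y) 0) \<le> norm (sup x 0) + norm (sup y 0)" for x y :: 'a
      using norm_mono[OF _ sup_zero_add_le[of x y]] norm_triangle_ineq[of "sup x 0" "sup y 0"] by simp
  qed (auto simp: sup_zero_scaleR)
  then obtain h :: "'a \<Rightarrow> real" where h: "linear h" "\<And>y. h y \<le> norm (sup y 0)" "h x = norm (sup x 0)"
    using hahn_banach_at_point by blast
  have le: "h y \<le> 1 * norm y" for y using h(2)[of y] norm_sup_zero_le[of y] by simp
  obtain f :: "'a \<Rightarrow>\<^sub>L real" where f: "blinfun_apply f = h" using linear_dominated_blinfun[OF h(1) le] by blast
  have "0 \<le> f y" if "0 \<le> y" for y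
    using h(2)[of "- y"] that by (simp add: f linear_neg[OF h(1)] sup_absorb2)
  then have "0 \<le> f" by (simp add: less_eq_blinfun_def)
  moreover have "f y \<le> 1" if "norm y \<le> 1" for y using le[of y] that by (simp add: f)
  then have "norm f \<le> 1" using norm_pos_functional_le[OF \<open>0 \<le> f\<close>, of 1] by simp
  ultimately show ?thesis using h(3) f by auto
qed

lemma functional_attaining_norm:
  fixes x :: "'a::real_normed_vector"
  shows "\<exists>f :: 'a \<Rightarrow>\<^sub>L real. norm f \<le> 1 \<and> blinfun_apply f x = norm x"
proof -
  have "sublinear (norm :: 'a \<Rightarrow> real)" by (rule sublinearI) (auto simp: norm_triangle_ineq)
  then obtain h :: "'a \<Rightarrow> real" where h: "linear h" "\<And>y. h y \<le> norm y" "h x = norm x"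
    using hahn_banach_at_point by blast
  obtain f :: "'a \<Rightarrow>\<^sub>L real" where f: "blinfun_apply f = h"
    using linear_dominated_blinfun[OF h(1), of 1] h(2) by auto
  have "norm (f y) \<le> 1 * norm y" for y
    using h(2)[of "- y"] h(2)[of y] by (simp add: f abs_le_iff linear_neg[OF h(1)])
  then have "norm f \<le> 1" by (intro norm_blinfun_bound) simp_all
  then show ?thesis using f h(3) by auto
qed

lemma le_if_functionals_le:
  fixes x y :: "'a::banach_lattice"
  assumes "\<And>f :: 'a \<Rightarrow>\<^sub>L real. 0 \<le> f \<Longrightarrow> blinfun_apply f x \<le> blinfun_apply f y"
  shows "x \<le> y"
proof -
  obtain f :: "'a \<Rightarrow>\<^sub>L real" where f: "0 \<le> f" "blinfun_apply f (x - y) = norm (sup (x - y) 0)"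
    using functional_attaining_norm_pprt[of "x - y"] by blast
  then have "norm (sup (x - y) 0) \<le> 0" using assms[OF f(1)] unfolding f(2)[symmetric] blinfun.diff_right by simp
  then have "sup (x - y) 0 = 0" by (simp only: norm_le_zero_iff)
  then have "x - y \<le> 0" by (metis sup_ge1)
  then show ?thesis by simp
qed

text \<open>
  Hahn--Banach for \<open>y \<mapsto> f (y\<^sup>+)\<close>: a linear function below it is positive and dominated by \<open>f\<close>. In
  spirit \<open>g\<close> is the restriction of \<open>f\<close> to the band generated by \<open>x\<^sup>+\<close>.
\<close>

lemma functional_attaining_pprt:
  fixes f :: "'a::banach_lattice \<Rightarrow>\<^sub>L real"
  assumes f: "0 \<le> f"
  shows "\<exists>g\<ge>0. g \<le> f \<and> blinfun_apply g x = f (sup x 0)"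
proof -
  have "sublinear (\<lambda>y. f (sup y 0))"
  proof (rule sublinearI)
    show "f (sup (x + y) 0) \<le> f (sup x 0) + f (sup y 0)" for x y
      using blinfun_mono_right[OF f sup_zero_add_le[of x y]] by (simp add: blinfun.add_right)
  qed (auto simp: sup_zero_scaleR blinfun.scaleR_right)
  then obtain h :: "'a \<Rightarrow> real" where h: "linear h" "\<And>y. h y \<le> f (sup y 0)" "h x = f (sup x 0)"
    using hahn_banach_at_point by blast
  have "h y \<le> norm f * norm y" for y
    using h(2)[of y] pos_functional_le_norm[OF order_refl norm_sup_zero_le[of y], of f]
    by simp
  then obtain g :: "'a \<Rightarrow>\<^sub>L real" where g: "blinfun_apply g = h" using linear_dominated_blinfun[OF h(1)] by blast
  have "0 \<le> g y" "g y \<le> f y" if "0 \<le> y" for y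
    using h(2)[of "- y"] h(2)[of y] that
    by (auto simp: g linear_neg[OF h(1)] sup_absorb1 sup_absorb2)
  then have "0 \<le> g" "g \<le> f" by (simp_all add: less_eq_blinfun_def)
  then show ?thesis using h(3) g by auto
qed

text \<open>
  A Dini theorem: a decreasing net on which every positive functional tends to \<open>0\<close> is norm null.
  In place of Mazur's theorem one applies Hahn--Banach to the infimum over \<open>a \<in> A\<close> and \<open>t \<ge> 0\<close> of
  \<open>\<parallel>(y + t a)\<^sup>+\<parallel> - t e\<close>, which is subadditive because \<open>A\<close> is directed, is at least \<open>- \<parallel>y\<parallel>\<close>
  because norms on \<open>A\<close> are at least \<open>e\<close>, and is at most \<open>- e\<close> at \<open>- a\<close>.
\<close>

lemma directed_norm_bounded_below_functional:
  fixes A :: "'a::banach_lattice set"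
  assumes A: "A \<noteq> {}" and pos: "\<And>a. a \<in> A \<Longrightarrow> 0 \<le> a"
    and dir: "\<And>a b. a \<in> A \<Longrightarrow> b \<in> A \<Longrightarrow> \<exists>c\<in>A. c \<le> a \<and> c \<le> b"
    and e: "\<And>a. a \<in> A \<Longrightarrow> e \<le> norm a"
  shows "\<exists>f :: 'a \<Rightarrow>\<^sub>L real. 0 \<le> f \<and> (\<forall>a\<in>A. e \<le> blinfun_apply f a)"
proof -
  define Q where "Q = (\<lambda>(a::'a, t) y. norm (sup (y + t *\<^sub>R a) 0) - t * e)"
  define I where "I = A \<times> {0::real..}"
  have lower: "- norm y \<le> Q i y" if "i \<in> I" for i y
  proof -
    obtain a t where i: "i = (a, t)" "a \<in> A" "0 \<le> t" using \<open>i \<in> I\<close> by (auto simp: I_def)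
    have ta: "0 \<le> t *\<^sub>R a" using pos i by (simp add: scaleR_nonneg_nonneg)
    have "t *\<^sub>R a \<le> sup (y + t *\<^sub>R a) 0 + \<bar>y\<bar>"
    proof -
      have "t *\<^sub>R a = (y + t *\<^sub>R a) + - y" by simp
      also have "\<dots> \<le> sup (y + t *\<^sub>R a) 0 + \<bar>y\<bar>" by (intro add_mono sup_ge1 abs_ge_minus_self)
      finally show ?thesis .
    qed
    then have "norm (t *\<^sub>R a) \<le> norm (sup (y + t *\<^sub>R a) 0 + \<bar>y\<bar>)" by (rule norm_mono[OF ta])
    also have "\<dots> \<le> norm (sup (y + t *\<^sub>R a) 0) + norm y" by (metis norm_abs_bl norm_triangle_ineq)
    finally have "t * norm a \<le> norm (sup (y + t *\<^sub>R a) 0) + norm y" using i by simp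
    moreover have "t * e \<le> t * norm a" using i e by (simp add: mult_left_mono)
    ultimately show ?thesis by (simp add: Q_def i(1))
  qed
  have bdd: "bdd_below ((\<lambda>i. Q i y) ` I)" for y
    using lower by (intro bdd_belowI2[of _ "- norm y"])
  obtain a0 where a0: "a0 \<in> A" using A by blast
  have sub: "sublinear (\<lambda>y. INF i\<in>I. Q i y)"
  proof (rule sublinear_INF[OF _ bdd])
    show "I \<noteq> {}" using a0 by (auto simp: I_def)
  next
    fix i j x y assume "i \<in> I" "j \<in> I"
    then obtain a s b t where ij: "i = (a, s)" "a \<in> A" "0 \<le> s" "j = (b, t)" "b \<in> A" "0 \<le> t"
      by (auto simp: I_def)
    obtain c where c: "c \<in> A" "c \<le> a" "c \<le> b" using dir ij by blast
    have "x + y + (s + t) *\<^sub>R c = (x + s *\<^sub>R c) + (y + t *\<^sub>R c)" by (simp add: algebra_simps)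
    also have "\<dots> \<le> (x + s *\<^sub>R a) + (y + t *\<^sub>R b)"
      using c ij by (intro add_mono scaleR_left_mono order_refl)
    finally have "sup (x + y + (s + t) *\<^sub>R c) 0 \<le> sup ((x + s *\<^sub>R a) + (y + t *\<^sub>R b)) 0"
      by (rule sup_mono) simp
    also have "\<dots> \<le> sup (x + s *\<^sub>R a) 0 + sup (y + t *\<^sub>R b) 0" by (rule sup_zero_add_le)
    finally have "norm (sup (x + y + (s + t) *\<^sub>R c) 0) \<le> norm (sup (x + s *\<^sub>R a) 0 + sup (y + t *\<^sub>R b) 0)"
      by (intro norm_mono) auto
    also have "\<dots> \<le> norm (sup (x + s *\<^sub>R a) 0) + norm (sup (y + t *\<^sub>R b) 0)" by (rule norm_triangle_ineq)
    finally show "\<exists>k\<in>I. Q k (x + y) \<le> Q i x + Q j y"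
      using c ij by (intro bexI[of _ "(c, s + t)"]) (auto simp: Q_def I_def algebra_simps)
  next
    fix i x and c :: real assume "i \<in> I" "0 < c"
    then obtain a t where i: "i = (a, t)" "a \<in> A" "0 \<le> t" by (auto simp: I_def)
    have "c *\<^sub>R x + (c * t) *\<^sub>R a = c *\<^sub>R (x + t *\<^sub>R a)" by (simp add: algebra_simps)
    then have "norm (sup (c *\<^sub>R x + (c * t) *\<^sub>R a) 0) = c * norm (sup (x + t *\<^sub>R a) 0)"
      using \<open>0 < c\<close> by (simp add: sup_zero_scaleR)
    then show "\<exists>k\<in>I. Q k (c *\<^sub>R x) \<le> c * Q i x"
      using i \<open>0 < c\<close> by (intro bexI[of _ "(a, c * t)"]) (auto simp: Q_def I_def algebra_simps)
  next
    show "0 \<le> Q i 0" if "i \<in> I" for i using lower[OF that, of 0] by simp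
    show "\<exists>i\<in>I. Q i 0 \<le> 0" using a0 by (intro bexI[of _ "(a0, 0)"]) (auto simp: Q_def I_def)
  qed
  then obtain h :: "'a \<Rightarrow> real" where h: "linear h" "\<And>y. h y \<le> (INF i\<in>I. Q i y)"
    using sublinear_dominates_linear by blast
  have hQ: "h y \<le> Q (a, t) y" if "a \<in> A" "0 \<le> t" for y a t
  proof -
    have "(INF i\<in>I. Q i y) \<le> Q (a, t) y" using that by (intro cINF_lower[OF bdd]) (simp add: I_def)
    then show ?thesis using h(2)[of y] by linarith
  qed
  have hle: "h y \<le> norm (sup y 0)" for y using hQ[OF a0, of 0 y] by (simp add: Q_def)
  have "h y \<le> 1 * norm y" for y using hle[of y] norm_sup_zero_le[of y] by simp
  then obtain f :: "'a \<Rightarrow>\<^sub>L real" where f: "blinfun_apply f = h" using linear_dominated_blinfun[OF h(1)] by blast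
  have "0 \<le> f y" if "0 \<le> y" for y
    using hle[of "- y"] that by (simp add: f linear_neg[OF h(1)] sup_absorb2)
  moreover have "e \<le> f a" if "a \<in> A" for a
    using hQ[OF that, of 1 "- a"] by (simp add: f Q_def linear_neg[OF h(1)])
  ultimately show ?thesis by (auto simp: less_eq_blinfun_def)
qed

section \<open>The canonical embedding\<close>

definition embed :: "'a::real_normed_vector \<Rightarrow> ('a \<Rightarrow>\<^sub>L real) \<Rightarrow>\<^sub>L real"
  where "embed x = Blinfun (\<lambda>f. blinfun_apply f x)"

lemma embed_apply [simp]: "embed x f = f x"
  by (simp add: embed_def bounded_linear_Blinfun_apply blinfun.bounded_linear_left)

lemma canonical_embed: "canonical x = blinfun_apply (embed x)"
  by (simp add: canonical_def fun_eq_iff)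

lemma embed_zero [simp]: "embed 0 = 0"
  by (rule blinfun_eqI) simp

lemma embed_diff: "embed (x - y) = embed x - embed y"
  by (rule blinfun_eqI) (simp add: blinfun.diff_left blinfun.diff_right)

lemma embed_add: "embed (x + y) = embed x + embed y"
  by (rule blinfun_eqI) (simp add: blinfun.add_left blinfun.add_right)

lemma embed_scaleR: "embed (c *\<^sub>R x) = c *\<^sub>R embed x"
  by (rule blinfun_eqI) (simp add: blinfun.scaleR_left blinfun.scaleR_right)

lemma norm_embed [simp]: "norm (embed x) = norm x"
proof (rule antisym)
  show "norm (embed x) \<le> norm x"
  proof (rule norm_blinfun_bound)
    show "norm (embed x f) \<le> norm x * norm f" for f
      using norm_blinfun[of f x] by (simp add: mult.commute)
  qed simp
  obtain f :: "'a \<Rightarrow>\<^sub>L real" where f: "norm f \<le> 1" "blinfun_apply f x = norm x" using functional_attaining_norm by blast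
  have "norm x \<le> norm (embed x) * norm f" using norm_blinfun[of "embed x" f] f by simp
  also have "\<dots> \<le> norm (embed x)" using f mult_left_mono[of "norm f" 1 "norm (embed x)"] by simp
  finally show "norm x \<le> norm (embed x)" .
qed

lemma embed_le_iff [simp]: "embed x \<le> embed y \<longleftrightarrow> x \<le> (y::'a::banach_lattice)"
proof
  assume "embed x \<le> embed y"
  then have le: "embed x f \<le> embed y f" if "0 \<le> f" for f using that by (rule blinfun_leD)
  show "x \<le> y"
  proof (rule le_if_functionals_le)
    show "f x \<le> f y" if "0 \<le> f" for f :: "'a \<Rightarrow>\<^sub>L real" using le[OF that] by simp
  qed
next
  assume "x \<le> y"
  then show "embed x \<le> embed y"
    unfolding less_eq_blinfun_def[of "embed x"] by (simp add: blinfun_mono_right)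
qed

lemma embed_nonneg_iff [simp]: "0 \<le> embed x \<longleftrightarrow> 0 \<le> (x::'a::banach_lattice)"
  using embed_le_iff[of 0 x] by simp

lemma tendsto_embed:
  assumes "s \<longlonglongrightarrow> l"
  shows "(\<lambda>n. embed (s n)) \<longlonglongrightarrow> embed l"
  using assms by (simp add: tendsto_iff dist_norm embed_diff[symmetric])

text \<open>
  The embedding is isometric and the space is complete, so its image is closed.
\<close>

lemma range_embed_limit:
  fixes s :: "nat \<Rightarrow> 'a::banach"
  assumes "(\<lambda>n. embed (s n)) \<longlonglongrightarrow> \<phi>"
  shows "\<phi> \<in> range embed"
proof -
  have "Cauchy (\<lambda>n. embed (s n))" using assms by (rule LIMSEQ_imp_Cauchy)
  then have "Cauchy s" by (simp add: Cauchy_def dist_norm embed_diff[symmetric])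
  then obtain x where "s \<longlonglongrightarrow> x" by (auto simp: Cauchy_convergent_iff convergent_def)
  then have "(\<lambda>n. embed (s n)) \<longlonglongrightarrow> embed x" by (rule tendsto_embed)
  then show ?thesis using assms LIMSEQ_unique by blast
qed

lemma range_embed_approx:
  fixes \<phi> :: "('a::banach \<Rightarrow>\<^sub>L real) \<Rightarrow>\<^sub>L real"
  assumes "\<And>e. 0 < e \<Longrightarrow> \<exists>x. norm (\<phi> - embed x) \<le> e"
  shows "\<phi> \<in> range embed"
proof -
  have "\<exists>x. norm (\<phi> - embed x) \<le> inverse (real (Suc n))" for n by (rule assms) simp
  then obtain s where s: "\<And>n. norm (\<phi> - embed (s n)) \<le> inverse (real (Suc n))" by metis
  have "(\<lambda>n. embed (s n)) \<longlonglongrightarrow> \<phi>"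
    using s by (intro metric_tendsto_imp_tendsto[OF LIMSEQ_inverse_real_of_nat] always_eventually)
      (auto simp: dist_norm norm_minus_commute)
  then show ?thesis by (rule range_embed_limit)
qed

section \<open>Pointwise infima of functionals\<close>

text \<open>
  The pointwise infimum on the cone is additive since \<open>A\<close> is directed downwards. This provides limits
  of decreasing nets in every dual.
\<close>

lemma directed_functionals_inf:
  fixes A :: "('a::banach_lattice \<Rightarrow>\<^sub>L real) set"
  assumes A: "A \<noteq> {}" and pos: "\<And>f. f \<in> A \<Longrightarrow> 0 \<le> f"
    and dir: "\<And>f g. f \<in> A \<Longrightarrow> g \<in> A \<Longrightarrow> \<exists>h\<in>A. h \<le> f \<and> h \<le> g"
  obtains \<phi> :: "'a \<Rightarrow>\<^sub>L real" where "0 \<le> \<phi>" "\<And>f. f \<in> A \<Longrightarrow> \<phi> \<le> f"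
    "\<And>x e. 0 \<le> x \<Longrightarrow> 0 < e \<Longrightarrow> \<exists>f\<in>A. blinfun_apply f x < \<phi> x + e"
proof -
  define q where "q x = (INF f\<in>A. blinfun_apply f x)" for x
  have bdd: "bdd_below ((\<lambda>f. blinfun_apply f x) ` A)" if "0 \<le> x" for x
    using pos that by (intro bdd_belowI2[of _ 0]) (simp add: blinfun_nonneg)
  have ge0: "0 \<le> q x" if "0 \<le> x" for x
    unfolding q_def using A pos that by (intro cINF_greatest) (auto simp: blinfun_nonneg)
  have le: "q x \<le> f x" if "0 \<le> x" "f \<in> A" for x f
    unfolding q_def using that by (intro cINF_lower bdd)
  have approx: "\<exists>f\<in>A. blinfun_apply f x < q x + e" if "0 \<le> x" "0 < e" for x e
  proof (rule ccontr)
    assume "\<not> ?thesis"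
    then have "q x + e \<le> q x" unfolding q_def[of x] using A that
      by (intro cINF_greatest) (auto simp: not_less q_def)
    then show False using that by simp
  qed
  have add: "q (x + y) = q x + q y" if xy: "0 \<le> x" "0 \<le> y" for x y
  proof (rule antisym)
    show "q (x + y) \<le> q x + q y"
    proof (rule field_le_epsilon)
      fix e :: real assume "0 < e"
      then obtain f g where fg: "f \<in> A" "f x < q x + e/2" "g \<in> A" "g y < q y + e/2"
        using approx[OF xy(1), of "e/2"] approx[OF xy(2), of "e/2"] by auto
      then obtain h where h: "h \<in> A" "h \<le> f" "h \<le> g" using dir by blast
      have "q (x + y) \<le> h x + h y" using le[OF _ h(1), of "x + y"] xy by (simp add: blinfun.add_right)
      also have "\<dots> \<le> f x + g y" using h xy by (intro add_mono blinfun_leD)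
      finally show "q (x + y) \<le> q x + q y + e" using fg by linarith
    qed
    show "q x + q y \<le> q (x + y)"
      unfolding q_def[of "x + y"] using A le xy by (intro cINF_greatest) (auto simp: blinfun.add_right add_mono)
  qed
  obtain f0 where f0: "f0 \<in> A" using A by blast
  have "\<exists>h::'a \<Rightarrow>\<^sub>L real. \<forall>x\<ge>0. h x = q x"
  proof (rule additive_on_cone_extends[of q "norm f0"])
    show "\<bar>q x\<bar> \<le> norm f0 * norm x" if "0 \<le> x" for x
      using ge0[OF that] le[OF that f0] pos_functional_le_norm[of f0 "norm f0" x "norm x"] by simp
    have *: "q (c *\<^sub>R x) \<le> c * q x" if c: "0 < c" and "0 \<le> x" for c x
    proof (rule field_le_epsilon)
      fix e :: real assume "0 < e"
      then obtain f where f: "f \<in> A" "f x < q x + e/c" using approx[OF \<open>0 \<le> x\<close>, of "e/c"] c by auto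
      have "q (c *\<^sub>R x) \<le> c * f x"
        using le[OF _ f(1), of "c *\<^sub>R x"] c \<open>0 \<le> x\<close> by (simp add: blinfun.scaleR_right scaleR_nonneg_nonneg)
      also have "\<dots> \<le> c * (q x + e/c)" using f c by (intro mult_left_mono) auto
      finally show "q (c *\<^sub>R x) \<le> c * q x + e" using c by (simp add: algebra_simps)
    qed
    show "q (c *\<^sub>R x) = c * q x" if "0 \<le> c" "0 \<le> x" for c x
    proof (cases "c = 0")
      case True
      then show ?thesis using add[of 0 0] by simp
    next
      case False
      then have c: "0 < c" using that by simp
      have "q x \<le> inverse c * q (c *\<^sub>R x)"
        using *[of "inverse c" "c *\<^sub>R x"] c that by (simp add: scaleR_nonneg_nonneg)
      then show ?thesis using *[OF c that(2)] c by (simp add: field_simps)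
    qed
  qed (use add in auto)
  then obtain \<phi> :: "'a \<Rightarrow>\<^sub>L real" where \<phi>: "\<And>x. 0 \<le> x \<Longrightarrow> \<phi> x = q x" by blast
  show thesis
  proof (rule that[of \<phi>])
    show "0 \<le> \<phi>" using ge0 by (simp add: less_eq_blinfun_def \<phi>)
    show "\<phi> \<le> f" if "f \<in> A" for f using le that by (simp add: less_eq_blinfun_def \<phi>)
    show "\<exists>f\<in>A. blinfun_apply f x < \<phi> x + e" if "0 \<le> x" "0 < e" for x e using approx[OF that] \<phi>[OF that(1)] by simp
  qed
qed

section \<open>Monotone convergence under an order continuous norm\<close>

text \<open>
  The differences \<open>u - d\<close> of upper bounds \<open>u\<close> of \<open>D\<close> and elements \<open>d \<in> D\<close> form a net that decreases
  to \<open>0\<close>: if \<open>z\<close> is below all of them, then with \<open>u\<close> also \<open>u - z\<close>, \<open>u - 2 z\<close>, \<dots> are upper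
  bounds, and \<open>z \<le> 0\<close> by the Archimedean property.
\<close>

lemma oc_directed_cauchy:
  fixes D :: "'a::banach_lattice set"
  assumes oc: "order_continuous_norm TYPE('a)" and D: "D \<noteq> {}"
    and dir: "\<And>c d. c \<in> D \<Longrightarrow> d \<in> D \<Longrightarrow> \<exists>b\<in>D. c \<le> b \<and> d \<le> b"
    and bound: "\<And>d. d \<in> D \<Longrightarrow> d \<le> x" and e: "0 < e"
  shows "\<exists>d\<in>D. \<forall>d'\<in>D. d \<le> d' \<longrightarrow> norm (d' - d) < e"
proof -
  define U where "U = {u. \<forall>d\<in>D. d \<le> u}"
  define r where "r = {((d, u), (d', u')). d \<in> D \<and> d' \<in> D \<and> u \<in> U \<and> u' \<in> U \<and> d \<le> d' \<and> u' \<le> u}"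
  define gap where "gap = (\<lambda>(d::'a, u). u - d)"
  have F: "Field r = D \<times> U" by (auto simp: r_def Field_def)
  have x: "x \<in> U" using bound by (simp add: U_def)
  have r: "directed_rel r"
    unfolding directed_rel_def
  proof (intro conjI ballI)
    show "r \<noteq> {}" using D x F by (metis Field_empty Sigma_empty_iff ex_in_conv)
    show "refl_on (Field r) r" unfolding F by (auto simp: refl_on_def r_def)
    show "trans r" by (rule transI) (auto simp: r_def)
    fix a b assume "a \<in> Field r" "b \<in> Field r"
    then obtain d u d' u' where ab: "a = (d, u)" "b = (d', u')" "d \<in> D" "u \<in> U" "d' \<in> D" "u' \<in> U"
      by (auto simp: F)
    then obtain c where "c \<in> D" "d \<le> c" "d' \<le> c" using dir by blast
    moreover have "inf u u' \<in> U" using ab by (auto simp: U_def)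
    ultimately show "\<exists>c. (a, c) \<in> r \<and> (b, c) \<in> r"
      using ab by (intro exI[of _ "(c, inf u u')"]) (auto simp: r_def)
  qed
  have "z \<le> 0" if z: "\<forall>a\<in>Field r. z \<le> gap a" for z
  proof -
    have zle: "d + z \<le> u" if "d \<in> D" "u \<in> U" for d u
    proof -
      have "z \<le> u - d" using z that by (auto simp: F gap_def)
      then show ?thesis by (simp add: algebra_simps)
    qed
    have "x - real n *\<^sub>R z \<in> U" for n
    proof (induction n)
      case (Suc n)
      have "d \<le> x - real (Suc n) *\<^sub>R z" if "d \<in> D" for d
        using zle[OF that Suc] by (simp add: algebra_simps)
      then show ?case by (simp add: U_def)
    qed (simp add: x)
    moreover obtain d where "d \<in> D" using D by blast
    ultimately have "real n *\<^sub>R z \<le> x - d" for n by (auto simp: U_def algebra_simps)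
    then show "z \<le> 0" by (rule archimedean_lattice)
  qed
  then have "decreases_to_zero r gap"
    unfolding decreases_to_zero_def F by (auto simp: r_def gap_def U_def intro: diff_mono)
  then have "\<forall>\<^sub>F a in tails r. norm (gap a) < e"
    using order_continuous_norm_any_index[OF oc r] e by (auto simp: tendsto_iff)
  then obtain d u where du: "d \<in> D" "u \<in> U" "norm (u - d) < e"
    using r unfolding eventually_tails[OF r] F by (force simp: gap_def directed_rel_def refl_on_def F)
  have "norm (d' - d) < e" if "d' \<in> D" "d \<le> d'" for d'
  proof -
    have "norm (d' - d) \<le> norm (u - d)" using du that by (intro norm_mono) (auto simp: U_def)
    then show ?thesis using du by simp
  qed
  then show ?thesis using du by blast
qed

lemma oc_increasing_convergent:
  fixes y :: "nat \<Rightarrow> 'a::banach_lattice"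
  assumes oc: "order_continuous_norm TYPE('a)" and mono: "\<And>n. y n \<le> y (Suc n)" and bound: "\<And>n. y n \<le> x"
  shows "convergent y"
proof -
  have le: "y m \<le> y n" if "m \<le> n" for m n using lift_Suc_mono_le[of y, OF mono that] .
  have "\<exists>N. \<forall>n\<ge>N. dist (y n) (y N) < e" if "0 < e" for e
  proof -
    have "\<exists>d\<in>range y. \<forall>d'\<in>range y. d \<le> d' \<longrightarrow> norm (d' - d) < e"
    proof (rule oc_directed_cauchy[OF oc _ _ _ that])
      fix c d assume "c \<in> range y" "d \<in> range y"
      then obtain m n where "c = y m" "d = y n" by auto
      then show "\<exists>b\<in>range y. c \<le> b \<and> d \<le> b" using le[of m "max m n"] le[of n "max m n"] by auto
    qed (use bound in auto)
    then show ?thesis using le by (auto simp: dist_norm)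
  qed
  then show ?thesis unfolding Cauchy_convergent_iff[symmetric] Cauchy_altdef2 by blast
qed

text \<open>
  An increasing sequence in \<open>D\<close> with shrinking gaps to all later elements converges, and its
  limit dominates each \<open>d \<in> D\<close>, since \<open>d\<close> can be joined to every term at vanishing cost.
\<close>

lemma oc_directed_greatest:
  fixes D :: "'a::banach_lattice set"
  assumes oc: "order_continuous_norm TYPE('a)" and D: "D \<noteq> {}"
    and dir: "\<And>c d. c \<in> D \<Longrightarrow> d \<in> D \<Longrightarrow> \<exists>b\<in>D. c \<le> b \<and> d \<le> b"
    and bound: "\<And>d. d \<in> D \<Longrightarrow> d \<le> x"
    and closed: "\<And>s l. (\<And>n::nat. s n \<in> D) \<Longrightarrow> s \<longlonglongrightarrow> l \<Longrightarrow> l \<in> D"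
  shows "\<exists>m\<in>D. \<forall>d\<in>D. d \<le> m"
proof -
  obtain up where up: "\<And>c d. c \<in> D \<Longrightarrow> d \<in> D \<Longrightarrow> up c d \<in> D \<and> c \<le> up c d \<and> d \<le> up c d"
    using dir by metis
  have "\<exists>a. a \<in> D \<and> (\<forall>d'\<in>D. a \<le> d' \<longrightarrow> norm (d' - a) < inverse (real (Suc n)))" for n
    using oc_directed_cauchy[OF oc D dir bound, of "inverse (real (Suc n))"] by auto
  then obtain a where a: "\<And>n. a n \<in> D"
    "\<And>n d'. d' \<in> D \<Longrightarrow> a n \<le> d' \<Longrightarrow> norm (d' - a n) < inverse (real (Suc n))" by metis
  define s where "s = rec_nat (a 0) (\<lambda>n d. up d (a (Suc n)))"
  have sD: "s n \<in> D" for n by (induction n) (auto simp: s_def a up)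
  have as: "a n \<le> s n" for n using up[OF sD a(1)] by (cases n) (auto simp: s_def)
  have mono: "s n \<le> s (Suc n)" for n using up[OF sD a(1)] by (simp add: s_def)
  have close: "norm (d' - s n) < inverse (real (Suc n))" if "d' \<in> D" "s n \<le> d'" for d' n
  proof -
    have "norm (d' - s n) \<le> norm (d' - a n)" using that as by (intro norm_mono) (auto intro: diff_mono)
    also have "\<dots> < inverse (real (Suc n))" using that as by (intro a) (auto intro: order_trans)
    finally show ?thesis .
  qed
  obtain l where l: "s \<longlonglongrightarrow> l"
    using oc_increasing_convergent[of s x, OF oc mono bound[OF sD]] by (auto simp: convergent_def)
  have "d \<le> l" if d: "d \<in> D" for d
  proof (rule tendsto_lower_bound_lattice)
    have "(\<lambda>n. up d (s n) - s n) \<longlonglongrightarrow> 0"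
      using close up[OF d sD]
      by (intro metric_tendsto_imp_tendsto[OF LIMSEQ_inverse_real_of_nat] always_eventually)
        (auto simp: less_imp_le)
    then show "(\<lambda>n. up d (s n)) \<longlonglongrightarrow> l" using tendsto_add[OF _ l] by fastforce
  qed (use up[OF d sD] in auto)
  then show ?thesis using closed[OF sD l] by blast
qed

text \<open>
  \<open>tail_sup y m n\<close> is the supremum of \<open>y n, \<dots>, y (n + m)\<close>; unfolding the first term rather than the last
  one makes monotonicity in \<open>n\<close> immediate.
\<close>

primrec tail_sup :: "(nat \<Rightarrow> 'a::lattice) \<Rightarrow> nat \<Rightarrow> nat \<Rightarrow> 'a" where
  "tail_sup y 0 n = y n"
| "tail_sup y (Suc m) n = sup (y n) (tail_sup y m (Suc n))"

text \<open>
  Here \<open>w n\<close> is the supremum of \<open>y n, y (n + 1), \<dots>\<close> and \<open>l\<close> the limit superior, both obtained as norm limits.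
  A positive functional whose values on \<open>y\<close> are eventually at most \<open>C / 2\<^sup>n\<close> satisfies
  \<open>p (w n) \<le> 2 C / 2\<^sup>n\<close>, so it vanishes on \<open>l\<close>; this is a Borel--Cantelli argument.
\<close>

lemma oc_limsup:
  fixes y :: "nat \<Rightarrow> 'a::banach_lattice"
  assumes oc: "order_continuous_norm TYPE('a)" and y: "\<And>n. 0 \<le> y n" "\<And>n. y n \<le> x"
  obtains w l where "\<And>n. y n \<le> w n" "w \<longlonglongrightarrow> l" "0 \<le> l" "l \<le> x"
    "\<forall>(p :: 'a \<Rightarrow>\<^sub>L real) N C. 0 \<le> p \<longrightarrow> (\<forall>n\<ge>N. blinfun_apply p (y n) \<le> C / 2 ^ n)
      \<longrightarrow> blinfun_apply p l \<le> 0"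
proof -
  define V where "V = tail_sup y"
  have y_le: "y n \<le> V m n" for m n by (cases m) (auto simp: V_def)
  have bound: "V m n \<le> x" for m n by (induction m arbitrary: n) (auto simp: V_def y)
  have pos: "0 \<le> V m n" for m n using y(1) y_le by (rule order_trans)
  have mono: "V m n \<le> V (Suc m) n" for m n
    by (induction m arbitrary: n) (auto simp: V_def intro: le_supI2)
  have "convergent (\<lambda>m. V m n)" for n by (rule oc_increasing_convergent[of "\<lambda>m. V m n" x, OF oc mono bound])
  then have "\<forall>n. \<exists>z. (\<lambda>m. V m n) \<longlonglongrightarrow> z" by (simp add: convergent_def)
  then obtain w where w: "\<And>n. (\<lambda>m. V m n) \<longlonglongrightarrow> w n" by metis
  have yw: "y n \<le> w n" for n by (rule tendsto_lower_bound_lattice[OF w]) (auto simp: y_le)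
  have wx: "w n \<le> x" for n by (rule tendsto_upper_bound_lattice[OF w]) (auto simp: bound)
  have wpos: "0 \<le> w n" for n using y(1) yw by (rule order_trans)
  have V_le: "V m n \<le> w n" for m n
  proof (rule tendsto_lower_bound_lattice[OF w])
    show "\<forall>\<^sub>F k in sequentially. V m n \<le> V k n"
      using lift_Suc_mono_le[of "\<lambda>m. V m n", OF mono] by (auto simp: eventually_sequentially)
  qed simp
  have decr: "w (Suc n) \<le> w n" for n
  proof (rule tendsto_upper_bound_lattice[OF w])
    have "V m (Suc n) \<le> w n" for m
      using V_le[of "Suc m" n] by (auto simp: V_def)
    then show "\<forall>\<^sub>F m in sequentially. V m (Suc n) \<le> w n" by simp
  qed simp
  have "convergent (\<lambda>n. x - w n)"
    by (rule oc_increasing_convergent[OF oc, of _ x]) (auto simp: decr wpos)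
  then obtain c where c: "(\<lambda>n. x - w n) \<longlonglongrightarrow> c" by (auto simp: convergent_def)
  have "(\<lambda>n. x - (x - w n)) \<longlonglongrightarrow> x - c" by (intro tendsto_intros c)
  then have l: "w \<longlonglongrightarrow> x - c" by simp
  show thesis
  proof (rule that[OF yw l])
    show "0 \<le> x - c" by (rule tendsto_lower_bound_lattice[OF l]) (auto simp: wpos)
    show "x - c \<le> x" by (rule tendsto_upper_bound_lattice[OF l]) (auto simp: wx)
    have "p (x - c) \<le> 0" if p: "0 \<le> p" and le: "\<forall>n\<ge>N. p (y n) \<le> C / 2 ^ n"
      for p :: "'a \<Rightarrow>\<^sub>L real" and N C
    proof -
      have "0 \<le> C / 2 ^ N" using blinfun_nonneg[OF p y(1)[of N]] le by force
      then have C: "0 \<le> C" using mult_nonneg_nonneg[of "C / 2 ^ N" "2 ^ N"] by simp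
      \<comment> \<open>The supremum is dominated by the sum, and this is the value of the finite geometric series.\<close>
      have "p (V m n) \<le> C / 2 ^ n * (2 - 1 / 2 ^ m)" if "N \<le> n" for m n
        using that
      proof (induction m arbitrary: n)
        case 0
        then show ?case using le by (simp add: V_def)
      next
        case (Suc m)
        have "V (Suc m) n \<le> y n + V m (Suc n)"
          using y(1)[of n] pos[of m "Suc n"] by (auto simp: V_def add_increasing add_increasing2)
        then have "p (V (Suc m) n) \<le> p (y n) + p (V m (Suc n))"
          using blinfun_mono_right[OF p] by (metis blinfun.add_right)
        also have "\<dots> \<le> C / 2 ^ n + C / 2 ^ (Suc n) * (2 - 1 / 2 ^ m)"
          using Suc.IH[of "Suc n"] Suc.prems le by (intro add_mono) auto
        also have "\<dots> = C / 2 ^ n * (2 - 1 / 2 ^ Suc m)" by (simp add: field_simps)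
        finally show ?case .
      qed
      moreover have "C / 2 ^ n * (2 - 1 / 2 ^ m) \<le> C / 2 ^ n * 2" for m n :: nat
        using C by (intro mult_left_mono) auto
      ultimately have pV: "p (V m n) \<le> C / 2 ^ n * 2" if "N \<le> n" for m n using that order_trans by blast
      have pw: "p (w n) \<le> C / 2 ^ n * 2" if "N \<le> n" for n
      proof (rule LIMSEQ_le_const2)
        show "(\<lambda>m. p (V m n)) \<longlonglongrightarrow> p (w n)" by (intro tendsto_intros w)
      qed (use pV[OF that] in auto)
      show ?thesis
      proof (rule LIMSEQ_le)
        show "(\<lambda>n. p (w n)) \<longlonglongrightarrow> p (x - c)" by (intro tendsto_intros l)
        show "(\<lambda>n. C / 2 ^ n * 2) \<longlonglongrightarrow> 0" by real_asymp
      qed (use pw in auto)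
    qed
    then show "\<forall>(p :: 'a \<Rightarrow>\<^sub>L real) N C. 0 \<le> p \<longrightarrow> (\<forall>n\<ge>N. blinfun_apply p (y n) \<le> C / 2 ^ n) \<longrightarrow> blinfun_apply p (x - c) \<le> 0"
      by blast
  qed
qed

text \<open>
  Each \<open>p i\<close> annihilates the limit superior \<open>l\<close> of \<open>y\<close>, while \<open>p n (y n) \<le> p n (w n - l)\<close> for
  the tail suprema \<open>w n\<close>, which tend to \<open>l\<close> in norm.
\<close>

lemma oc_gliding_hump:
  fixes y :: "nat \<Rightarrow> 'a::banach_lattice" and p :: "nat \<Rightarrow> 'a \<Rightarrow>\<^sub>L real"
  assumes oc: "order_continuous_norm TYPE('a)" and y: "\<And>n. 0 \<le> y n" "\<And>n. y n \<le> x"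
    and p: "\<And>n. 0 \<le> p n" "\<And>n. norm (p n) \<le> M"
    and small: "\<And>i n. i < n \<Longrightarrow> p i (y n) \<le> C / 2 ^ n" and e: "0 < e"
  shows "\<exists>n. p n (y n) < e"
proof -
  obtain w l where w: "\<And>n. y n \<le> w n" "w \<longlonglongrightarrow> l" "0 \<le> l" "l \<le> x"
    "\<forall>(p :: 'a \<Rightarrow>\<^sub>L real) N C. 0 \<le> p \<longrightarrow> (\<forall>n\<ge>N. blinfun_apply p (y n) \<le> C / 2 ^ n)
      \<longrightarrow> blinfun_apply p l \<le> 0"
    using oc_limsup[of y x, OF oc y] by blast
  have pl: "p i l \<le> 0" for i using w(5) p(1)[of i] small[of i] by (meson Suc_le_lessD)
  have M: "0 \<le> M" using p(2)[of 0] norm_ge_zero order_trans by blast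
  have "\<forall>\<^sub>F n in sequentially. dist (w n) l < e / (M + 1)" using w(2) e M by (intro tendstoD) auto
  then obtain n where n: "norm (w n - l) < e / (M + 1)" by (auto simp: eventually_sequentially dist_norm)
  have "p n (y n) \<le> p n (w n)" by (intro blinfun_mono_right p w)
  also have "\<dots> \<le> p n (w n - l)" using pl[of n] by (simp add: blinfun.diff_right)
  also have "\<dots> \<le> M * norm (w n - l)" by (intro pos_functional_le_norm p M) simp
  also have "\<dots> \<le> M * (e / (M + 1))" using n M by (intro mult_left_mono) auto
  also have "\<dots> < e" using e M by (simp add: field_simps)
  finally show ?thesis by blast
qed

section \<open>Almost order bounded balls\<close>

text \<open>
  \<open>S n\<close> is the sum of \<open>g 0, \<dots>, g (n - 1)\<close>. The factor \<open>2 ^ n\<close> later forces the earlier elements to be of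
  order \<open>2\<^sup>-\<^sup>n\<close> wherever \<open>g n\<close> exceeds \<open>2 ^ n *\<^sub>R S n\<close>.
\<close>

lemma dominating_sequence:
  fixes Q :: "'a::banach_lattice \<Rightarrow> 'a \<Rightarrow> bool"
  assumes "\<And>u. 0 \<le> u \<Longrightarrow> \<exists>g\<ge>0. Q u g"
  obtains g S where "\<And>n. 0 \<le> g n" "\<And>n::nat. 0 \<le> S n" "\<And>i n. i < n \<Longrightarrow> g i \<le> S n"
    "\<And>n. Q (2 ^ n *\<^sub>R S n) (g n)"
proof -
  obtain G where G: "\<And>u. 0 \<le> u \<Longrightarrow> 0 \<le> G u \<and> Q u (G u)" using assms by metis
  define S :: "nat \<Rightarrow> 'a" where "S = rec_nat 0 (\<lambda>n s. s + G (2 ^ n *\<^sub>R s))"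
  define g where "g n = G (2 ^ n *\<^sub>R S n)" for n
  have S0: "S 0 = 0" and SS: "S (Suc n) = S n + g n" for n by (simp_all add: S_def g_def)
  have S: "0 \<le> S n" for n
    by (induction n) (auto simp: S0 SS g_def G scaleR_nonneg_nonneg)
  then have g: "0 \<le> g n" "Q (2 ^ n *\<^sub>R S n) (g n)" for n using G by (simp_all add: g_def scaleR_nonneg_nonneg)
  have "g i \<le> S n" if "i < n" for i n
    using that
  proof (induction n)
    case (Suc n)
    show ?case
    proof (cases "i = n")
      case True
      then show ?thesis using S by (simp add: SS add_increasing)
    next
      case False
      then show ?thesis using Suc g by (simp add: SS add_increasing2)
    qed
  qed simp
  then show thesis using that g S by blast
qed

text \<open>
  If no \<open>u\<close> works, \<open>dominating_sequence\<close> yields functionals \<open>g n\<close> of the ball, and the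
  Riesz--Kantorovich formula yields \<open>y n \<in> [0, x]\<close> at which \<open>g n\<close> is large and all earlier functionals
  are small. A gliding hump excludes this.
\<close>

lemma oc_dual_ball_almost_order_bounded:
  fixes x :: "'a::banach_lattice"
  assumes oc: "order_continuous_norm TYPE('a)" and x: "0 \<le> x" and e: "0 < e"
  shows "\<exists>u\<ge>0. \<forall>g :: 'a \<Rightarrow>\<^sub>L real. 0 \<le> g \<and> norm g \<le> M \<longrightarrow> blinfun_apply (sup (g - u) 0) x \<le> e"
proof (rule ccontr)
  assume no: "\<not> ?thesis"
  define Q where "Q u g \<longleftrightarrow> norm g \<le> M \<and> e < (sup (g - u) 0) x" for u g :: "'a \<Rightarrow>\<^sub>L real"
  have "\<exists>g\<ge>0. Q u g" if "0 \<le> u" for u using no that unfolding Q_def by (meson not_le)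
  then obtain g S where g: "\<And>n. 0 \<le> g n" and S: "\<And>n::nat. 0 \<le> S n"
    and gS: "\<And>i n. i < n \<Longrightarrow> g i \<le> S n" and Q: "\<And>n. Q (2 ^ n *\<^sub>R S n) (g n)"
    using dominating_sequence[of Q] by metis
  have "\<exists>y. 0 \<le> y \<and> y \<le> x \<and> e < (g n - 2 ^ n *\<^sub>R S n) y" for n
    using Q[of n] by (intro functional_pprt_witness[OF x]) (simp add: Q_def)
  then obtain y where y: "\<And>n. 0 \<le> y n" "\<And>n. y n \<le> x" and hump: "\<And>n. e < (g n - 2 ^ n *\<^sub>R S n) (y n)"
    by metis
  have gM: "norm (g n) \<le> M" for n using Q by (simp add: Q_def)
  have M: "0 \<le> M" using gM[of 0] norm_ge_zero order_trans by blast
  have gy: "e + 2 ^ n * S n (y n) < g n (y n)" for n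
    using hump[of n] by (simp add: blinfun.diff_left blinfun.scaleR_left)
  have small: "g i (y n) \<le> (M * norm x) / 2 ^ n" if "i < n" for i n
  proof -
    have "g i (y n) \<le> S n (y n)" by (intro blinfun_leD gS that y)
    moreover have "g n (y n) \<le> M * norm x" by (intro pos_functional_le_norm gM norm_mono y M)
    ultimately have "2 ^ n * g i (y n) \<le> M * norm x"
      using gy[of n] e by (smt (verit) mult_left_mono zero_le_power)
    then show ?thesis by (simp add: field_simps)
  qed
  obtain n where "g n (y n) < e" using oc_gliding_hump[of y x g, OF oc y g gM small e] by blast
  moreover have "0 \<le> 2 ^ n * S n (y n)" using blinfun_nonneg[OF S y(1)] by simp
  ultimately show False using gy[of n] by linarith
qed

text \<open>
  The same argument with the roles of \<open>E\<close> and \<open>E'\<close> exchanged: the elements \<open>x n\<close> act as functionals on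
  \<open>E'\<close>, and the elements of \<open>[0, f]\<close> at which they are tested attain \<open>f ((x n - 2\<^sup>n S n)\<^sup>+)\<close>.
\<close>

lemma oc_dual_imp_ball_almost_order_bounded:
  fixes f :: "'a::banach_lattice \<Rightarrow>\<^sub>L real"
  assumes oc: "order_continuous_norm TYPE('a \<Rightarrow>\<^sub>L real)" and f: "0 \<le> f" and e: "0 < e"
  shows "\<exists>u\<ge>0. \<forall>x. 0 \<le> x \<and> norm x \<le> M \<longrightarrow> f (sup (x - u) 0) \<le> e"
proof (rule ccontr)
  assume no: "\<not> ?thesis"
  define Q where "Q u x \<longleftrightarrow> norm x \<le> M \<and> e < f (sup (x - u) 0)" for u x
  have "\<exists>x\<ge>0. Q u x" if "0 \<le> u" for u using no that unfolding Q_def by (meson not_le)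
  then obtain x S where x: "\<And>n. 0 \<le> x n" and S: "\<And>n::nat. 0 \<le> S n"
    and xS: "\<And>i n. i < n \<Longrightarrow> x i \<le> S n" and Q: "\<And>n. Q (2 ^ n *\<^sub>R S n) (x n)"
    using dominating_sequence[of Q] by metis
  have "\<exists>g. 0 \<le> g \<and> g \<le> f \<and> blinfun_apply g (x n - 2 ^ n *\<^sub>R S n) = f (sup (x n - 2 ^ n *\<^sub>R S n) 0)" for n
    using functional_attaining_pprt[OF f] by auto
  then obtain g where g: "\<And>n. 0 \<le> g n" "\<And>n. g n \<le> f"
    and att: "\<And>n. blinfun_apply (g n) (x n - 2 ^ n *\<^sub>R S n) = f (sup (x n - 2 ^ n *\<^sub>R S n) 0)"
    by metis
  have xM: "norm (x n) \<le> M" for n using Q by (simp add: Q_def)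
  have M: "0 \<le> M" using xM[of 0] norm_ge_zero order_trans by blast
  have gx: "e + 2 ^ n * g n (S n) < g n (x n)" for n
    using Q[of n] att[of n] by (simp add: Q_def blinfun.diff_right blinfun.scaleR_right)
  have small: "embed (x i) (g n) \<le> (norm f * M) / 2 ^ n" if "i < n" for i n
  proof -
    have "g n (x i) \<le> g n (S n)" by (intro blinfun_mono_right xS that g)
    moreover have "g n (x n) \<le> norm f * M" by (intro pos_functional_le_norm xM norm_mono g) simp
    ultimately have "2 ^ n * g n (x i) \<le> norm f * M"
      using gx[of n] e by (smt (verit) mult_left_mono zero_le_power)
    then show ?thesis by (simp add: field_simps)
  qed
  have "0 \<le> embed (x n)" "norm (embed (x n)) \<le> M" for n using x xM by simp_all
  then obtain n where "embed (x n) (g n) < e"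
    using oc_gliding_hump[of "\<lambda>n. g n" f "\<lambda>n. embed (x n)", OF oc g _ _ small e] by blast
  moreover have "0 \<le> 2 ^ n * g n (S n)" using blinfun_nonneg[OF g(1) S] by simp
  ultimately show False using gx[of n] by simp
qed

section \<open>Order intervals of the bidual\<close>

text \<open>
  A Hahn decomposition. Starting from \<open>h\<close>, subtract repeatedly some \<open>L k \<in> [0, k]\<close> at which \<open>\<theta>\<close> is, up
  to the factor \<open>2\<close>, as negative as it gets on \<open>[0, k]\<close>. The values of \<open>\<theta>\<close> do not decrease. The pieces
  removed tend to \<open>0\<close> at \<open>x\<close>, hence under \<open>\<theta>\<close>, so \<open>\<theta>\<close> is nonnegative below the pointwise limit.
\<close>

lemma functional_nonneg_part:
  fixes \<theta> :: "('a::banach_lattice \<Rightarrow>\<^sub>L real) \<Rightarrow>\<^sub>L real"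
  assumes bound: "\<And>f. 0 \<le> f \<Longrightarrow> \<bar>\<theta> f\<bar> \<le> C * f x" and x: "0 \<le> x" and C: "0 \<le> C"
    and h: "0 \<le> h" "0 < \<theta> h"
  shows "\<exists>k\<ge>0. 0 < \<theta> k \<and> (\<forall>l. 0 \<le> l \<and> l \<le> k \<longrightarrow> 0 \<le> \<theta> l)"
proof -
  have "\<exists>l. 0 \<le> l \<and> l \<le> k \<and> \<theta> l \<le> 0 \<and> (\<forall>m. 0 \<le> m \<and> m \<le> k \<longrightarrow> 2 * \<theta> l \<le> \<theta> m)" if k: "0 \<le> k" for k
  proof -
    \<comment> \<open>The infimum need not be attained, but if it is negative, some value lies below half of it.\<close>
    define i where "i = (INF m\<in>{0..k}. \<theta> m)"
    have "bdd_below (blinfun_apply \<theta> ` {0..k})"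
    proof (rule bdd_belowI2)
      fix m assume "m \<in> {0..k}"
      then have "\<bar>\<theta> m\<bar> \<le> C * m x" "C * m x \<le> C * k x"
        using bound[of m] x C by (auto intro!: mult_left_mono blinfun_leD)
      then show "- (C * k x) \<le> \<theta> m" by linarith
    qed
    then have i_le: "i \<le> \<theta> m" if "0 \<le> m" "m \<le> k" for m
      unfolding i_def using that by (intro cINF_lower) auto
    show ?thesis
    proof (cases "i < 0")
      case True
      have "\<exists>l. l \<in> {0..k} \<and> \<theta> l < i / 2"
      proof (rule ccontr)
        assume "\<not> ?thesis"
        then have "i / 2 \<le> i" unfolding i_def[symmetric] using k
          by (subst (2) i_def, intro cINF_greatest) (auto simp: not_less)
        then show False using True by simp
      qed
      then obtain l where l: "0 \<le> l" "l \<le> k" "\<theta> l < i / 2" by auto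
      show ?thesis
      proof (intro exI[of _ l] conjI allI impI)
        show "2 * \<theta> l \<le> \<theta> m" if "0 \<le> m \<and> m \<le> k" for m using i_le[of m] that l by linarith
      qed (use l True in auto)
    next
      case False
      then show ?thesis using i_le k by (intro exI[of _ 0]) force
    qed
  qed
  then obtain L where L: "\<And>k. 0 \<le> k \<Longrightarrow> 0 \<le> L k \<and> L k \<le> k \<and> \<theta> (L k) \<le> 0 \<and>
      (\<forall>m. 0 \<le> m \<and> m \<le> k \<longrightarrow> 2 * \<theta> (L k) \<le> \<theta> m)" by metis
  define s where "s = rec_nat h (\<lambda>_ k. k - L k)"
  have s0: "s 0 = h" and sS: "s (Suc n) = s n - L (s n)" for n by (simp_all add: s_def)
  have s_pos: "0 \<le> s n" for n by (induction n) (auto simp: s0 sS h L)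
  have s_dec: "s (Suc n) \<le> s n" for n using L[OF s_pos] by (simp add: sS)
  have s_le: "s n \<le> s m" if "m \<le> n" for m n
    using lift_Suc_antimono_le[of s, OF s_dec that] .
  have \<theta>s: "\<theta> h \<le> \<theta> (s n)" for n
  proof (induction n)
    case (Suc n)
    have "\<theta> (s (Suc n)) = \<theta> (s n) - \<theta> (L (s n))" by (simp add: sS blinfun.diff_right)
    then show ?case using L[OF s_pos[of n]] Suc by linarith
  qed (simp add: s0)
  have dir: "\<exists>b\<in>range s. b \<le> c \<and> b \<le> d" if "c \<in> range s" "d \<in> range s" for c d
  proof -
    from that obtain m n where "c = s m" "d = s n" by (meson imageE)
    then show ?thesis using s_le[of m "max m n"] s_le[of n "max m n"] by auto
  qed
  have ne: "range s \<noteq> {}" by simp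
  have pos: "0 \<le> f" if "f \<in> range s" for f using that s_pos by auto
  obtain \<kappa> :: "'a \<Rightarrow>\<^sub>L real" where \<kappa>: "0 \<le> \<kappa>" "\<And>f. f \<in> range s \<Longrightarrow> \<kappa> \<le> f"
    "\<And>y e. 0 \<le> y \<Longrightarrow> 0 < e \<Longrightarrow> \<exists>f\<in>range s. blinfun_apply f y < \<kappa> y + e"
    using directed_functionals_inf[OF ne pos dir] by blast
  have close: "\<exists>n. s n x < \<kappa> x + e" if "0 < e" for e using \<kappa>(3)[OF x that] by blast
  have "\<theta> h \<le> \<theta> \<kappa>"
  proof (rule field_le_epsilon)
    fix e :: real assume "0 < e"
    then obtain n where n: "s n x < \<kappa> x + e / (C + 1)" using close[of "e / (C + 1)"] C by auto
    have "\<theta> (s n - \<kappa>) \<le> C * (s n - \<kappa>) x" using bound[of "s n - \<kappa>"] \<kappa>(2)[of "s n"] by simp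
    also have "\<dots> \<le> C * (e / (C + 1))" using n C by (intro mult_left_mono) (auto simp: blinfun.diff_left)
    also have "\<dots> \<le> e" using C \<open>0 < e\<close> by (simp add: field_simps)
    finally show "\<theta> h \<le> \<theta> \<kappa> + e" using \<theta>s[of n] by (simp add: blinfun.diff_right)
  qed
  moreover have "0 \<le> \<theta> m" if m: "0 \<le> m" "m \<le> \<kappa>" for m
  proof (rule field_le_epsilon)
    fix e :: real assume "0 < e"
    then have e: "0 < e / (2 * C + 1)" using C by simp
    obtain n where n: "s n x < \<kappa> x + e / (2 * C + 1)" using close[OF e] by blast
    have "L (s n) = s n - s (Suc n)" by (simp add: sS)
    then have "L (s n) x = s n x - s (Suc n) x" by (simp add: blinfun.diff_left)
    also have "\<dots> \<le> e / (2 * C + 1)" using n blinfun_leD[OF \<kappa>(2) x, of "s (Suc n)"] by simp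
    finally have "C * L (s n) x \<le> C * (e / (2 * C + 1))" using C by (intro mult_left_mono) auto
    also have "\<dots> \<le> e / 2" using C \<open>0 < e\<close> by (simp add: field_simps)
    finally have "- \<theta> (L (s n)) \<le> e / 2" using bound[of "L (s n)"] L[OF s_pos[of n]] by simp
    moreover have "2 * \<theta> (L (s n)) \<le> \<theta> m"
      using L[OF s_pos[of n]] m \<kappa>(2)[of "s n"] by (auto intro: order_trans)
    ultimately show "0 \<le> \<theta> m + e" by linarith
  qed
  ultimately show ?thesis using h \<kappa>(1) by force
qed

text \<open>
  The embedding preserves suprema: split \<open>g\<close> into \<open>k\<close> and \<open>g - k\<close>, where \<open>k\<close> attains
  \<open>g ((z - w)\<^sup>+)\<close>; then \<open>g (z \<squnion> w) = k z + (g - k) w\<close>.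
\<close>

lemma embed_sup_le:
  fixes z w :: "'a::banach_lattice"
  assumes "embed z \<le> \<phi>" "embed w \<le> \<phi>"
  shows "embed (sup z w) \<le> \<phi>"
  unfolding less_eq_blinfun_def[of "embed (sup z w)"]
proof (intro allI impI)
  fix g :: "'a \<Rightarrow>\<^sub>L real" assume g: "0 \<le> g"
  obtain k where k: "0 \<le> k" "k \<le> g" "blinfun_apply k (z - w) = g (sup (z - w) 0)"
    using functional_attaining_pprt[OF g] by blast
  have "sup z w = w + sup (z - w) 0"
    using add_sup_distrib_left[of w "z - w" 0] by (simp only: add.right_neutral) (simp add: algebra_simps)
  then have "g (sup z w) = (g - k) w + k z"
    using k(3) by (simp add: blinfun.add_right blinfun.diff_left blinfun.diff_right)
  also have "\<dots> \<le> \<phi> (g - k) + \<phi> k"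
    using blinfun_leD[OF assms(2), of "g - k"] blinfun_leD[OF assms(1) k(1)] k(2) by simp
  finally show "embed (sup z w) g \<le> \<phi> g" by (simp add: blinfun.diff_right)
qed

text \<open>
  Remove from \<open>x\<close> the largest element of \<open>[0, x]\<close> that \<open>k\<close> annihilates; \<open>k\<close> is strictly positive on the remainder.
\<close>

lemma oc_carrier:
  fixes k :: "'a::banach_lattice \<Rightarrow>\<^sub>L real"
  assumes oc: "order_continuous_norm TYPE('a)" and x: "0 \<le> x" and k: "0 \<le> k"
  obtains z where "0 \<le> z" "z \<le> x" "k z = k x" "\<And>y. 0 \<le> y \<Longrightarrow> y \<le> z \<Longrightarrow> k y = 0 \<Longrightarrow> y = 0"
proof -
  define P where "P = {y. 0 \<le> y \<and> y \<le> x \<and> k y = 0}"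
  have "\<exists>m\<in>P. \<forall>d\<in>P. d \<le> m"
  proof (rule oc_directed_greatest[OF oc])
    show "P \<noteq> {}" using x by (auto simp: P_def)
    show "\<exists>b\<in>P. c \<le> b \<and> d \<le> b" if "c \<in> P" "d \<in> P" for c d
    proof (intro bexI[of _ "sup c d"] conjI)
      have cd: "0 \<le> c" "0 \<le> d" "c \<le> x" "d \<le> x" "k c = 0" "k d = 0" using that by (auto simp: P_def)
      have "sup c d \<le> c + d" using cd by (simp add: add_increasing add_increasing2)
      then have "k (sup c d) \<le> 0" using blinfun_mono_right[OF k] cd by (metis add_0 blinfun.add_right)
      moreover have "0 \<le> sup c d" using cd(1) by (rule le_supI1)
      ultimately show "sup c d \<in> P" using blinfun_nonneg[OF k, of "sup c d"] cd by (auto simp: P_def)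
    qed auto
    show "l \<in> P" if s: "\<And>n::nat. s n \<in> P" and l: "s \<longlonglongrightarrow> l" for s l
    proof -
      have "(\<lambda>n. k (s n)) \<longlonglongrightarrow> k l" by (intro tendsto_intros l)
      moreover have "k (s n) = 0" for n using s[of n] by (simp add: P_def)
      ultimately have "k l = 0" by (simp add: LIMSEQ_const_iff)
      moreover have "0 \<le> l" by (rule tendsto_lower_bound_lattice[OF l]) (use s in \<open>auto simp: P_def\<close>)
      moreover have "l \<le> x" by (rule tendsto_upper_bound_lattice[OF l]) (use s in \<open>auto simp: P_def\<close>)
      ultimately show ?thesis by (simp add: P_def)
    qed
  qed (auto simp: P_def)
  then obtain m where m: "0 \<le> m" "m \<le> x" "k m = 0" "\<And>y. y \<in> P \<Longrightarrow> y \<le> m" by (auto simp: P_def)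
  show thesis
  proof (rule that[of "x - m"])
    fix y assume y: "0 \<le> y" "y \<le> x - m" "k y = 0"
    have "m + y \<in> P" using y m by (auto simp: P_def blinfun.add_right algebra_simps)
    then have "m + y \<le> m" by (rule m)
    then show "y = 0" using y by (simp add: order.antisym)
  qed (use m in \<open>auto simp: blinfun.diff_right\<close>)
qed

text \<open>
  Absolute continuity: if \<open>k\<close> is strictly positive on \<open>[0, z]\<close>, then \<open>g \<sqinter> 2\<^sup>n k\<close> tends to \<open>g\<close> at
  \<open>z\<close>. Otherwise there are \<open>y n \<in> [0, z]\<close> with \<open>k (y n)\<close> of order \<open>2\<^sup>-\<^sup>n\<close> but \<open>g (y n) > e / 2\<close>;
  \<open>k\<close> annihilates their limit superior, which is therefore \<open>0\<close>.
\<close>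

lemma carrier_absorbs:
  fixes g k :: "'a::banach_lattice \<Rightarrow>\<^sub>L real"
  assumes oc: "order_continuous_norm TYPE('a)" and g: "0 \<le> g" and k: "0 \<le> k" and z: "0 \<le> z"
    and carrier: "\<And>y. 0 \<le> y \<Longrightarrow> y \<le> z \<Longrightarrow> k y = 0 \<Longrightarrow> y = 0" and e: "0 < e"
  shows "\<exists>n::nat. blinfun_apply (sup (g - 2 ^ n *\<^sub>R k) 0) z < e"
proof (rule ccontr)
  assume "\<not> ?thesis"
  then have le: "e \<le> (sup (g - 2 ^ n *\<^sub>R k) 0) z" for n by (simp add: not_less)
  have "e / 2 < e" using e by simp
  then have ge: "e / 2 < (sup (g - 2 ^ n *\<^sub>R k) 0) z" for n using le by (rule less_le_trans)
  have "\<forall>n::nat. \<exists>y. 0 \<le> y \<and> y \<le> z \<and> e / 2 < (g - 2 ^ n *\<^sub>R k) y"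
    by (intro allI functional_pprt_witness[OF z ge])
  then have "\<exists>y. \<forall>n::nat. 0 \<le> y n \<and> y n \<le> z \<and> e / 2 < (g - 2 ^ n *\<^sub>R k) (y n)" by (rule choice)
  then obtain y where y: "\<And>n. 0 \<le> y n" "\<And>n. y n \<le> z" "\<And>n. e / 2 < (g - 2 ^ n *\<^sub>R k) (y n)" by blast
  have gy: "e / 2 + 2 ^ n * k (y n) < g (y n)" for n
    using y(3)[of n] by (simp add: blinfun.diff_left blinfun.scaleR_left)
  obtain w l where w: "\<And>n. y n \<le> w n" "w \<longlonglongrightarrow> l" "0 \<le> l" "l \<le> z"
    "\<forall>(p :: 'a \<Rightarrow>\<^sub>L real) N C. 0 \<le> p \<longrightarrow> (\<forall>n\<ge>N. blinfun_apply p (y n) \<le> C / 2 ^ n)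
      \<longrightarrow> blinfun_apply p l \<le> 0"
    using oc_limsup[of y z, OF oc y(1,2)] by blast
  have "k (y n) \<le> g z / 2 ^ n" for n
    using gy[of n] e blinfun_mono_right[OF g y(2)[of n]] by (simp add: field_simps)
  then have "k l \<le> 0" using w(5) k by blast
  then have "l = 0" using carrier[OF w(3,4)] blinfun_nonneg[OF k w(3)] by simp
  then have "(\<lambda>n. g (w n)) \<longlonglongrightarrow> g 0" using w(2) by (intro tendsto_intros) simp
  moreover have "e / 2 \<le> g (w n)" for n
  proof -
    have "0 \<le> 2 ^ n * k (y n)" using blinfun_nonneg[OF k y(1)] by simp
    then show ?thesis using gy[of n] blinfun_mono_right[OF g w(1)[of n]] by linarith
  qed
  ultimately have "e / 2 \<le> g 0" by (intro LIMSEQ_le_const) auto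
  then show False using e by simp
qed

text \<open>
  The elements of \<open>E\<close> below \<open>\<phi>\<close> have a largest one \<open>z0\<close>. The element \<open>\<delta> z\<close> constructed from a
  nonzero \<open>\<phi> - z0\<close> contradicts its maximality.
\<close>

lemma oc_interval_in_range_embed:
  fixes x :: "'a::banach_lattice"
  assumes oc: "order_continuous_norm TYPE('a)" and \<phi>: "0 \<le> \<phi>" "\<phi> \<le> embed x"
  shows "\<phi> \<in> range embed"
proof -
  have "0 \<le> embed x" using \<phi> by (rule order_trans)
  then have x: "0 \<le> x" by simp
  define D where "D = {z. 0 \<le> z \<and> embed z \<le> \<phi>}"
  have "\<exists>m\<in>D. \<forall>d\<in>D. d \<le> m"
  proof (rule oc_directed_greatest[OF oc])
    show "D \<noteq> {}" using \<phi> by (auto simp: D_def intro: exI[of _ 0])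
    show "\<exists>b\<in>D. c \<le> b \<and> d \<le> b" if "c \<in> D" "d \<in> D" for c d
      using that by (intro bexI[of _ "sup c d"]) (auto simp: D_def intro: embed_sup_le le_supI1)
    show "d \<le> x" if "d \<in> D" for d
    proof -
      have "embed d \<le> embed x" by (rule order_trans[OF _ \<phi>(2)]) (use that in \<open>simp add: D_def\<close>)
      then show ?thesis by simp
    qed
    show "l \<in> D" if s: "\<And>n::nat. s n \<in> D" and l: "s \<longlonglongrightarrow> l" for s l
    proof -
      have "0 \<le> l" by (rule tendsto_lower_bound_lattice[OF l]) (use s in \<open>auto simp: D_def\<close>)
      moreover have "embed l \<le> \<phi>"
        by (rule tendsto_upper_bound_lattice[OF tendsto_embed[OF l]]) (use s in \<open>auto simp: D_def\<close>)
      ultimately show ?thesis by (simp add: D_def)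
    qed
  qed
  then obtain z0 where z0: "0 \<le> z0" "embed z0 \<le> \<phi>" "\<And>z. 0 \<le> z \<Longrightarrow> embed z \<le> \<phi> \<Longrightarrow> z \<le> z0"
    by (auto simp: D_def)
  define \<psi> where "\<psi> = \<phi> - embed z0"
  have \<psi>: "0 \<le> \<psi>" "\<psi> \<le> embed x"
  proof -
    show "0 \<le> \<psi>" using z0 by (simp add: \<psi>_def)
    have "\<psi> \<le> \<phi>" using z0(1) by (simp add: \<psi>_def)
    then show "\<psi> \<le> embed x" using \<phi>(2) by (rule order_trans)
  qed
  have "\<psi> \<le> 0"
  proof (rule ccontr)
    assume "\<not> \<psi> \<le> 0"
    then obtain h where h: "0 \<le> h" "0 < \<psi> h"
      unfolding less_eq_blinfun_def[of \<psi>] by (auto simp: not_le)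
    have "\<psi> h \<le> h x" using blinfun_leD[OF \<psi>(2) h(1)] by simp
    then have hx: "0 < h x" using h by linarith
    \<comment> \<open>Half of the largest value for which \<open>\<psi> - \<delta> x\<close> is nonnegative at \<open>h\<close>.\<close>
    define \<delta> where "\<delta> = \<psi> h / (2 * h x)"
    have \<delta>: "0 < \<delta>" using h hx by (simp add: \<delta>_def)
    define \<theta> where "\<theta> = \<psi> - \<delta> *\<^sub>R embed x"
    have \<theta>: "\<theta> f = \<psi> f - \<delta> * f x" for f
      by (simp add: \<theta>_def blinfun.diff_left blinfun.scaleR_left)
    have "\<bar>\<theta> f\<bar> \<le> (1 + \<delta>) * f x" if f: "0 \<le> f" for f
    proof -
      have "0 \<le> \<psi> f" "\<psi> f \<le> f x" "0 \<le> \<delta> * f x"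
        using blinfun_nonneg[OF \<psi>(1) f] blinfun_leD[OF \<psi>(2) f] blinfun_nonneg[OF f x] \<delta> by auto
      then show ?thesis unfolding \<theta> by (simp add: abs_le_iff algebra_simps)
    qed
    moreover have "0 < \<theta> h" using h hx by (simp add: \<theta> \<delta>_def)
    ultimately obtain k where k: "0 \<le> k" "0 < \<theta> k" "\<And>l. 0 \<le> l \<Longrightarrow> l \<le> k \<Longrightarrow> 0 \<le> \<theta> l"
      using functional_nonneg_part[of \<theta> "1 + \<delta>" x h] x h(1) \<delta> by auto
    \<comment> \<open>So \<open>k\<close> does not annihilate \<open>x\<close>, and the part of \<open>x\<close> carried by \<open>k\<close> is nonzero.\<close>
    have "\<psi> k \<le> k x" "0 \<le> \<delta> * k x"
      using blinfun_leD[OF \<psi>(2) k(1)] blinfun_nonneg[OF k(1) x] \<delta> by simp_all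
    then have kx: "0 < k x" using k(2) unfolding \<theta> by linarith
    obtain z where z: "0 \<le> z" "z \<le> x" "k z = k x" "\<And>y. 0 \<le> y \<Longrightarrow> y \<le> z \<Longrightarrow> k y = 0 \<Longrightarrow> y = 0"
      using oc_carrier[OF oc x k(1)] by blast
    have below: "\<delta> * g z \<le> \<psi> g" if g: "0 \<le> g" for g :: "'a \<Rightarrow>\<^sub>L real"
    proof (rule field_le_epsilon)
      fix e :: real assume "0 < e"
      then have "0 < e / \<delta>" using \<delta> by simp
      then have "\<exists>n::nat. blinfun_apply (sup (g - 2 ^ n *\<^sub>R k) 0) z < e / \<delta>"
        using z(4) by (intro carrier_absorbs[OF oc g k(1) z(1)])
      then obtain n :: nat where n: "blinfun_apply (sup (g - 2 ^ n *\<^sub>R k) 0) z < e / \<delta>" ..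
      \<comment> \<open>Below a multiple of \<open>k\<close> the functional \<open>\<psi>\<close> dominates \<open>\<delta> x\<close>; the rest of \<open>g\<close> is negligible at \<open>z\<close>.\<close>
      define g' where "g' = inf g (2 ^ n *\<^sub>R k)"
      have g': "0 \<le> g'" "g' \<le> g" "g' \<le> 2 ^ n *\<^sub>R k"
        using g k(1) by (auto simp: g'_def scaleR_nonneg_nonneg)
      have "inverse (2 ^ n) *\<^sub>R g' \<le> inverse (2 ^ n) *\<^sub>R (2 ^ n *\<^sub>R k)" using g' by (intro scaleR_left_mono) auto
      then have "0 \<le> \<theta> (inverse (2 ^ n) *\<^sub>R g')" using g' by (intro k(3)) (auto simp: scaleR_nonneg_nonneg)
      then have "0 \<le> 2 ^ n * \<theta> (inverse (2 ^ n) *\<^sub>R g')" by (rule mult_nonneg_nonneg[rotated]) simp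
      then have "0 \<le> \<theta> g'" by (simp add: blinfun.scaleR_right mult.assoc[symmetric])
      then have "\<delta> * g' x \<le> \<psi> g'" by (simp add: \<theta>)
      also have "\<psi> g' \<le> \<psi> g" using \<psi>(1) g'(2) by (rule blinfun_mono_right)
      finally have 1: "\<delta> * g' x \<le> \<psi> g" .
      have 2: "\<delta> * g' z \<le> \<delta> * g' x" using \<delta> g' z by (intro mult_left_mono blinfun_mono_right) auto
      have "g = g' + sup (g - 2 ^ n *\<^sub>R k) 0" unfolding g'_def by (rule inf_plus_sup_diff[symmetric])
      then have "g z = g' z + (sup (g - 2 ^ n *\<^sub>R k) 0) z" by (metis blinfun.add_left)
      then have "\<delta> * g z = \<delta> * g' z + \<delta> * (sup (g - 2 ^ n *\<^sub>R k) 0) z" by (simp add: algebra_simps)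
      moreover have "\<delta> * (sup (g - 2 ^ n *\<^sub>R k) 0) z \<le> e" using n \<delta> by (simp add: field_simps)
      ultimately show "\<delta> * g z \<le> \<psi> g + e" using 1 2 by linarith
    qed
    have "embed (z0 + \<delta> *\<^sub>R z) \<le> \<phi>"
      unfolding less_eq_blinfun_def[of "embed (z0 + \<delta> *\<^sub>R z)"]
    proof (intro allI impI)
      fix g :: "'a \<Rightarrow>\<^sub>L real" assume "0 \<le> g"
      then show "embed (z0 + \<delta> *\<^sub>R z) g \<le> \<phi> g"
        using below[of g] by (simp add: \<psi>_def blinfun.add_right blinfun.scaleR_right blinfun.diff_left)
    qed
    then have "z0 + \<delta> *\<^sub>R z \<le> z0" using z0(1) z(1) \<delta> by (intro z0) (auto simp: scaleR_nonneg_nonneg)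
    then have "\<delta> *\<^sub>R z \<le> 0" by simp
    then have "k (\<delta> *\<^sub>R z) \<le> 0" using blinfun_mono_right[OF k(1)] by fastforce
    then show False using \<delta> kx z(3) by (simp add: blinfun.scaleR_right mult_le_0_iff)
  qed
  then have "\<psi> = 0" using \<psi>(1) by (rule order.antisym)
  then show ?thesis by (simp add: \<psi>_def)
qed

section \<open>Directed index sets and monotone nets\<close>

lemma directed_relD:
  assumes "directed_rel r"
  shows "a \<in> Field r \<Longrightarrow> (a, a) \<in> r" "(a, b) \<in> r \<Longrightarrow> (b, c) \<in> r \<Longrightarrow> (a, c) \<in> r"
    "a \<in> Field r \<Longrightarrow> b \<in> Field r \<Longrightarrow> \<exists>c. (a, c) \<in> r \<and> (b, c) \<in> r" "Field r \<noteq> {}"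
  using assms by (auto simp: directed_rel_def refl_on_def Field_def elim: transE)

lemma eventually_tails_Field:
  assumes "directed_rel r"
  shows "\<forall>\<^sub>F a in tails r. a \<in> Field r"
  using directed_relD(4)[OF assms] by (auto simp: eventually_tails[OF assms] intro: FieldI2)

lemma eventually_tails_ex:
  assumes "directed_rel r" "eventually P (tails r)"
  shows "\<exists>a\<in>Field r. P a"
  using assms directed_relD(1)[OF assms(1)] by (auto simp: eventually_tails)

lemma order_continuous_normI:
  assumes "\<And>(r :: 'a idx rel) x e. directed_rel r \<Longrightarrow> decreases_to_zero r x \<Longrightarrow> 0 < e
    \<Longrightarrow> \<exists>a\<in>Field r. norm (x a :: 'a) < e"
  shows "order_continuous_norm TYPE('a::banach_lattice)"
  unfolding order_continuous_norm_def
proof (intro allI impI, elim conjE, rule tendstoI)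
  fix r :: "'a idx rel" and x :: "'a idx \<Rightarrow> 'a" and e :: real
  assume r: "directed_rel r" and x: "decreases_to_zero r x" and e: "0 < e"
  obtain a where a: "a \<in> Field r" "norm (x a) < e" using assms[OF r x e] by blast
  have "norm (x b) < e" if "(a, b) \<in> r" for b
  proof -
    have "norm (x b) \<le> norm (x a)"
      using x that by (intro norm_mono) (auto simp: decreases_to_zero_def intro: FieldI2)
    then show ?thesis using a by simp
  qed
  then show "\<forall>\<^sub>F a in tails r. dist (norm (x a)) 0 < e"
    using a by (auto simp: eventually_tails[OF r])
qed

lemma decreasing_image:
  assumes r: "directed_rel r" and x: "decreases_to_zero r x"
  shows "x ` Field r \<noteq> {}" "c \<in> x ` Field r \<Longrightarrow> 0 \<le> c"
    "c \<in> x ` Field r \<Longrightarrow> d \<in> x ` Field r \<Longrightarrow> \<exists>b\<in>x ` Field r. b \<le> c \<and> b \<le> d"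
proof -
  show "x ` Field r \<noteq> {}" using directed_relD(4)[OF r] by simp
  show "c \<in> x ` Field r \<Longrightarrow> 0 \<le> c" using x by (auto simp: decreases_to_zero_def)
  assume "c \<in> x ` Field r" "d \<in> x ` Field r"
  then obtain a b where ab: "c = x a" "d = x b" "a \<in> Field r" "b \<in> Field r" by blast
  obtain k where k: "(a, k) \<in> r" "(b, k) \<in> r" using directed_relD(3)[OF r ab(3,4)] by blast
  then show "\<exists>b\<in>x ` Field r. b \<le> c \<and> b \<le> d"
    using x ab by (intro bexI[of _ "x k"]) (auto simp: decreases_to_zero_def intro: FieldI2)
qed

text \<open>
  By the Dini theorem it suffices to test the net against positive functionals.
\<close>

lemma oc_if_weakly_null:
  assumes "\<And>(r :: 'a idx rel) x (f :: 'a \<Rightarrow>\<^sub>L real) e. directed_rel r \<Longrightarrow> decreases_to_zero r x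
    \<Longrightarrow> 0 \<le> f \<Longrightarrow> 0 < e \<Longrightarrow> \<exists>a\<in>Field r. blinfun_apply f (x a) < e"
  shows "order_continuous_norm TYPE('a::banach_lattice)"
proof (rule order_continuous_normI, rule ccontr)
  fix r :: "'a idx rel" and x :: "'a idx \<Rightarrow> 'a" and e :: real
  assume r: "directed_rel r" and x: "decreases_to_zero r x" and e: "0 < e"
    and "\<not> (\<exists>a\<in>Field r. norm (x a) < e)"
  then have ge: "e \<le> norm c" if "c \<in> x ` Field r" for c using that by (auto simp: not_less)
  obtain f :: "'a \<Rightarrow>\<^sub>L real" where f: "0 \<le> f" "\<forall>c\<in>x ` Field r. e \<le> blinfun_apply f c"
    using directed_norm_bounded_below_functional[OF decreasing_image[OF r x] ge] by blast
  obtain a where "a \<in> Field r" "blinfun_apply f (x a) < e" using assms[OF r x f(1) e] by blast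
  then show False using f(2) by force
qed

text \<open>
  The pointwise limit of the net is a lower bound of it, hence \<open>0\<close>.
\<close>

lemma decreasing_functionals_pointwise:
  fixes x :: "'i \<Rightarrow> 'a::banach_lattice \<Rightarrow>\<^sub>L real"
  assumes r: "directed_rel r" and x: "decreases_to_zero r x" and v: "0 \<le> v" and e: "0 < e"
  shows "\<exists>a\<in>Field r. x a v < e"
proof -
  obtain \<phi> :: "'a \<Rightarrow>\<^sub>L real" where \<phi>: "0 \<le> \<phi>" "\<And>f. f \<in> x ` Field r \<Longrightarrow> \<phi> \<le> f"
    "\<And>y e. 0 \<le> y \<Longrightarrow> 0 < e \<Longrightarrow> \<exists>f\<in>x ` Field r. blinfun_apply f y < \<phi> y + e"
    using directed_functionals_inf[OF decreasing_image[OF r x]] by blast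
  have "\<phi> \<le> 0" using x \<phi>(2) by (auto simp: decreases_to_zero_def)
  then have "\<phi> = 0" using \<phi>(1) by (rule order.antisym)
  then show ?thesis using \<phi>(3)[OF v e] by auto
qed

lemma directed_rel_prod:
  assumes s: "directed_rel s" and t: "directed_rel t"
  shows "directed_rel {((i, m), (j, n)). (i, j) \<in> s \<and> (m, n) \<in> t}" (is "directed_rel ?r")
    and "Field {((i, m), (j, n)). (i, j) \<in> s \<and> (m, n) \<in> t} = Field s \<times> Field t"
proof -
  have refl: "((i, m), (i, m)) \<in> ?r" if "i \<in> Field s" "m \<in> Field t" for i m
    using directed_relD(1)[OF s that(1)] directed_relD(1)[OF t that(2)] by simp
  show F: "Field ?r = Field s \<times> Field t"
  proof
    show "Field ?r \<subseteq> Field s \<times> Field t" by (auto simp: Field_def)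
    show "Field s \<times> Field t \<subseteq> Field ?r" using refl by (auto intro: FieldI1)
  qed
  show "directed_rel ?r"
    unfolding directed_rel_def
  proof (intro conjI ballI)
    obtain i m where "i \<in> Field s" "m \<in> Field t" using directed_relD(4)[OF s] directed_relD(4)[OF t] by blast
    then show "?r \<noteq> {}" using refl by blast
    show "refl_on (Field ?r) ?r" unfolding F using refl by (auto simp: refl_on_def)
    show "trans ?r" using directed_relD(2)[OF s] directed_relD(2)[OF t] by (intro transI) auto
    fix p q assume "p \<in> Field ?r" "q \<in> Field ?r"
    then obtain i m j n where pq: "p = (i, m)" "q = (j, n)" "i \<in> Field s" "j \<in> Field s"
      "m \<in> Field t" "n \<in> Field t" unfolding F by auto
    obtain k where "(i, k) \<in> s" "(j, k) \<in> s" using directed_relD(3)[OF s pq(3,4)] by blast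
    moreover obtain l where "(m, l) \<in> t" "(n, l) \<in> t" using directed_relD(3)[OF t pq(5,6)] by blast
    ultimately show "\<exists>c. (p, c) \<in> ?r \<and> (q, c) \<in> ?r"
      using pq by (intro exI[of _ "(k, l)"]) simp
  qed
qed

lemma directed_nat: "directed_rel {(m, n::nat). m \<le> n}" "Field {(m, n::nat). m \<le> n} = UNIV"
proof -
  show F: "Field {(m, n::nat). m \<le> n} = UNIV" by (auto simp: Field_def)
  have "\<exists>c. a \<le> c \<and> b \<le> c" for a b :: nat by (intro exI[of _ "max a b"]) simp
  then show "directed_rel {(m, n::nat). m \<le> n}"
    unfolding directed_rel_def F by (auto simp: refl_on_def intro!: transI)
qed

section \<open>From nets to uniform estimates\<close>

text \<open>
  Continuity along all bounded nets that are null for a directed family of gauges \<open>\<rho>\<close> implies an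
  \<open>e\<close>-\<open>d\<close> condition: counterexamples \<open>y (i, n)\<close> with \<open>\<rho> i (y (i, n)) \<le> 1 / (n + 1)\<close> form such a null net.
\<close>

lemma net_uniformity:
  fixes \<rho> :: "'i \<Rightarrow> 'x \<Rightarrow> real" and s :: "'i rel" and f :: "'x \<Rightarrow> real"
  assumes s: "directed_rel s" and mono: "\<And>i j x. (i, j) \<in> s \<Longrightarrow> \<rho> i x \<le> \<rho> j x"
    and nonneg: "\<And>i x. i \<in> Field s \<Longrightarrow> 0 \<le> \<rho> i x"
    and null: "\<And>(r :: ('i \<times> nat) rel) y. directed_rel r \<Longrightarrow> y ` Field r \<subseteq> B
      \<Longrightarrow> \<forall>i\<in>Field s. ((\<lambda>a. \<rho> i (y a)) \<longlongrightarrow> 0) (tails r) \<Longrightarrow> ((\<lambda>a. f (y a)) \<longlongrightarrow> 0) (tails r)"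
    and e: "0 < e"
  shows "\<exists>i\<in>Field s. \<exists>d>0. \<forall>x\<in>B. \<rho> i x \<le> d \<longrightarrow> \<bar>f x\<bar> < e"
proof (rule ccontr)
  assume no: "\<not> ?thesis"
  have "\<forall>p. \<exists>x. fst p \<in> Field s \<longrightarrow>
      x \<in> B \<and> \<rho> (fst p) x \<le> inverse (real (Suc (snd p))) \<and> e \<le> \<bar>f x\<bar>"
  proof
    fix p :: "'i \<times> nat"
    have "0 < inverse (real (Suc (snd p)))" by simp
    then show "\<exists>x. fst p \<in> Field s \<longrightarrow>
        x \<in> B \<and> \<rho> (fst p) x \<le> inverse (real (Suc (snd p))) \<and> e \<le> \<bar>f x\<bar>"
      using no by (meson not_less)
  qed
  then have "\<exists>y. \<forall>p. fst p \<in> Field s \<longrightarrow>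
      y p \<in> B \<and> \<rho> (fst p) (y p) \<le> inverse (real (Suc (snd p))) \<and> e \<le> \<bar>f (y p)\<bar>" by (rule choice)
  then obtain y where y: "\<And>i n. i \<in> Field s \<Longrightarrow> y (i, n) \<in> B"
      "\<And>i n. i \<in> Field s \<Longrightarrow> \<rho> i (y (i, n)) \<le> inverse (real (Suc n))"
      "\<And>i n. i \<in> Field s \<Longrightarrow> e \<le> \<bar>f (y (i, n))\<bar>" by (metis fst_conv snd_conv)
  define r where "r = {((i, m), (j, n)). (i, j) \<in> s \<and> (m, n) \<in> {(m, n :: nat). m \<le> n}}"
  have F: "Field r = Field s \<times> UNIV" and r: "directed_rel r"
    using directed_rel_prod[OF s directed_nat(1)] by (simp_all only: r_def directed_nat(2))
  have "((\<lambda>a. f (y a)) \<longlongrightarrow> 0) (tails r)"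
  proof (rule null[OF r])
    show "y ` Field r \<subseteq> B" using y(1) by (auto simp: F)
    show "\<forall>i\<in>Field s. ((\<lambda>a. \<rho> i (y a)) \<longlongrightarrow> 0) (tails r)"
    proof (intro ballI tendstoI)
      fix i and d :: real assume i: "i \<in> Field s" and "0 < d"
      then obtain n where n: "inverse (real (Suc n)) < d" using reals_Archimedean by blast
      have "dist (\<rho> i (y b)) 0 < d" if "((i, n), b) \<in> r" for b
      proof -
        obtain j m where b: "b = (j, m)" "(i, j) \<in> s" "n \<le> m" using \<open>((i, n), b) \<in> r\<close> by (auto simp: r_def)
        have "j \<in> Field s" using b(2) by (rule FieldI2)
        then have "\<rho> i (y b) \<le> inverse (real (Suc m))"
          using y(2)[of j m] mono[OF b(2), of "y (j, m)"] by (simp add: b(1))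
        also have "\<dots> \<le> inverse (real (Suc n))" using b(3) by (intro le_imp_inverse_le) auto
        finally show ?thesis using n nonneg[OF i] by simp
      qed
      then show "\<forall>\<^sub>F a in tails r. dist (\<rho> i (y a)) 0 < d"
        using i by (auto simp: eventually_tails[OF r] F)
    qed
  qed
  then have "\<forall>\<^sub>F a in tails r. dist (f (y a)) 0 < e" using e by (rule tendstoD)
  then obtain a where a: "a \<in> Field r" "\<bar>f (y a)\<bar> < e" using eventually_tails_ex[OF r] by fastforce
  then have "e \<le> \<bar>f (y a)\<bar>" using y(3)[of "fst a" "snd a"] by (auto simp: F)
  then show False using a(2) by simp
qed

lemma directed_cone: "directed_rel {(u, v). 0 \<le> u \<and> u \<le> (v::'a::banach_lattice)}"
  "Field {(u, v). 0 \<le> u \<and> u \<le> (v::'a)} = {u. 0 \<le> u}"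
proof -
  show F: "Field {(u, v). 0 \<le> u \<and> u \<le> (v::'a)} = {u. 0 \<le> u}"
    by (auto simp: Field_def intro: order_trans)
  show "directed_rel {(u, v). 0 \<le> u \<and> u \<le> (v::'a)}"
    unfolding directed_rel_def F
  proof (intro conjI ballI)
    fix u v :: 'a assume "u \<in> {u. 0 \<le> u}" "v \<in> {u. 0 \<le> u}"
    then show "\<exists>c. (u, c) \<in> {(u, v). 0 \<le> u \<and> u \<le> v} \<and> (v, c) \<in> {(u, v). 0 \<le> u \<and> u \<le> v}"
      by (intro exI[of _ "sup u v"]) auto
  qed (auto simp: refl_on_def intro!: transI)
qed

lemma un_dual_uniform:
  fixes f :: "'a::banach_lattice \<Rightarrow> real"
  assumes f: "f \<in> un_dual" and e: "0 < e"
  obtains u d where "0 \<le> u" "0 < d" "\<And>x. norm x \<le> 1 \<Longrightarrow> norm (inf \<bar>x\<bar> u) \<le> d \<Longrightarrow> \<bar>f x\<bar> < e"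
proof -
  define s where "s = {(u, v). 0 \<le> u \<and> u \<le> (v::'a)}"
  have s: "directed_rel s" "Field s = {u. 0 \<le> u}" unfolding s_def by (rule directed_cone)+
  have "\<exists>u\<in>Field s. \<exists>d>0. \<forall>x\<in>{x. norm x \<le> 1}. norm (inf \<bar>x\<bar> u) \<le> d \<longrightarrow> \<bar>f x\<bar> < e"
  proof (rule net_uniformity[OF s(1)])
    show "norm (inf \<bar>x\<bar> u) \<le> norm (inf \<bar>x\<bar> v)" if "(u, v) \<in> s" for u v x
      using that by (intro norm_mono) (auto simp: s_def intro: le_infI2)
    fix r :: "('a \<times> nat) rel" and y
    assume r: "directed_rel r" and y: "y ` Field r \<subseteq> {x. norm x \<le> 1}"
      and null: "\<forall>u\<in>Field s. ((\<lambda>a. norm (inf \<bar>y a\<bar> u)) \<longlongrightarrow> 0) (tails r)"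
    have "bounded (y ` Field r)" using y by (auto simp: bounded_iff)
    moreover have "un_null r y" using null by (auto simp: un_null_def s(2) tendsto_norm_zero_iff)
    ultimately show "((\<lambda>a. f (y a)) \<longlongrightarrow> 0) (tails r)" using un_dual_any_index[OF f r] by blast
  qed (use e in auto)
  then show thesis using that by (auto simp: s(2))
qed

lemma uaw_star_dual_uniform:
  fixes f :: "('a::banach_lattice \<Rightarrow>\<^sub>L real) \<Rightarrow> real"
  assumes f: "f \<in> uaw_star_dual" and e: "0 < e"
  obtains u x d where "0 \<le> u" "0 \<le> x" "0 < d"
    "\<And>g. norm g \<le> 1 \<Longrightarrow> blinfun_apply (inf \<bar>g\<bar> u) x \<le> d \<Longrightarrow> \<bar>f g\<bar> < e"
proof -
  define s1 where "s1 = {(u, v). 0 \<le> u \<and> u \<le> (v::'a \<Rightarrow>\<^sub>L real)}"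
  define s2 where "s2 = {(x, y). 0 \<le> x \<and> x \<le> (y::'a)}"
  have s1: "directed_rel s1" "Field s1 = {u. 0 \<le> u}" unfolding s1_def by (rule directed_cone)+
  have s2: "directed_rel s2" "Field s2 = {u. 0 \<le> u}" unfolding s2_def by (rule directed_cone)+
  define s where "s = {((u, x), (v, y)). (u, v) \<in> s1 \<and> (x, y) \<in> s2}"
  have s: "directed_rel s" and F: "Field s = Field s1 \<times> Field s2"
    unfolding s_def by (rule directed_rel_prod[OF s1(1) s2(1)])+
  define \<rho> where "\<rho> = (\<lambda>(u, x::'a) g. blinfun_apply (inf \<bar>g\<bar> u) x :: real)"
  have "\<exists>i\<in>Field s. \<exists>d>0. \<forall>g\<in>{g. norm g \<le> 1}. \<rho> i g \<le> d \<longrightarrow> \<bar>f g\<bar> < e"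
  proof (rule net_uniformity[OF s])
    show "\<rho> i g \<le> \<rho> j g" if "(i, j) \<in> s" for i j g
    proof -
      obtain u x v y where ij: "i = (u, x)" "j = (v, y)" "0 \<le> u" "u \<le> v" "0 \<le> x" "x \<le> y"
        using \<open>(i, j) \<in> s\<close> by (auto simp: s_def s1_def s2_def)
      have "inf \<bar>g\<bar> u \<le> inf \<bar>g\<bar> v" using ij by (intro inf_mono) auto
      then have "(inf \<bar>g\<bar> u) x \<le> (inf \<bar>g\<bar> v) x" using ij(5) by (rule blinfun_leD)
      also have "\<dots> \<le> (inf \<bar>g\<bar> v) y" using ij by (intro blinfun_mono_right) (auto intro: order_trans)
      finally show ?thesis by (simp add: \<rho>_def ij)
    qed
    show "0 \<le> \<rho> i g" if "i \<in> Field s" for i g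
      using that by (auto simp: F s1(2) s2(2) \<rho>_def intro!: blinfun_nonneg)
    fix r :: "((('a \<Rightarrow>\<^sub>L real) \<times> 'a) \<times> nat) rel" and y
    assume r: "directed_rel r" and y: "y ` Field r \<subseteq> {x. norm x \<le> 1}"
      and null: "\<forall>i\<in>Field s. ((\<lambda>a. \<rho> i (y a)) \<longlongrightarrow> 0) (tails r)"
    have "bounded (y ` Field r)" using y by (auto simp: bounded_iff)
    moreover have "uaw_star_null r y"
      unfolding uaw_star_null_def
    proof (intro allI impI)
      fix u :: "'a \<Rightarrow>\<^sub>L real" and v assume u: "0 \<le> u"
      then have "((\<lambda>a. \<rho> (u, \<bar>v\<bar>) (y a)) \<longlongrightarrow> 0) (tails r)" using null by (auto simp: F s1(2) s2(2))
      then have lim: "((\<lambda>a. (inf \<bar>y a\<bar> u) \<bar>v\<bar>) \<longlongrightarrow> 0) (tails r)" by (simp add: \<rho>_def)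
      show "((\<lambda>a. (inf \<bar>y a\<bar> u) v) \<longlongrightarrow> 0) (tails r)"
      proof (rule metric_tendsto_imp_tendsto[OF lim], rule always_eventually, rule allI)
        fix a
        have "0 \<le> inf \<bar>y a\<bar> u" using u by simp
        then have "\<bar>(inf \<bar>y a\<bar> u) v\<bar> \<le> (inf \<bar>y a\<bar> u) \<bar>v\<bar>" using blinfun_abs_le[of "inf \<bar>y a\<bar> u" v] by simp
        then show "dist ((inf \<bar>y a\<bar> u) v) 0 \<le> dist ((inf \<bar>y a\<bar> u) \<bar>v\<bar>) 0" by simp
      qed
    qed
    ultimately show "((\<lambda>a. f (y a)) \<longlongrightarrow> 0) (tails r)" using uaw_star_dual_any_index[OF f r] by blast
  qed (use e in auto)
  then show thesis using that by (force simp: F s1(2) s2(2) \<rho>_def)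
qed

section \<open>Functionals continuous along uaw*-null nets\<close>

text \<open>
  Let \<open>0 \<le> k\<close> and \<open>\<parallel>k\<parallel> \<le> 1\<close>. If \<open>k x \<le> d\<close>, then \<open>F k < e\<close>; otherwise \<open>F k \<le> \<parallel>F\<parallel> \<le> n (k x)\<close> for
  \<open>n = \<parallel>F\<parallel> / d\<close>. So \<open>(F\<^sup>+ - n x)\<^sup>+\<close> has norm at most \<open>e\<close>, and \<open>F\<^sup>+ \<sqinter> n x\<close> lies in \<open>E\<close>, because \<open>E\<close>
  is an ideal.
\<close>

lemma uaw_star_dual_pprt:
  fixes F :: "('a::banach_lattice \<Rightarrow>\<^sub>L real) \<Rightarrow>\<^sub>L real"
  assumes oc: "order_continuous_norm TYPE('a)" and F: "blinfun_apply F \<in> uaw_star_dual"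
  shows "sup F 0 \<in> range embed"
proof (rule range_embed_approx)
  fix e :: real assume e: "0 < e"
  obtain u x d where u: "0 \<le> u" and x: "0 \<le> x" and d: "0 < d"
    and small: "\<And>g. norm g \<le> 1 \<Longrightarrow> blinfun_apply (inf \<bar>g\<bar> u) x \<le> d \<Longrightarrow> \<bar>F g\<bar> < e"
    using uaw_star_dual_uniform[OF F e] by blast
  define n where "n = norm F / d"
  have n: "0 \<le> n" "n * d = norm F" using d by (simp_all add: n_def)
  define Y where "Y = embed (n *\<^sub>R x)"
  have Y: "0 \<le> Y" using n x by (simp add: Y_def scaleR_nonneg_nonneg)
  have "inf (sup F 0) Y \<in> range embed"
    by (rule oc_interval_in_range_embed[OF oc, of _ "n *\<^sub>R x"]) (use Y in \<open>auto simp: Y_def[symmetric]\<close>)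
  then obtain z where z: "inf (sup F 0) Y = embed z" by blast
  have "sup F 0 - embed z = sup (sup F 0 - Y) 0"
    using inf_plus_sup_diff[of "sup F 0" Y] z by (metis add_diff_cancel_left')
  moreover have "norm (sup (sup F 0 - Y) 0) \<le> e"
  proof (rule norm_pos_functional_le)
    fix g :: "'a \<Rightarrow>\<^sub>L real" assume g: "0 \<le> g" "norm g \<le> 1"
    show "(sup (sup F 0 - Y) 0) g \<le> e"
    proof (rule ccontr)
      assume "\<not> ?thesis"
      then obtain h where h: "0 \<le> h" "h \<le> g" "e < (sup F 0 - Y) h"
        using functional_pprt_witness[OF g(1), of e "sup F 0 - Y"] by (auto simp: not_le)
      then have "e + n * h x < (sup F 0) h"
        by (simp add: Y_def blinfun.diff_left blinfun.scaleR_right)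
      then obtain k where k: "0 \<le> k" "k \<le> h" "e + n * h x < F k"
        using functional_pprt_witness[OF h(1)] by blast
      have "norm k \<le> norm g" using k h by (intro norm_mono) (auto intro: order_trans)
      then have k1: "norm k \<le> 1" using g by simp
      have "0 \<le> n * h x" using n blinfun_nonneg[OF h(1) x] by simp
      then have "\<not> (inf \<bar>k\<bar> u) x \<le> d" using small[OF k1] k(3) by force
      moreover have "(inf \<bar>k\<bar> u) x \<le> h x"
        using x k by (intro blinfun_leD) (auto intro: le_infI1)
      ultimately have "n * d \<le> n * h x" using n by (intro mult_left_mono) auto
      moreover have "F k \<le> norm F * 1" by (rule pos_functional_le_norm) (use k1 in auto)
      ultimately show False using k(3) n e by simp
    qed
  qed (use e in auto)
  ultimately show "\<exists>z. norm (sup F 0 - embed z) \<le> e" by metis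
qed

lemma uaw_star_dual_subset_range:
  assumes oc: "order_continuous_norm TYPE('a::banach_lattice)"
  shows "uaw_star_dual \<subseteq> range (canonical :: 'a \<Rightarrow> ('a \<Rightarrow>\<^sub>L real) \<Rightarrow> real)"
proof
  fix f :: "('a \<Rightarrow>\<^sub>L real) \<Rightarrow> real" assume f: "f \<in> uaw_star_dual"
  then have "bounded_linear f" by (simp add: uaw_star_dual_def)
  then obtain F where F: "blinfun_apply F = f" by (metis bounded_linear_Blinfun_apply)
  have "blinfun_apply (- F) \<in> uaw_star_dual"
    using f tendsto_minus[where a = "0::real"]
    by (auto simp: uaw_star_dual_def F[symmetric] blinfun.minus_left blinfun.bounded_linear_right
        bounded_linear_minus)
  then obtain w where w: "sup (- F) 0 = embed w" using uaw_star_dual_pprt[OF oc] by blast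
  obtain z where z: "sup F 0 = embed z" using uaw_star_dual_pprt[OF oc] f F by blast
  have "F = embed (z - w)" using eq_pprt_diff_pprt[of F] unfolding z w embed_diff .
  then show "f \<in> range canonical" using F by (metis canonical_embed rangeI)
qed

lemma eventually_small_of_almost_bounded:
  fixes r :: "'i rel"
  assumes r: "directed_rel r" and lim: "(h \<longlongrightarrow> (0::real)) (tails r)" and e: "0 < e"
    and le: "\<And>a. a \<in> Field r \<Longrightarrow> \<bar>g a\<bar> \<le> h a + e / 2"
  shows "\<forall>\<^sub>F a in tails r. dist (g a) (0::real) < e"
proof -
  have "\<forall>\<^sub>F a in tails r. dist (h a) 0 < e / 2" using e by (intro tendstoD[OF lim]) simp
  then show ?thesis using eventually_tails_Field[OF r] by eventually_elim (use le in fastforce)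
qed

text \<open>
  On a ball that is almost order bounded by \<open>u\<close> with respect to \<open>\<bar>x\<bar>\<close>, the value \<open>\<bar>g x\<bar>\<close> exceeds
  \<open>(\<bar>g\<bar> \<sqinter> u) \<bar>x\<bar>\<close> by at most \<open>e / 2\<close>.
\<close>

lemma range_subset_uaw_star_dual:
  assumes oc: "order_continuous_norm TYPE('a::banach_lattice)"
  shows "range (canonical :: 'a \<Rightarrow> ('a \<Rightarrow>\<^sub>L real) \<Rightarrow> real) \<subseteq> uaw_star_dual"
proof
  fix f :: "('a \<Rightarrow>\<^sub>L real) \<Rightarrow> real" assume "f \<in> range canonical"
  then obtain x where f: "f = blinfun_apply (embed x)" by (auto simp: canonical_embed)
  have "((\<lambda>a. f (g a)) \<longlongrightarrow> 0) (tails r)"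
    if r: "directed_rel r" and bdd: "bounded (g ` Field r)" and null: "uaw_star_null r g"
    for r :: "('a \<Rightarrow>\<^sub>L real) idx rel" and g
  proof (rule tendstoI)
    fix e :: real assume e: "0 < e"
    obtain M where M: "\<And>a. a \<in> Field r \<Longrightarrow> norm (g a) \<le> M" using bdd by (auto simp: bounded_iff)
    obtain u where u: "0 \<le> u" "\<And>k :: 'a \<Rightarrow>\<^sub>L real. 0 \<le> k \<Longrightarrow> norm k \<le> M \<Longrightarrow> blinfun_apply (sup (k - u) 0) \<bar>x\<bar> \<le> e / 2"
      using oc_dual_ball_almost_order_bounded[OF oc, of "\<bar>x\<bar>" "e / 2" M] e by auto
    show "\<forall>\<^sub>F a in tails r. dist (f (g a)) 0 < e"
    proof (rule eventually_small_of_almost_bounded[OF r _ e])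
      show "((\<lambda>a. (inf \<bar>g a\<bar> u) \<bar>x\<bar>) \<longlongrightarrow> 0) (tails r)" using null u by (auto simp: uaw_star_null_def)
      fix a assume a: "a \<in> Field r"
      have "\<bar>g a x\<bar> \<le> \<bar>g a\<bar> \<bar>x\<bar>" by (rule blinfun_abs_le)
      also have "\<bar>g a\<bar> \<bar>x\<bar> = (inf \<bar>g a\<bar> u) \<bar>x\<bar> + (sup (\<bar>g a\<bar> - u) 0) \<bar>x\<bar>"
        by (simp only: blinfun.add_left[symmetric] inf_plus_sup_diff)
      also have "\<dots> \<le> (inf \<bar>g a\<bar> u) \<bar>x\<bar> + e / 2" using u(2)[of "\<bar>g a\<bar>"] M[OF a] by simp
      finally show "\<bar>f (g a)\<bar> \<le> (inf \<bar>g a\<bar> u) \<bar>x\<bar> + e / 2" by (simp add: f)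
    qed
  qed
  then show "f \<in> uaw_star_dual" by (auto simp: uaw_star_dual_def f blinfun.bounded_linear_right)
qed

text \<open>
  The counterpart in \<open>E\<close>: on a ball that is almost order bounded by \<open>u\<close> with respect to \<open>\<bar>f\<bar>\<close>, a bound on
  \<open>\<bar>f\<bar> (\<bar>x\<bar> \<sqinter> u)\<close> bounds \<open>\<bar>f x\<bar>\<close> up to \<open>e / 2\<close>.
\<close>

lemma norm_dual_subset_uaw_dual:
  assumes oc: "order_continuous_norm TYPE('a::banach_lattice \<Rightarrow>\<^sub>L real)"
  shows "(norm_dual :: ('a \<Rightarrow> real) set) \<subseteq> uaw_dual"
proof
  fix f' :: "'a \<Rightarrow> real" assume "f' \<in> norm_dual"
  then have bl: "bounded_linear f'" by (simp add: norm_dual_def)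
  then obtain f where f: "blinfun_apply f = f'" by (metis bounded_linear_Blinfun_apply)
  have "((\<lambda>a. f' (x a)) \<longlongrightarrow> 0) (tails r)"
    if r: "directed_rel r" and bdd: "bounded (x ` Field r)" and null: "uaw_null r x"
    for r :: "'a idx rel" and x
  proof (rule tendstoI)
    fix e :: real assume e: "0 < e"
    obtain M where M: "\<And>a. a \<in> Field r \<Longrightarrow> norm (x a) \<le> M" using bdd by (auto simp: bounded_iff)
    obtain u where u: "0 \<le> u" "\<And>y. 0 \<le> y \<Longrightarrow> norm y \<le> M \<Longrightarrow> blinfun_apply \<bar>f\<bar> (sup (y - u) 0) \<le> e / 2"
      using oc_dual_imp_ball_almost_order_bounded[OF oc, of "\<bar>f\<bar>" "e / 2" M] e by auto
    show "\<forall>\<^sub>F a in tails r. dist (f' (x a)) 0 < e"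
    proof (rule eventually_small_of_almost_bounded[OF r _ e])
      show "((\<lambda>a. \<bar>f\<bar> (inf \<bar>x a\<bar> u)) \<longlongrightarrow> 0) (tails r)" using null u by (auto simp: uaw_null_def)
      fix a assume a: "a \<in> Field r"
      have "\<bar>f (x a)\<bar> \<le> \<bar>f\<bar> \<bar>x a\<bar>" by (rule blinfun_abs_le)
      also have "\<bar>f\<bar> \<bar>x a\<bar> = \<bar>f\<bar> (inf \<bar>x a\<bar> u) + \<bar>f\<bar> (sup (\<bar>x a\<bar> - u) 0)"
        by (simp only: blinfun.add_right[symmetric] inf_plus_sup_diff)
      also have "\<dots> \<le> \<bar>f\<bar> (inf \<bar>x a\<bar> u) + e / 2" using u(2)[of "\<bar>x a\<bar>"] M[OF a] by simp
      finally show "\<bar>f' (x a)\<bar> \<le> \<bar>f\<bar> (inf \<bar>x a\<bar> u) + e / 2" by (simp add: f)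
    qed
  qed
  then show "f' \<in> uaw_dual" using bl by (auto simp: uaw_dual_def)
qed

text \<open>
  The infimum of the net in \<open>E''\<close>; it can belong to \<open>E\<close> only if it is the infimum \<open>0\<close> there.
\<close>

lemma decreasing_net_bidual_inf:
  fixes x :: "'i \<Rightarrow> 'a::banach_lattice"
  assumes r: "directed_rel r" and x: "decreases_to_zero r x"
  obtains \<phi> :: "('a \<Rightarrow>\<^sub>L real) \<Rightarrow>\<^sub>L real" where "0 \<le> \<phi>" "\<And>a. a \<in> Field r \<Longrightarrow> \<phi> \<le> embed (x a)"
    "\<And>f e. 0 \<le> f \<Longrightarrow> 0 < e \<Longrightarrow> \<exists>a\<in>Field r. blinfun_apply f (x a) < \<phi> f + e"
    "\<phi> \<in> range embed \<Longrightarrow> \<phi> = 0"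
proof -
  note im = decreasing_image[OF r x]
  have ne: "embed ` x ` Field r \<noteq> {}" using im(1) by simp
  have pos: "0 \<le> g" if "g \<in> embed ` x ` Field r" for g using that im(2) by auto
  have dir: "\<exists>k\<in>embed ` x ` Field r. k \<le> g \<and> k \<le> h"
    if "g \<in> embed ` x ` Field r" "h \<in> embed ` x ` Field r" for g h
  proof -
    from that obtain c d where cd: "g = embed c" "h = embed d" "c \<in> x ` Field r" "d \<in> x ` Field r" by blast
    then obtain b where "b \<in> x ` Field r" "b \<le> c" "b \<le> d" using im(3) by blast
    then show ?thesis using cd by (intro bexI[of _ "embed b"]) auto
  qed
  obtain \<phi> :: "('a \<Rightarrow>\<^sub>L real) \<Rightarrow>\<^sub>L real" where \<phi>: "0 \<le> \<phi>" "\<And>g. g \<in> embed ` x ` Field r \<Longrightarrow> \<phi> \<le> g"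
    "\<And>y e. 0 \<le> y \<Longrightarrow> 0 < e \<Longrightarrow> \<exists>g\<in>embed ` x ` Field r. blinfun_apply g y < \<phi> y + e"
    using directed_functionals_inf[OF ne pos dir] by blast
  show thesis
  proof (rule that[OF \<phi>(1)])
    show "\<phi> \<le> embed (x a)" if "a \<in> Field r" for a using \<phi>(2) that by blast
    show "\<exists>a\<in>Field r. blinfun_apply f (x a) < \<phi> f + e" if "0 \<le> f" "0 < e" for f e using \<phi>(3)[OF that] by auto
    assume "\<phi> \<in> range embed"
    then obtain z where z: "\<phi> = embed z" by blast
    have "z \<le> x b" if "b \<in> Field r" for b using \<phi>(2)[of "embed (x b)"] that by (simp add: z)
    then have "z \<le> 0" using x by (auto simp: decreases_to_zero_def)
    moreover have "0 \<le> z" using \<phi>(1) by (simp add: z)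
    ultimately show "\<phi> = 0" by (simp add: z order.antisym)
  qed
qed

lemma oc_if_intervals_in_range_embed:
  assumes ideal: "\<And>(x::'a::banach_lattice) \<phi>. 0 \<le> x \<Longrightarrow> 0 \<le> \<phi> \<Longrightarrow> \<phi> \<le> embed x \<Longrightarrow> \<phi> \<in> range embed"
  shows "order_continuous_norm TYPE('a)"
proof (rule oc_if_weakly_null)
  fix r :: "'a idx rel" and x :: "'a idx \<Rightarrow> 'a" and f :: "'a \<Rightarrow>\<^sub>L real" and e :: real
  assume r: "directed_rel r" and x: "decreases_to_zero r x" and f: "0 \<le> f" and e: "0 < e"
  obtain \<phi> :: "('a \<Rightarrow>\<^sub>L real) \<Rightarrow>\<^sub>L real" where \<phi>: "0 \<le> \<phi>" "\<And>a. a \<in> Field r \<Longrightarrow> \<phi> \<le> embed (x a)"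
    "\<And>f e. 0 \<le> f \<Longrightarrow> 0 < e \<Longrightarrow> \<exists>a\<in>Field r. blinfun_apply f (x a) < \<phi> f + e"
    "\<phi> \<in> range embed \<Longrightarrow> \<phi> = 0"
    using decreasing_net_bidual_inf[OF r x] by blast
  obtain a where a: "a \<in> Field r" using directed_relD(4)[OF r] by blast
  have "0 \<le> x a" using x a by (simp add: decreases_to_zero_def)
  then have "\<phi> \<in> range embed" using \<phi>(1) \<phi>(2)[OF a] by (rule ideal)
  then have "\<phi> = 0" by (rule \<phi>(4))
  then show "\<exists>a\<in>Field r. f (x a) < e" using \<phi>(3)[OF f e] by simp
qed

text \<open>
  The uaw*-dual is an ideal of \<open>E''\<close>, since with \<open>g\<close> also \<open>\<bar>g\<bar>\<close> is a uaw*-null net and \<open>\<bar>\<phi> g\<bar> \<le> \<bar>g\<bar> x\<close>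
  for \<open>0 \<le> \<phi> \<le> x\<close>.
\<close>

lemma oc_if_uaw_star_dual_eq_range:
  assumes eq: "uaw_star_dual = range (canonical :: 'a::banach_lattice \<Rightarrow> ('a \<Rightarrow>\<^sub>L real) \<Rightarrow> real)"
  shows "order_continuous_norm TYPE('a)"
proof (rule oc_if_intervals_in_range_embed)
  fix x :: 'a and \<phi> assume x: "0 \<le> x" and \<phi>: "0 \<le> \<phi>" "\<phi> \<le> embed x"
  have xd: "canonical x \<in> uaw_star_dual" by (simp add: eq)
  have "((\<lambda>a. \<phi> (g a)) \<longlongrightarrow> 0) (tails r)"
    if r: "directed_rel r" and bdd: "bounded (g ` Field r)" and null: "uaw_star_null r g"
    for r :: "('a \<Rightarrow>\<^sub>L real) idx rel" and g
  proof -
    have "bounded ((\<lambda>a. \<bar>g a\<bar>) ` Field r)" using bdd by (auto simp: bounded_iff)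
    moreover have "uaw_star_null r (\<lambda>a. \<bar>g a\<bar>)" using null by (simp add: uaw_star_null_def)
    ultimately have "((\<lambda>a. canonical x \<bar>g a\<bar>) \<longlongrightarrow> 0) (tails r)"
      using uaw_star_dual_any_index[OF xd r] by blast
    then have lim: "((\<lambda>a. embed x \<bar>g a\<bar>) \<longlongrightarrow> 0) (tails r)" by (simp only: canonical_embed)
    show ?thesis
    proof (rule metric_tendsto_imp_tendsto[OF lim], rule always_eventually, rule allI)
      fix a
      have "\<bar>\<phi> (g a)\<bar> \<le> \<phi> \<bar>g a\<bar>" using blinfun_abs_le[of \<phi> "g a"] \<phi>(1) by simp
      also have "\<dots> \<le> embed x \<bar>g a\<bar>" using \<phi>(2) by (rule blinfun_leD) simp
      finally show "dist (\<phi> (g a)) 0 \<le> dist (embed x \<bar>g a\<bar>) 0" by simp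
    qed
  qed
  then have "blinfun_apply \<phi> \<in> uaw_star_dual"
    by (auto simp: uaw_star_dual_def blinfun.bounded_linear_right)
  then obtain y where "blinfun_apply \<phi> = blinfun_apply (embed y)" unfolding eq by (auto simp: canonical_embed)
  then show "\<phi> \<in> range embed" by (auto simp: blinfun_apply_inject)
qed

section \<open>Disjoint, un-null and uaw-null nets\<close>

lemma inf_pprt_nprt: "inf (sup a 0) (sup (- a) 0) = (0::'a::lattice_ab_group_add)"
proof -
  have "inf (sup a 0) (sup (- a) 0) = sup a 0 + inf 0 (sup (- a) 0 - sup a 0)"
    using add_inf_distrib_left[of "sup a 0" 0 "sup (- a) 0 - sup a 0"] by (simp only: add_0_right add_diff_cancel_left' diff_add_cancel add.commute[of "sup a 0" "sup (- a) 0 - sup a 0"])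
  also have "sup (- a) 0 - sup a 0 = - a" using eq_pprt_diff_pprt[of a] by (metis minus_diff_eq)
  also have "inf 0 (- a) = - sup a 0" by (simp only: neg_sup_eq_inf minus_zero inf_commute)
  also have "sup a 0 + - sup a 0 = 0" by (rule add.right_inverse)
  finally show ?thesis .
qed

text \<open>
  Where \<open>x\<close> exceeds \<open>c u\<close> one has \<open>c u \<le> x\<close>. For the proof let \<open>w\<close> be the left-hand side:
  \<open>w - x\<close> is dominated both by \<open>(x - c u)\<^sup>-\<close> and by \<open>c (x - c u)\<^sup>+\<close>, which are disjoint.
\<close>

lemma inf_excess_le:
  fixes x u :: "'a::banach_lattice"
  assumes x: "0 \<le> x" and u: "0 \<le> u" and c: "1 \<le> c"
  shows "c *\<^sub>R inf (sup (x - c *\<^sub>R u) 0) u \<le> x"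
proof -
  define p where "p = sup (x - c *\<^sub>R u) 0"
  define q where "q = sup (- (x - c *\<^sub>R u)) 0"
  define w where "w = c *\<^sub>R inf p u"
  have p: "0 \<le> p" and q: "0 \<le> q" by (simp_all add: p_def q_def)
  have "w \<le> c *\<^sub>R u" unfolding w_def using c by (intro scaleR_left_mono) auto
  then have "w - x \<le> - (x - c *\<^sub>R u)" by simp
  then have 1: "w - x \<le> q" unfolding q_def by (rule le_supI1)
  have "w \<le> c *\<^sub>R p" unfolding w_def using c by (intro scaleR_left_mono) auto
  moreover have "w - x \<le> w" using x by simp
  ultimately have 2: "w - x \<le> c *\<^sub>R p" by (rule order_trans[rotated])
  have "w - x \<le> inf (c *\<^sub>R p) q" using 2 1 by (rule le_infI)
  also have "inf (c *\<^sub>R p) q \<le> inf (c *\<^sub>R p) (c *\<^sub>R q)"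
    using scaleR_right_mono[OF c q] by (intro inf_mono order_refl) simp
  also have "\<dots> = c *\<^sub>R inf p q" using c by (intro inf_scaleR[symmetric]) simp
  also have "inf p q = 0" unfolding p_def q_def by (rule inf_pprt_nprt)
  finally have "w - x \<le> 0" by simp
  then show ?thesis by (simp add: w_def p_def)
qed

lemma disjoint_add:
  fixes b p q :: "'a::lattice_ab_group_add"
  assumes "inf b p = 0" "inf b q = 0"
  shows "inf b (p + q) = 0"
proof (rule antisym)
  have pos: "0 \<le> b" "0 \<le> p" "0 \<le> q" using assms by (metis inf_le1 inf_le2)+
  show "0 \<le> inf b (p + q)" using pos by simp
  have "inf b (p + q) \<le> inf (p + b) (p + q)" using pos by (intro inf_mono) (auto simp: add_increasing)
  also have "\<dots> = p + inf b q" by (simp only: add_inf_distrib_left)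
  finally have "inf b (p + q) \<le> p" using assms by simp
  then have "inf b (p + q) \<le> inf b p" by simp
  then show "inf b (p + q) \<le> 0" using assms by simp
qed

text \<open>
  For disjoint elements sums are suprema.
\<close>

lemma disjoint_sum_le:
  fixes z :: "'i \<Rightarrow> 'a::lattice_ab_group_add"
  assumes "finite T" and z: "\<And>a. a \<in> T \<Longrightarrow> 0 \<le> z a" "\<And>a. a \<in> T \<Longrightarrow> z a \<le> u" and u: "0 \<le> u"
    and disj: "\<And>a b. a \<in> T \<Longrightarrow> b \<in> T \<Longrightarrow> a \<noteq> b \<Longrightarrow> inf (z a) (z b) = 0"
  shows "sum z T \<le> u"
proof -
  have orth: "inf b (sum z S) = 0" if "finite S" "\<forall>a\<in>S. inf b (z a) = 0" "0 \<le> b" for b S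
    using that by (induction S rule: finite_induct) (auto simp: inf_absorb2 intro: disjoint_add)
  have "sum z S \<le> u" if "S \<subseteq> T" for S
  proof -
    have "finite S" using that assms(1) by (rule finite_subset)
    then show ?thesis using that
    proof (induction S rule: finite_induct)
      case (insert b S)
      have "inf (z b) (sum z S) = 0"
      proof (rule orth)
        show "\<forall>a\<in>S. inf (z b) (z a) = 0"
        proof
          fix a assume "a \<in> S"
          then have "a \<in> T" "b \<in> T" "b \<noteq> a" using insert by auto
          then show "inf (z b) (z a) = 0" by (intro disj)
        qed
        show "finite S" by (rule insert.hyps)
        show "0 \<le> z b" using insert.prems by (intro z) simp
      qed
      then have "z b + sum z S = sup (z b) (sum z S)"
        using add_eq_inf_sup[of "z b" "sum z S"] by simp
      also have "\<dots> \<le> u" using insert.IH insert.prems z(2)[of b] by (intro le_supI) auto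
      finally show ?case using insert.hyps by simp
    qed (simp add: u)
  qed
  then show ?thesis by simp
qed

text \<open>
  Some \<open>b\<close> lies above all of \<open>J\<close> and above an index that is not below the upper bound \<open>m\<close> of \<open>J\<close>. An element of
  \<open>J\<close> above \<open>b\<close> would put that index below \<open>m\<close>.
\<close>

lemma eventually_outside_finite:
  assumes r: "directed_rel r" "no_greatest r" and J: "finite J" "J \<subseteq> Field r"
  shows "\<forall>\<^sub>F a in tails r. a \<notin> J"
proof -
  have "\<exists>m\<in>Field r. \<forall>a\<in>J. (a, m) \<in> r"
    using J
  proof (induction J rule: finite_induct)
    case empty
    then show ?case using directed_relD(4)[OF r(1)] by auto
  next
    case (insert b J)
    then obtain m where m: "m \<in> Field r" "\<forall>a\<in>J. (a, m) \<in> r" by auto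
    obtain k where k: "(b, k) \<in> r" "(m, k) \<in> r" using directed_relD(3)[OF r(1), of b m] insert m by auto
    then show ?case using m directed_relD(2)[OF r(1)] by (intro bexI[of _ k]) (auto intro: FieldI2)
  qed
  then obtain m where m: "m \<in> Field r" "\<forall>a\<in>J. (a, m) \<in> r" by blast
  obtain a where a: "a \<in> Field r" "(a, m) \<notin> r" using r(2) m(1) by (auto simp: no_greatest_def)
  obtain b where b: "(a, b) \<in> r" "(m, b) \<in> r" using directed_relD(3)[OF r(1) a(1) m(1)] by blast
  have "c \<notin> J" if "(b, c) \<in> r" for c
    using directed_relD(2)[OF r(1)] a b m that by blast
  then show ?thesis using b(1) by (auto simp: eventually_tails[OF r(1)] intro: FieldI2)
qed

text \<open>
  The elements \<open>\<bar>x a\<bar> \<sqinter> u\<close> are disjoint in \<open>[0, u]\<close>, so \<open>\<bar>f\<bar>\<close> is at least \<open>e\<close> at no more than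
  \<open>\<bar>f\<bar> u / e\<close> of them.
\<close>

lemma disjoint_net_uaw_null:
  fixes x :: "'i \<Rightarrow> 'a::banach_lattice"
  assumes r: "directed_rel r" "no_greatest r" and x: "disjoint_net r x"
  shows "uaw_null r x"
  unfolding uaw_null_def
proof (intro allI impI tendstoI)
  fix u :: 'a and f :: "'a \<Rightarrow>\<^sub>L real" and e :: real assume u: "0 \<le> u" and e: "0 < e"
  define z where "z a = inf \<bar>x a\<bar> u" for a
  have z: "0 \<le> z a" "z a \<le> u" for a using u by (simp_all add: z_def)
  define J where "J = {a \<in> Field r. e \<le> \<bar>f\<bar> (z a)}"
  have "finite J"
  proof (rule ccontr)
    assume "infinite J"
    obtain n :: nat where n: "\<bar>f\<bar> u < real n * e" using e reals_Archimedean3 by blast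
    obtain T where T: "finite T" "card T = n" "T \<subseteq> J"
      using \<open>infinite J\<close> infinite_arbitrarily_large by blast
    have "real n * e = (\<Sum>a\<in>T. e)" using T by simp
    also have "\<dots> \<le> (\<Sum>a\<in>T. \<bar>f\<bar> (z a))" using T by (intro sum_mono) (auto simp: J_def)
    also have "\<dots> = \<bar>f\<bar> (sum z T)" by (simp add: blinfun.sum_right)
    also have "\<dots> \<le> \<bar>f\<bar> u"
    proof (intro blinfun_mono_right disjoint_sum_le T z u)
      fix a b assume "a \<in> T" "b \<in> T" "a \<noteq> b"
      then have "inf \<bar>x a\<bar> \<bar>x b\<bar> = 0" using x T by (auto simp: disjoint_net_def J_def)
      moreover have "inf (z a) (z b) \<le> inf \<bar>x a\<bar> \<bar>x b\<bar>" by (intro inf_mono) (auto simp: z_def)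
      ultimately show "inf (z a) (z b) = 0" using z by (simp add: order.antisym)
    qed simp
    finally show False using n by simp
  qed
  then have "\<forall>\<^sub>F a in tails r. a \<notin> J" by (intro eventually_outside_finite r) (auto simp: J_def)
  then show "\<forall>\<^sub>F a in tails r. dist (f (inf \<bar>x a\<bar> u)) 0 < e"
    using eventually_tails_Field[OF r(1)]
  proof eventually_elim
    case (elim a)
    have "\<bar>f (z a)\<bar> \<le> \<bar>f\<bar> (z a)" using blinfun_abs_le[of f "z a"] z by simp
    then show ?case using elim by (simp add: J_def z_def)
  qed
qed

lemma un_null_uaw_null:
  fixes x :: "'i \<Rightarrow> 'a::banach_lattice"
  shows "un_null r x \<Longrightarrow> uaw_null r x"
  unfolding un_null_def uaw_null_def
proof (intro allI impI)
  fix u :: 'a and f :: "'a \<Rightarrow>\<^sub>L real" assume un: "\<forall>u\<ge>0. ((\<lambda>a. inf \<bar>x a\<bar> u) \<longlongrightarrow> 0) (tails r)" and u: "0 \<le> u"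
  have "((\<lambda>a. f (inf \<bar>x a\<bar> u)) \<longlongrightarrow> f 0) (tails r)" using un u by (intro tendsto_intros) auto
  then show "((\<lambda>a. f (inf \<bar>x a\<bar> u)) \<longlongrightarrow> 0) (tails r)" by simp
qed

lemma uaw_dual_subset_un_dual: "uaw_dual \<subseteq> un_dual"
  by (auto simp: uaw_dual_def un_dual_def un_null_uaw_null)

lemma uaw_dual_subset_d_dual: "uaw_dual \<subseteq> d_dual"
  by (auto simp: uaw_dual_def d_dual_def disjoint_net_uaw_null)

lemma duals_subset_norm_dual: "uaw_dual \<subseteq> norm_dual" "d_dual \<subseteq> norm_dual" "un_dual \<subseteq> norm_dual"
  by (auto simp: uaw_dual_def d_dual_def un_dual_def norm_dual_def)

text \<open>
  For \<open>y\<close> in the unit ball the excess \<open>p = (y - c u)\<^sup>+\<close> satisfies \<open>\<parallel>p \<sqinter> u\<parallel> \<le> 1 / c\<close>; so \<open>f p\<close> is small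
  as soon as \<open>1 / c \<le> d\<close> for the \<open>d\<close> belonging to \<open>e\<close>.
\<close>

lemma un_dual_almost_order_bounded:
  fixes f :: "'a::banach_lattice \<Rightarrow>\<^sub>L real"
  assumes f: "blinfun_apply f \<in> un_dual" and e: "0 < e"
  obtains v where "0 \<le> v" "\<And>y. 0 \<le> y \<Longrightarrow> norm y \<le> 1 \<Longrightarrow> f (sup (y - v) 0) < e"
proof -
  obtain u d where u: "0 \<le> u" and d: "0 < d"
    and small: "\<And>x. norm x \<le> 1 \<Longrightarrow> norm (inf \<bar>x\<bar> u) \<le> d \<Longrightarrow> \<bar>f x\<bar> < e"
    using un_dual_uniform[OF f e] by blast
  define c where "c = max 1 (1 / d)"
  have c: "1 \<le> c" "1 / d \<le> c" by (simp_all add: c_def)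
  show thesis
  proof (rule that[of "c *\<^sub>R u"])
    show "0 \<le> c *\<^sub>R u" using c u by (simp add: scaleR_nonneg_nonneg)
    fix y :: 'a assume y: "0 \<le> y" "norm y \<le> 1"
    define p where "p = sup (y - c *\<^sub>R u) 0"
    have "y - c *\<^sub>R u \<le> y" using c u by (simp add: scaleR_nonneg_nonneg)
    then have p: "0 \<le> p" "p \<le> y" using y by (simp_all add: p_def)
    then have p1: "norm p \<le> 1" using norm_mono[of p y] y by simp
    have "c *\<^sub>R inf p u \<le> y" unfolding p_def using y(1) u c(1) by (rule inf_excess_le)
    then have "norm (c *\<^sub>R inf p u) \<le> norm y"
      using p u c by (intro norm_mono) (auto simp: scaleR_nonneg_nonneg)
    then have "c * norm (inf p u) \<le> 1" using c y by simp
    moreover have "1 / d * norm (inf p u) \<le> c * norm (inf p u)" using c by (intro mult_right_mono) auto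
    ultimately have "1 / d * norm (inf p u) \<le> 1" by linarith
    then have "norm (inf p u) \<le> d" using d by (simp add: field_simps)
    then show "f (sup (y - c *\<^sub>R u) 0) < e" using small[of p] p p1 by (simp add: p_def)
  qed
qed

text \<open>
  Let \<open>f\<^sub>\<alpha> \<down> 0\<close>. On the positive part of the unit ball \<open>f\<^sub>\<alpha> y \<le> f\<^sub>\<alpha> v + f\<^sub>\<alpha> ((y - v)\<^sup>+)\<close>. The last
  term is small by the choice of \<open>v\<close> for one \<open>f\<^sub>\<alpha>\<close>, hence for all later ones; the first tends to \<open>0\<close>.
\<close>

lemma oc_dual_if_un_dual_eq:
  assumes eq: "(un_dual :: ('a::banach_lattice \<Rightarrow> real) set) = norm_dual"
  shows "order_continuous_norm TYPE('a \<Rightarrow>\<^sub>L real)"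
proof (rule order_continuous_normI)
  fix r :: "('a \<Rightarrow>\<^sub>L real) idx rel" and x :: "('a \<Rightarrow>\<^sub>L real) idx \<Rightarrow> 'a \<Rightarrow>\<^sub>L real" and e :: real
  assume r: "directed_rel r" and x: "decreases_to_zero r x" and e: "0 < e"
  obtain a where a: "a \<in> Field r" using directed_relD(4)[OF r] by blast
  have "blinfun_apply (x a) \<in> un_dual" unfolding eq by (simp add: norm_dual_def blinfun.bounded_linear_right)
  then obtain v where v: "0 \<le> v" "\<And>y. 0 \<le> y \<Longrightarrow> norm y \<le> 1 \<Longrightarrow> x a (sup (y - v) 0) < e / 4"
    using un_dual_almost_order_bounded[of "x a" "e / 4"] e by auto
  obtain b where b: "b \<in> Field r" "x b v < e / 4"
    using decreasing_functionals_pointwise[OF r x v(1), of "e / 4"] e by auto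
  obtain c where c: "(a, c) \<in> r" "(b, c) \<in> r" using directed_relD(3)[OF r a b(1)] by blast
  then have xc: "x c \<le> x a" "x c \<le> x b" "c \<in> Field r" "0 \<le> x c"
    using x by (auto simp: decreases_to_zero_def intro: FieldI2)
  have "norm (x c) \<le> e / 2"
  proof (rule norm_pos_functional_le[OF xc(4)])
    fix y :: 'a assume y: "0 \<le> y" "norm y \<le> 1"
    have "x c y = x c (inf y v) + x c (sup (y - v) 0)"
      by (simp only: blinfun.add_right[symmetric] inf_plus_sup_diff)
    also have "x c (inf y v) \<le> x c v" by (rule blinfun_mono_right[OF xc(4)]) simp
    also have "x c v \<le> x b v" using xc(2) v(1) by (rule blinfun_leD)
    also have "x c (sup (y - v) 0) \<le> x a (sup (y - v) 0)" using xc(1) by (rule blinfun_leD) simp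
    finally show "x c y \<le> e / 2" using b(2) v(2)[OF y] by simp
  qed (use e in simp)
  then show "\<exists>a\<in>Field r. norm (x a) < e" using xc(3) e by (intro bexI[of _ c]) auto
qed

section \<open>The uo-dual\<close>

lemma nonneg_summable_le_suminf:
  fixes z :: "nat \<Rightarrow> 'a::banach_lattice"
  assumes z: "summable z" "\<And>n. 0 \<le> z n"
  shows "z n \<le> suminf z"
proof (rule tendsto_lower_bound_lattice[OF summable_LIMSEQ[OF z(1)]])
  have "z n \<le> sum z {..<m}" if "Suc n \<le> m" for m
    using that z(2) sum_mono2[of "{..<m}" "{n}" z] by simp
  then show "\<forall>\<^sub>F m in sequentially. z n \<le> sum z {..<m}" by (auto simp: eventually_sequentially)
qed simp

text \<open>
  An unbounded \<open>f\<close> has values above \<open>1\<close> on elements of norm \<open>4\<^sup>-\<^sup>n\<close>. Such elements form an order null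
  sequence: with \<open>w\<close> the sum of the elements \<open>2\<^sup>n \<bar>y n\<bar>\<close> one has \<open>\<bar>y n\<bar> \<le> w / 2\<^sup>n\<close>.
\<close>

lemma uo_dual_subset_norm_dual: "uo_dual \<subseteq> (norm_dual :: ('a::banach_lattice \<Rightarrow> real) set)"
proof
  fix f :: "'a \<Rightarrow> real" assume f: "f \<in> uo_dual"
  then have lin: "linear f" by (simp add: uo_dual_def)
  have "\<exists>K. \<forall>x. norm (f x) \<le> norm x * K"
  proof (rule ccontr)
    assume no: "\<not> ?thesis"
    have "\<forall>n::nat. \<exists>y. norm y = 1 / 4 ^ n \<and> 1 < \<bar>f y\<bar>"
    proof
      fix n :: nat
      obtain x where x: "norm x * 4 ^ n < \<bar>f x\<bar>" using no by (auto simp: not_le)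
      then have "f x \<noteq> 0" by (smt (verit) mult_nonneg_nonneg norm_ge_zero zero_le_power)
      then have "x \<noteq> 0" using linear_0[OF lin] by auto
      then have pos: "0 < norm x * 4 ^ n" by simp
      have "\<bar>f (inverse (norm x * 4 ^ n) *\<^sub>R x)\<bar> = \<bar>f x\<bar> / (norm x * 4 ^ n)"
        using pos by (simp add: linear_cmul[OF lin] abs_mult field_simps)
      also have "1 < \<bar>f x\<bar> / (norm x * 4 ^ n)" using x pos by (simp add: less_divide_eq)
      finally have "1 < \<bar>f (inverse (norm x * 4 ^ n) *\<^sub>R x)\<bar>" .
      moreover have "norm (inverse (norm x * 4 ^ n) *\<^sub>R x) = 1 / 4 ^ n"
        using \<open>x \<noteq> 0\<close> by (simp add: field_simps)
      ultimately show "\<exists>y. norm y = 1 / 4 ^ n \<and> 1 < \<bar>f y\<bar>" by blast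
    qed
    then have "\<exists>y. \<forall>n::nat. norm (y n) = 1 / 4 ^ n \<and> 1 < \<bar>f (y n)\<bar>" by (rule choice)
    then obtain y :: "nat \<Rightarrow> 'a" where y: "\<And>n. norm (y n) = 1 / 4 ^ n" "\<And>n. 1 < \<bar>f (y n)\<bar>" by blast
    define z where "z n = 2 ^ n *\<^sub>R \<bar>y n\<bar>" for n
    have nz: "norm (z n) = (1/2) ^ n" for n
    proof -
      have "norm (z n) = 2 ^ n / (2 * 2) ^ n" by (simp add: z_def y)
      also have "\<dots> = (1/2) ^ n" unfolding power_mult_distrib by (simp add: power_one_over)
      finally show ?thesis .
    qed
    have "summable z" by (rule summable_norm_cancel) (simp add: nz summable_geometric)
    then have z_le: "z n \<le> suminf z" for n by (rule nonneg_summable_le_suminf) (simp add: z_def scaleR_nonneg_nonneg)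
    define w where "w = suminf z"
    have "0 \<le> z 0" by (simp add: z_def)
    then have w: "0 \<le> w" unfolding w_def using z_le by (rule order_trans)
    define b where "b n = (1/2) ^ n *\<^sub>R w" for n :: nat
    have y_le: "\<bar>y n\<bar> \<le> b n" for n
    proof -
      have "(1/2) ^ n *\<^sub>R z n \<le> (1/2) ^ n *\<^sub>R w" unfolding w_def by (intro scaleR_left_mono z_le) simp
      moreover have "(1/2) ^ n *\<^sub>R z n = \<bar>y n\<bar>" by (simp add: z_def power_mult_distrib[symmetric])
      ultimately show ?thesis by (simp add: b_def)
    qed
    define r where "r = {(m, n::nat). m \<le> n}"
    have r: "directed_rel r" "Field r = UNIV" unfolding r_def by (rule directed_nat)+
    have b_dec: "b n \<le> b m" if "m \<le> n" for m n
      unfolding b_def using that w by (intro scaleR_right_mono power_decreasing) auto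
    have "decreases_to_zero r b"
      unfolding decreases_to_zero_def
    proof (intro conjI allI impI)
      show "\<forall>(m, n)\<in>r. b n \<le> b m" using b_dec by (auto simp: r_def)
      show "\<forall>n\<in>Field r. 0 \<le> b n" using w by (simp add: b_def scaleR_nonneg_nonneg)
      fix v assume v: "\<forall>n\<in>Field r. v \<le> b n"
      have "b \<longlonglongrightarrow> 0 *\<^sub>R w" unfolding b_def by (intro tendsto_intros LIMSEQ_power_zero) simp
      then have "b \<longlonglongrightarrow> 0" by simp
      then show "v \<le> 0" by (rule tendsto_lower_bound_lattice) (use v r in auto)
    qed
    then have "uo_null r y"
      unfolding uo_null_def
    proof (intro allI impI order_converges_any_index[OF r(1)])
      fix u :: 'a and m assume u: "0 \<le> u"
      have "\<bar>inf \<bar>y n\<bar> u - 0\<bar> \<le> b m" if "(m, n) \<in> r" for n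
      proof -
        have "inf \<bar>y n\<bar> u \<le> \<bar>y n\<bar>" by simp
        also have "\<dots> \<le> b n" by (rule y_le)
        also have "\<dots> \<le> b m" using that by (intro b_dec) (simp add: r_def)
        finally show ?thesis using u by simp
      qed
      then show "\<forall>\<^sub>F n in tails r. \<bar>inf \<bar>y n\<bar> u - 0\<bar> \<le> b m"
        using r by (auto simp: eventually_tails)
    qed
    moreover have "bounded (y ` Field r)"
      unfolding bounded_iff by (intro exI[of _ 1]) (auto simp: y divide_le_eq)
    ultimately have "((\<lambda>n. f (y n)) \<longlongrightarrow> 0) (tails r)" using uo_dual_any_index[OF f r(1)] by blast
    then have "\<forall>\<^sub>F n in tails r. dist (f (y n)) 0 < 1" by (rule tendstoD) simp
    then obtain n where "\<bar>f (y n)\<bar> < 1" using eventually_tails_ex[OF r(1)] by fastforce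
    then show False using y(2)[of n] by simp
  qed
  then have "bounded_linear f"
    using lin by (auto simp: bounded_linear_def bounded_linear_axioms_def)
  then show "f \<in> norm_dual" by (simp add: norm_dual_def)
qed

text \<open>
  An order continuous norm makes uo-null nets un-null.
\<close>

lemma un_dual_subset_uo_dual:
  assumes oc: "order_continuous_norm TYPE('a::banach_lattice)"
  shows "(un_dual :: ('a \<Rightarrow> real) set) \<subseteq> uo_dual"
proof -
  have "un_null r x" if r: "directed_rel r" and uo: "uo_null r x"
    for r :: "'a idx rel" and x :: "'a idx \<Rightarrow> 'a"
    unfolding un_null_def
  proof (intro allI impI tendstoI)
    fix u :: 'a and e :: real assume "0 \<le> u" and e: "0 < e"
    then obtain s :: "'a idx rel" and y where s: "directed_rel s" "decreases_to_zero s y"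
      and ev: "\<And>b. b \<in> Field s \<Longrightarrow> \<forall>\<^sub>F a in tails r. \<bar>inf \<bar>x a\<bar> u - 0\<bar> \<le> y b"
      using uo unfolding uo_null_def order_converges_def by blast
    have "\<forall>\<^sub>F b in tails s. dist (norm (y b)) 0 < e"
      using order_continuous_norm_any_index[OF oc s] e by (rule tendstoD)
    then obtain b where b: "b \<in> Field s" "norm (y b) < e" using eventually_tails_ex[OF s(1)] by fastforce
    show "\<forall>\<^sub>F a in tails r. dist (inf \<bar>x a\<bar> u) 0 < e"
      using ev[OF b(1)]
    proof eventually_elim
      case (elim a)
      then have "norm \<bar>inf \<bar>x a\<bar> u - 0\<bar> \<le> norm (y b)" by (intro norm_mono) auto
      then show ?case using b by simp
    qed
  qed
  then show ?thesis by (auto simp: un_dual_def uo_dual_def bounded_linear.linear)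
qed

text \<open>
  The net \<open>x b \<sqinter> x a\<close>, for a fixed index \<open>a\<close>, is bounded, agrees with \<open>x\<close> from \<open>a\<close> on, and is uo-null because it
  decreases to \<open>0\<close>.
\<close>

lemma oc_if_uo_dual_eq:
  assumes eq: "(uo_dual :: ('a::banach_lattice \<Rightarrow> real) set) = norm_dual"
  shows "order_continuous_norm TYPE('a)"
proof (rule oc_if_weakly_null)
  fix r :: "'a idx rel" and x :: "'a idx \<Rightarrow> 'a" and f :: "'a \<Rightarrow>\<^sub>L real" and e :: real
  assume r: "directed_rel r" and x: "decreases_to_zero r x" and f: "0 \<le> f" and e: "0 < e"
  have fu: "blinfun_apply f \<in> uo_dual" unfolding eq by (simp add: norm_dual_def blinfun.bounded_linear_right)
  obtain a where a: "a \<in> Field r" using directed_relD(4)[OF r] by blast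
  have x_pos: "0 \<le> x b" if "b \<in> Field r" for b using x that by (auto simp: decreases_to_zero_def)
  define y where "y b = inf (x b) (x a)" for b
  have y_pos: "0 \<le> y b" if "b \<in> Field r" for b using x_pos that a by (simp add: y_def)
  have y_le: "y b \<le> x b" for b by (simp add: y_def)
  have y_dec: "y c \<le> y b" if "(b, c) \<in> r" for b c
    unfolding y_def using x that by (intro inf_mono) (auto simp: decreases_to_zero_def)
  have "decreases_to_zero r y"
    unfolding decreases_to_zero_def
  proof (intro conjI allI impI)
    fix z assume "\<forall>b\<in>Field r. z \<le> y b"
    then have "\<forall>b\<in>Field r. z \<le> x b" using y_le order_trans by blast
    then show "z \<le> 0" using x by (auto simp: decreases_to_zero_def)
  qed (use y_dec y_pos in auto)
  then have "uo_null r y"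
    unfolding uo_null_def
  proof (intro allI impI order_converges_any_index[OF r])
    fix u :: 'a and b assume u: "0 \<le> u" and b: "b \<in> Field r"
    have "\<bar>inf \<bar>y c\<bar> u - 0\<bar> \<le> y b" if "(b, c) \<in> r" for c
    proof -
      have "\<bar>y c\<bar> = y c" using that by (intro abs_of_nonneg y_pos) (rule FieldI2)
      then have "inf \<bar>y c\<bar> u \<le> y c" by simp
      also have "\<dots> \<le> y b" using that by (rule y_dec)
      finally show ?thesis using u by simp
    qed
    then show "\<forall>\<^sub>F c in tails r. \<bar>inf \<bar>y c\<bar> u - 0\<bar> \<le> y b" using b by (auto simp: eventually_tails[OF r])
  qed
  moreover have "norm (y b) \<le> norm (x a)" if "b \<in> Field r" for b
    using y_pos[OF that] by (intro norm_mono) (auto simp: y_def)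
  then have "bounded (y ` Field r)" unfolding bounded_iff by (intro exI[of _ "norm (x a)"]) blast
  ultimately have "((\<lambda>b. f (y b)) \<longlongrightarrow> 0) (tails r)" using uo_dual_any_index[OF fu r] by blast
  then have "\<forall>\<^sub>F b in tails r. dist (f (y b)) 0 < e" using e by (rule tendstoD)
  then obtain b where b: "b \<in> Field r" "\<And>c. (b, c) \<in> r \<Longrightarrow> \<bar>f (y c)\<bar> < e"
    by (auto simp: eventually_tails[OF r])
  obtain c where c: "(a, c) \<in> r" "(b, c) \<in> r" using directed_relD(3)[OF r a b(1)] by blast
  have "x c \<le> x a" using x c(1) by (auto simp: decreases_to_zero_def)
  then have "y c = x c" by (simp add: y_def inf_absorb1)
  then have "f (x c) < e" using b(2)[OF c(2)] by simp
  then show "\<exists>a\<in>Field r. f (x a) < e" using FieldI2[OF c(1)] by blast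
qed

section \<open>Equality of the duals\<close>

lemma oc_dual_iff_duals_eq:
  "order_continuous_norm TYPE('a::banach_lattice \<Rightarrow>\<^sub>L real) \<longleftrightarrow>
    (uaw_dual :: ('a \<Rightarrow> real) set) = d_dual \<and> (d_dual :: ('a \<Rightarrow> real) set) = un_dual
    \<and> (un_dual :: ('a \<Rightarrow> real) set) = norm_dual"
proof
  assume "order_continuous_norm TYPE('a \<Rightarrow>\<^sub>L real)"
  then have "(norm_dual :: ('a \<Rightarrow> real) set) \<subseteq> uaw_dual" by (rule norm_dual_subset_uaw_dual)
  then show "(uaw_dual :: ('a \<Rightarrow> real) set) = d_dual \<and> (d_dual :: ('a \<Rightarrow> real) set) = un_dual
    \<and> (un_dual :: ('a \<Rightarrow> real) set) = norm_dual"
    using uaw_dual_subset_un_dual uaw_dual_subset_d_dual duals_subset_norm_dual by blast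
qed (simp add: oc_dual_if_un_dual_eq)

lemma oc_both_iff_duals_eq:
  "order_continuous_norm TYPE('a::banach_lattice) \<and> order_continuous_norm TYPE('a \<Rightarrow>\<^sub>L real) \<longleftrightarrow>
    (uo_dual :: ('a \<Rightarrow> real) set) = uaw_dual \<and> (uaw_dual :: ('a \<Rightarrow> real) set) = d_dual
    \<and> (d_dual :: ('a \<Rightarrow> real) set) = un_dual \<and> (un_dual :: ('a \<Rightarrow> real) set) = norm_dual"
proof
  assume oc: "order_continuous_norm TYPE('a) \<and> order_continuous_norm TYPE('a \<Rightarrow>\<^sub>L real)"
  then have "(uaw_dual :: ('a \<Rightarrow> real) set) = d_dual \<and> (d_dual :: ('a \<Rightarrow> real) set) = un_dual
    \<and> (un_dual :: ('a \<Rightarrow> real) set) = norm_dual" using oc_dual_iff_duals_eq by blast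
  moreover have "(un_dual :: ('a \<Rightarrow> real) set) \<subseteq> uo_dual" using oc un_dual_subset_uo_dual by blast
  ultimately show "(uo_dual :: ('a \<Rightarrow> real) set) = uaw_dual \<and> (uaw_dual :: ('a \<Rightarrow> real) set) = d_dual
    \<and> (d_dual :: ('a \<Rightarrow> real) set) = un_dual \<and> (un_dual :: ('a \<Rightarrow> real) set) = norm_dual"
    using uo_dual_subset_norm_dual by blast
next
  assume eq: "(uo_dual :: ('a \<Rightarrow> real) set) = uaw_dual \<and> (uaw_dual :: ('a \<Rightarrow> real) set) = d_dual
    \<and> (d_dual :: ('a \<Rightarrow> real) set) = un_dual \<and> (un_dual :: ('a \<Rightarrow> real) set) = norm_dual"
  then show "order_continuous_norm TYPE('a) \<and> order_continuous_norm TYPE('a \<Rightarrow>\<^sub>L real)"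
    using oc_if_uo_dual_eq oc_dual_if_un_dual_eq by metis
qed

section \<open>Reflexivity\<close>

lemma reflexive_space_iff: "reflexive_space TYPE('a::real_normed_vector) \<longleftrightarrow> surj (embed :: 'a \<Rightarrow> _)"
proof -
  have r: "range canonical = blinfun_apply ` range (embed :: 'a \<Rightarrow> _)"
    by (auto simp: canonical_embed image_def fun_eq_iff)
  have n: "norm_dual = range (blinfun_apply :: (('a \<Rightarrow>\<^sub>L real) \<Rightarrow>\<^sub>L real) \<Rightarrow> _)"
    by (auto simp: norm_dual_def blinfun.bounded_linear_right)
      (metis bounded_linear_Blinfun_apply rangeI)
  have "inj (blinfun_apply :: (('a \<Rightarrow>\<^sub>L real) \<Rightarrow>\<^sub>L real) \<Rightarrow> _)" by (auto intro: injI simp: blinfun_apply_inject)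
  then show ?thesis unfolding reflexive_space_def r n by (simp add: inj_image_eq_iff)
qed

text \<open>
  A functional \<open>\<Lambda>\<close> on \<open>E''\<close> is evaluation at its restriction to \<open>E\<close> when \<open>E\<close> is all of \<open>E''\<close>.
\<close>

lemma reflexive_dual:
  assumes "surj (embed :: 'a::real_normed_vector \<Rightarrow> _)"
  shows "surj (embed :: ('a \<Rightarrow>\<^sub>L real) \<Rightarrow> _)"
proof (rule surjI)
  fix \<Lambda> :: "(('a \<Rightarrow>\<^sub>L real) \<Rightarrow>\<^sub>L real) \<Rightarrow>\<^sub>L real"
  have bl: "bounded_linear (\<lambda>x::'a. \<Lambda> (embed x))"
  proof (rule bounded_linear_intro)
    show "norm (\<Lambda> (embed x)) \<le> norm x * norm \<Lambda>" for x :: 'a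
      using norm_blinfun[of \<Lambda> "embed x"] by (simp add: mult.commute)
  qed (simp_all add: embed_add embed_scaleR blinfun.add_right blinfun.scaleR_right)
  show "embed (Blinfun (\<lambda>x. \<Lambda> (embed x))) = \<Lambda>"
  proof (rule blinfun_eqI)
    fix \<phi> :: "('a \<Rightarrow>\<^sub>L real) \<Rightarrow>\<^sub>L real"
    obtain x where "\<phi> = embed x" using assms by (meson surjD)
    then show "embed (Blinfun (\<lambda>x. \<Lambda> (embed x))) \<phi> = \<Lambda> \<phi>"
      by (simp add: bounded_linear_Blinfun_apply[OF bl])
  qed
qed

lemma oc_if_surj_embed:
  assumes "surj (embed :: 'a::banach_lattice \<Rightarrow> _)"
  shows "order_continuous_norm TYPE('a)"
  by (rule oc_if_intervals_in_range_embed) (simp add: assms)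

text \<open>
  A net \<open>x\<^sub>\<alpha> \<down> 0\<close> in \<open>E\<close> converges in the norm of \<open>E''\<close> to its infimum there. Since \<open>E\<close> is closed
  in \<open>E''\<close>, this infimum belongs to \<open>E\<close> and is \<open>0\<close>.
\<close>

lemma oc_if_bidual_oc:
  assumes oc: "order_continuous_norm TYPE(('a::banach_lattice \<Rightarrow>\<^sub>L real) \<Rightarrow>\<^sub>L real)"
  shows "order_continuous_norm TYPE('a)"
proof (rule order_continuous_normI)
  fix r :: "'a idx rel" and x :: "'a idx \<Rightarrow> 'a" and e :: real
  assume r: "directed_rel r" and x: "decreases_to_zero r x" and e: "0 < e"
  obtain \<phi> :: "('a \<Rightarrow>\<^sub>L real) \<Rightarrow>\<^sub>L real" where \<phi>: "0 \<le> \<phi>" "\<And>a. a \<in> Field r \<Longrightarrow> \<phi> \<le> embed (x a)"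
    "\<And>f e. 0 \<le> f \<Longrightarrow> 0 < e \<Longrightarrow> \<exists>a\<in>Field r. blinfun_apply f (x a) < \<phi> f + e"
    "\<phi> \<in> range embed \<Longrightarrow> \<phi> = 0"
    using decreasing_net_bidual_inf[OF r x] by blast
  have "decreases_to_zero r (\<lambda>a. embed (x a) - \<phi>)"
    unfolding decreases_to_zero_def
  proof (intro conjI allI impI)
    show "\<forall>(a, b)\<in>r. embed (x b) - \<phi> \<le> embed (x a) - \<phi>"
      using x by (auto simp: decreases_to_zero_def)
    show "\<forall>a\<in>Field r. 0 \<le> embed (x a) - \<phi>" using \<phi>(2) by simp
    fix z assume z: "\<forall>a\<in>Field r. z \<le> embed (x a) - \<phi>"
    show "z \<le> 0"
      unfolding less_eq_blinfun_def[of z]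
    proof (intro allI impI, rule field_le_epsilon)
      fix f :: "'a \<Rightarrow>\<^sub>L real" and d :: real assume f: "0 \<le> f" and "0 < d"
      then obtain a where a: "a \<in> Field r" "blinfun_apply f (x a) < \<phi> f + d" using \<phi>(3) by blast
      have "z f \<le> (embed (x a) - \<phi>) f" using z a(1) f by (intro blinfun_leD) auto
      then show "z f \<le> blinfun_apply 0 f + d" using a(2) by (simp add: blinfun.diff_left)
    qed
  qed
  then have lim: "((\<lambda>a. norm (embed (x a) - \<phi>)) \<longlongrightarrow> 0) (tails r)"
    by (rule order_continuous_norm_any_index[OF oc r])
  have approx: "\<exists>a\<in>Field r. norm (embed (x a) - \<phi>) < d" if "0 < d" for d
    using eventually_tails_ex[OF r tendstoD[OF lim that]] by simp
  have "\<phi> \<in> range embed"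
  proof (rule range_embed_approx)
    show "\<exists>y. norm (\<phi> - embed y) \<le> d" if "0 < d" for d
      using approx[OF that] by (metis less_imp_le norm_minus_commute)
  qed
  then have "\<phi> = 0" by (rule \<phi>(4))
  then show "\<exists>a\<in>Field r. norm (x a) < e" using approx[OF e] by simp
qed

theorem theorem2p11:
  shows "(order_continuous_norm TYPE('a::banach_lattice) \<longleftrightarrow>
      uaw_star_dual = range (canonical :: 'a \<Rightarrow> ('a \<Rightarrow>\<^sub>L real) \<Rightarrow> real))
    \<and> (order_continuous_norm TYPE('a \<Rightarrow>\<^sub>L real) \<longleftrightarrow>
      (uaw_dual :: ('a \<Rightarrow> real) set) = d_dual \<and> (d_dual :: ('a \<Rightarrow> real) set) = un_dual
      \<and> (un_dual :: ('a \<Rightarrow> real) set) = norm_dual)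
    \<and> (order_continuous_norm TYPE('a) \<and> order_continuous_norm TYPE('a \<Rightarrow>\<^sub>L real) \<longleftrightarrow>
      (uo_dual :: ('a \<Rightarrow> real) set) = uaw_dual \<and> (uaw_dual :: ('a \<Rightarrow> real) set) = d_dual
      \<and> (d_dual :: ('a \<Rightarrow> real) set) = un_dual \<and> (un_dual :: ('a \<Rightarrow> real) set) = norm_dual)
    \<and> (reflexive_space TYPE('a) \<longleftrightarrow>
      (uaw_star_dual :: (('a \<Rightarrow>\<^sub>L real) \<Rightarrow> real) set) = uo_dual
      \<and> (uo_dual :: (('a \<Rightarrow>\<^sub>L real) \<Rightarrow> real) set) = uaw_dual
      \<and> (uaw_dual :: (('a \<Rightarrow>\<^sub>L real) \<Rightarrow> real) set) = d_dual
      \<and> (d_dual :: (('a \<Rightarrow>\<^sub>L real) \<Rightarrow> real) set) = un_dual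
      \<and> (un_dual :: (('a \<Rightarrow>\<^sub>L real) \<Rightarrow> real) set) = norm_dual)"
proof -
  have one: "order_continuous_norm TYPE('a) \<longleftrightarrow>
      uaw_star_dual = range (canonical :: 'a \<Rightarrow> ('a \<Rightarrow>\<^sub>L real) \<Rightarrow> real)"
    using uaw_star_dual_subset_range range_subset_uaw_star_dual oc_if_uaw_star_dual_eq_range by blast
  have four: "reflexive_space TYPE('a) \<longleftrightarrow>
      order_continuous_norm TYPE('a \<Rightarrow>\<^sub>L real) \<and> order_continuous_norm TYPE(('a \<Rightarrow>\<^sub>L real) \<Rightarrow>\<^sub>L real)
      \<and> (uaw_star_dual :: (('a \<Rightarrow>\<^sub>L real) \<Rightarrow> real) set) = norm_dual"
  proof
    assume refl: "reflexive_space TYPE('a)"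
    then have s: "surj (embed :: 'a \<Rightarrow> _)" by (simp only: reflexive_space_iff)
    then have s': "surj (embed :: ('a \<Rightarrow>\<^sub>L real) \<Rightarrow> _)" by (rule reflexive_dual)
    then have s'': "surj (embed :: (('a \<Rightarrow>\<^sub>L real) \<Rightarrow>\<^sub>L real) \<Rightarrow> _)" by (rule reflexive_dual)
    have "uaw_star_dual = range (canonical :: 'a \<Rightarrow> ('a \<Rightarrow>\<^sub>L real) \<Rightarrow> real)"
      using one oc_if_surj_embed[OF s] by blast
    then show "order_continuous_norm TYPE('a \<Rightarrow>\<^sub>L real)
      \<and> order_continuous_norm TYPE(('a \<Rightarrow>\<^sub>L real) \<Rightarrow>\<^sub>L real)
      \<and> (uaw_star_dual :: (('a \<Rightarrow>\<^sub>L real) \<Rightarrow> real) set) = norm_dual"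
      using refl oc_if_surj_embed[OF s'] oc_if_surj_embed[OF s''] by (simp add: reflexive_space_def)
  next
    assume oc: "order_continuous_norm TYPE('a \<Rightarrow>\<^sub>L real)
      \<and> order_continuous_norm TYPE(('a \<Rightarrow>\<^sub>L real) \<Rightarrow>\<^sub>L real)
      \<and> (uaw_star_dual :: (('a \<Rightarrow>\<^sub>L real) \<Rightarrow> real) set) = norm_dual"
    then have "order_continuous_norm TYPE('a)" using oc_if_bidual_oc by blast
    then show "reflexive_space TYPE('a)" using one oc by (simp add: reflexive_space_def)
  qed
  have chain: "(b = c \<and> c = d \<and> d = e \<and> e = f) \<and> a = f \<longleftrightarrow> a = b \<and> b = c \<and> c = d \<and> d = e \<and> e = f"
    for a b c d e f :: "(('a \<Rightarrow>\<^sub>L real) \<Rightarrow> real) set"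
    by auto
  show ?thesis
  proof (intro conjI)
    have "reflexive_space TYPE('a) \<longleftrightarrow>
      (order_continuous_norm TYPE('a \<Rightarrow>\<^sub>L real) \<and> order_continuous_norm TYPE(('a \<Rightarrow>\<^sub>L real) \<Rightarrow>\<^sub>L real))
      \<and> (uaw_star_dual :: (('a \<Rightarrow>\<^sub>L real) \<Rightarrow> real) set) = norm_dual"
      by (simp only: four conj_assoc)
    then show "reflexive_space TYPE('a) \<longleftrightarrow>
      (uaw_star_dual :: (('a \<Rightarrow>\<^sub>L real) \<Rightarrow> real) set) = uo_dual
      \<and> (uo_dual :: (('a \<Rightarrow>\<^sub>L real) \<Rightarrow> real) set) = uaw_dual
      \<and> (uaw_dual :: (('a \<Rightarrow>\<^sub>L real) \<Rightarrow> real) set) = d_dual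
      \<and> (d_dual :: (('a \<Rightarrow>\<^sub>L real) \<Rightarrow> real) set) = un_dual
      \<and> (un_dual :: (('a \<Rightarrow>\<^sub>L real) \<Rightarrow> real) set) = norm_dual"
      unfolding oc_both_iff_duals_eq chain .
  qed (rule one oc_dual_iff_duals_eq oc_both_iff_duals_eq)+
qed

end
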